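(* Let $\mathcal{F}=\ast_{\alpha\in I}G_\alpha$ be the free product of torsion free groups $G_\alpha$, $\alpha\in I$. Then, for every $w\in\mathcal{F}$, the quasiperiodicity $\mathrm{qp}(w)$ and the mixed genus $\mathrm{mg}(w)$ of $w$ satisfy $$\mathrm{qp}(w)\le \mathrm{mg}(w)-2<+\infty .$$ Furthermore, $\mathrm{qp}(w)=-\infty$ if and only if $w$ is conjugate in $\mathcal{F}$ to an element of a free factor $G_\alpha$ of $\mathcal{F}$; otherwise, $\mathrm{qp}(w)\ge 0$ is finite.
   Context: Let $w$ be an element of a free product $\mathcal{F}=\ast_{\alpha\in I}G_\alpha$. A commutator is an element of the form $[x,y]=x^{-1}y^{-1}xy$. Mixed genus: a mixed commutator factorization for $w$ is an equality $w=c_1\cdots c_k d_1\cdots d_\ell$ in $\mathcal{F}$, where $k,\ell\ge 0$ (empty products are $1$), each $c_i$ is a commutator in $\mathcal{F}$ and each $d_j$ is conjugate in $\mathcal{F}$ to an element of a free factor $G_\alpha$. The mixed genus $\mathrm{mg}(w)$ is the minimal integer $s$ such that $s=2k+\ell$ over all mixed commutator factorizations for $w$. Quasiperiodicity: a quasiperiodic factorization for $w$ is an equality $w=h_1^{n_1}\cdots h_m^{n_m}$ in $\mathcal{F}$, where $m\ge 1$, the elements $h_1,\dots,h_m\in\mathcal{F}$ are conjugate to each other and are not conjugate to an element of a free factor $G_\alpha$, and $n_1,\dots,n_m$ are positive integers. The quasiperiodicity $\mathrm{qp}(w)$ is the maximal integer $r$ such that $r=\sum_{j=1}^m(n_j-1)$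 over all quasiperiodic factorizations for $w$, if such factorizations exist and the set of such $r$ is bounded above; $\mathrm{qp}(w):=+\infty$ if the set of such $r$ is not bounded above; and $\mathrm{qp}(w):=-\infty$ if $w$ has no quasiperiodic factorization. *)

theory Defs
  imports "HOL-Algebra.Group" "HOL-Library.Extended_Real"
begin

section \<open>Free products of groups\<close>

text \<open>
  The free product of a family \<open>G i\<close>, \<open>i \<in> I\<close>, is realised on reduced words: lists of letters
  \<open>(i, a)\<close> with \<open>a\<close> a nontrivial element of \<open>G i\<close> and neighbouring letters taken from
  different factors.
\<close>

definition letters :: "'i set \<Rightarrow> ('i \<Rightarrow> ('a, 'b) monoid_scheme) \<Rightarrow> ('i \<times> 'a) set" where
  "letters I G = (SIGMA i:I. carrier (G i))"

definition reduced_words :: "'i set \<Rightarrow> ('i \<Rightarrow> ('a, 'b) monoid_scheme) \<Rightarrow> ('i \<times> 'a) list set" where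
  "reduced_words I G = {u. set u \<subseteq> letters I G \<and> (\<forall>(i, a) \<in> set u. a \<noteq> \<one>\<^bsub>G i\<^esub>) \<and>
     (\<forall>k. Suc k < length u \<longrightarrow> fst (u ! k) \<noteq> fst (u ! Suc k))}"

text \<open>The reduced form of the product of a single (possibly trivial) letter and a reduced word.\<close>

fun lmult :: "('i \<Rightarrow> ('a, 'b) monoid_scheme) \<Rightarrow> 'i \<times> 'a \<Rightarrow> ('i \<times> 'a) list \<Rightarrow> ('i \<times> 'a) list" where
  "lmult G (i, a) [] = (if a = \<one>\<^bsub>G i\<^esub> then [] else [(i, a)])"
| "lmult G (i, a) ((j, b) # v) =
     (if a = \<one>\<^bsub>G i\<^esub> then (j, b) # v
      else if i = j then (if a \<otimes>\<^bsub>G i\<^esub> b = \<one>\<^bsub>G i\<^esub> then v else (i, a \<otimes>\<^bsub>G i\<^esub> b) # v)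
      else (i, a) # (j, b) # v)"

definition free_product ::
  "'i set \<Rightarrow> ('i \<Rightarrow> ('a, 'b) monoid_scheme) \<Rightarrow> ('i \<times> 'a) list monoid" where
  "free_product I G = \<lparr>carrier = reduced_words I G, mult = (\<lambda>u v. foldr (lmult G) u v), one = []\<rparr>"

text \<open>The embedding of the \<open>i\<close>-th free factor.\<close>

definition factor_emb :: "('i \<Rightarrow> ('a, 'b) monoid_scheme) \<Rightarrow> 'i \<Rightarrow> 'a \<Rightarrow> ('i \<times> 'a) list" where
  "factor_emb G i a = (if a = \<one>\<^bsub>G i\<^esub> then [] else [(i, a)])"

definition factor_elems ::
  "'i set \<Rightarrow> ('i \<Rightarrow> ('a, 'b) monoid_scheme) \<Rightarrow> ('i \<times> 'a) list set" where
  "factor_elems I G = (\<Union>i\<in>I. factor_emb G i ` carrier (G i))"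


section \<open>Torsion, conjugacy and commutators\<close>

definition torsion_free :: "('a, 'b) monoid_scheme \<Rightarrow> bool" where
  "torsion_free G \<longleftrightarrow>
     (\<forall>x \<in> carrier G. \<forall>n::nat. 0 < n \<longrightarrow> x [^]\<^bsub>G\<^esub> n = \<one>\<^bsub>G\<^esub> \<longrightarrow> x = \<one>\<^bsub>G\<^esub>)"

definition conjugate :: "('a, 'b) monoid_scheme \<Rightarrow> 'a \<Rightarrow> 'a \<Rightarrow> bool" where
  "conjugate G x y \<longleftrightarrow> x \<in> carrier G \<and> y \<in> carrier G \<and>
     (\<exists>g \<in> carrier G. y = inv\<^bsub>G\<^esub> g \<otimes>\<^bsub>G\<^esub> x \<otimes>\<^bsub>G\<^esub> g)"

definition comm :: "('a, 'b) monoid_scheme \<Rightarrow> 'a \<Rightarrow> 'a \<Rightarrow> 'a" where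
  "comm G x y = inv\<^bsub>G\<^esub> x \<otimes>\<^bsub>G\<^esub> inv\<^bsub>G\<^esub> y \<otimes>\<^bsub>G\<^esub> x \<otimes>\<^bsub>G\<^esub> y"

definition commutators :: "('a, 'b) monoid_scheme \<Rightarrow> 'a set" where
  "commutators G = {comm G x y | x y. x \<in> carrier G \<and> y \<in> carrier G}"

definition list_product :: "('a, 'b) monoid_scheme \<Rightarrow> 'a list \<Rightarrow> 'a" where
  "list_product G xs = foldr (\<otimes>\<^bsub>G\<^esub>) xs \<one>\<^bsub>G\<^esub>"

definition conj_to_factor ::
  "'i set \<Rightarrow> ('i \<Rightarrow> ('a, 'b) monoid_scheme) \<Rightarrow> ('i \<times> 'a) list \<Rightarrow> bool" where
  "conj_to_factor I G x \<longleftrightarrow> (\<exists>y \<in> factor_elems I G. conjugate (free_product I G) x y)"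


section \<open>Mixed genus and quasiperiodicity\<close>

definition mixed_factorization ::
  "'i set \<Rightarrow> ('i \<Rightarrow> ('a, 'b) monoid_scheme) \<Rightarrow> ('i \<times> 'a) list \<Rightarrow>
   ('i \<times> 'a) list list \<Rightarrow> ('i \<times> 'a) list list \<Rightarrow> bool" where
  "mixed_factorization I G w cs ds \<longleftrightarrow>
     set cs \<subseteq> commutators (free_product I G) \<and>
     (\<forall>d \<in> set ds. conj_to_factor I G d) \<and>
     w = list_product (free_product I G) (cs @ ds)"

text \<open>
  An infimum of a nonempty set of natural numbers is attained; it would be \<open>\<infinity>\<close> for an element
  without any mixed commutator factorization.
\<close>

definition mixed_genus ::
  "'i set \<Rightarrow> ('i \<Rightarrow> ('a, 'b) monoid_scheme) \<Rightarrow> ('i \<times> 'a) list \<Rightarrow> ereal" where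
  "mixed_genus I G w =
     Inf {ereal (real (2 * length cs + length ds)) | cs ds. mixed_factorization I G w cs ds}"

text \<open>The pairs \<open>(h, n)\<close> in the list \<open>ps\<close> stand for the factors \<open>h ^ n\<close>.\<close>

definition quasiperiodic_factorization ::
  "'i set \<Rightarrow> ('i \<Rightarrow> ('a, 'b) monoid_scheme) \<Rightarrow> ('i \<times> 'a) list \<Rightarrow>
   (('i \<times> 'a) list \<times> nat) list \<Rightarrow> bool" where
  "quasiperiodic_factorization I G w ps \<longleftrightarrow>
     ps \<noteq> [] \<and>
     (\<forall>(h, n) \<in> set ps. h \<in> carrier (free_product I G) \<and> \<not> conj_to_factor I G h \<and> 0 < n) \<and>
     (\<forall>(h, n) \<in> set ps. \<forall>(h', n') \<in> set ps. conjugate (free_product I G) h h') \<and>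
     w = list_product (free_product I G) (map (\<lambda>(h, n). h [^]\<^bsub>free_product I G\<^esub> n) ps)"

definition quasiperiodicity_values ::
  "'i set \<Rightarrow> ('i \<Rightarrow> ('a, 'b) monoid_scheme) \<Rightarrow> ('i \<times> 'a) list \<Rightarrow> nat set" where
  "quasiperiodicity_values I G w =
     {(\<Sum>(h, n)\<leftarrow>ps. n - 1) | ps. quasiperiodic_factorization I G w ps}"

definition quasiperiodicity ::
  "'i set \<Rightarrow> ('i \<Rightarrow> ('a, 'b) monoid_scheme) \<Rightarrow> ('i \<times> 'a) list \<Rightarrow> ereal" where
  "quasiperiodicity I G w =
     (let R = quasiperiodicity_values I G w in
      if R = {} then - \<infinity> else if bdd_above R then ereal (real (Max R)) else \<infinity>)"


section \<open>The free product is a group with the expected universal property\<close>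

lemma reduced_words_Nil [simp]: "[] \<in> reduced_words I G"
  by (simp add: reduced_words_def)

lemma reduced_words_Cons:
  "(i, a) # u \<in> reduced_words I G \<longleftrightarrow>
     i \<in> I \<and> a \<in> carrier (G i) \<and> a \<noteq> \<one>\<^bsub>G i\<^esub> \<and> u \<in> reduced_words I G \<and>
     (u \<noteq> [] \<longrightarrow> fst (hd u) \<noteq> i)"
proof -
  have "(\<forall>k. Suc k < length ((i, a) # u) \<longrightarrow> fst (((i, a) # u) ! k) \<noteq> fst (((i, a) # u) ! Suc k)) \<longleftrightarrow>
     (\<forall>k. Suc k < length u \<longrightarrow> fst (u ! k) \<noteq> fst (u ! Suc k)) \<and> (u \<noteq> [] \<longrightarrow> fst (hd u) \<noteq> i)"
    (is "(\<forall>k. ?P k) \<longleftrightarrow> ?Q")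
  proof -
    have "(\<forall>k. ?P k) \<longleftrightarrow> ?P 0 \<and> (\<forall>k. ?P (Suc k))"
      by (metis not0_implies_Suc)
    then show ?thesis by (cases u) auto
  qed
  then show ?thesis
    unfolding reduced_words_def letters_def by auto
qed

context
  fixes I :: "'i set" and G :: "'i \<Rightarrow> ('a, 'b) monoid_scheme"
  assumes groups: "\<And>i. i \<in> I \<Longrightarrow> group (G i)"
begin

lemma lmult_closed:
  assumes "i \<in> I" "a \<in> carrier (G i)" "v \<in> reduced_words I G"
  shows "lmult G (i, a) v \<in> reduced_words I G"
proof -
  interpret group "G i" using groups assms(1) .
  show ?thesis
    using assms by (cases v) (auto simp: reduced_words_Cons)
qed

lemma lmult_one: "lmult G (i, \<one>\<^bsub>G i\<^esub>) v = v"
  by (cases v) auto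

lemma lmult_lmult:
  assumes "i \<in> I" "a \<in> carrier (G i)" "b \<in> carrier (G i)" "v \<in> reduced_words I G"
  shows "lmult G (i, a) (lmult G (i, b) v) = lmult G (i, a \<otimes>\<^bsub>G i\<^esub> b) v"
proof -
  interpret group "G i" using groups assms(1) .
  show ?thesis
  proof (cases v)
    case Nil
    then show ?thesis using assms by auto
  next
    case (Cons x v')
    obtain j c where x: "x = (j, c)" by force
    show ?thesis
    proof (cases "j = i")
      case False
      then show ?thesis using assms Cons x by auto
    next
      case True
      have c: "c \<in> carrier (G i)" "c \<noteq> \<one>\<^bsub>G i\<^esub>" and v': "v' = [] \<or> fst (hd v') \<noteq> i"
        using assms(4) Cons x True by (auto simp: reduced_words_Cons)
      have eq: "a \<otimes>\<^bsub>G i\<^esub> (b \<otimes>\<^bsub>G i\<^esub> c) = a \<otimes>\<^bsub>G i\<^esub> b \<otimes>\<^bsub>G i\<^esub> c"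
        using assms c by (simp add: m_assoc)
      have nf: "lmult G (i, d) v' = (if d = \<one>\<^bsub>G i\<^esub> then v' else (i, d) # v')" for d
        using v' by (cases v') auto
      have red: "lmult G (i, d) v = lmult G (i, d \<otimes>\<^bsub>G i\<^esub> c) v'" if "d \<in> carrier (G i)" for d
        using Cons x True c that by (auto simp: nf)
      have "lmult G (i, a) (lmult G (i, e) v') = lmult G (i, a \<otimes>\<^bsub>G i\<^esub> e) v'"
        if "e \<in> carrier (G i)" for e
        using that assms by (auto simp: nf lmult_one)
      then show ?thesis
        using assms c by (simp add: red eq)
    qed
  qed
qed

lemma foldr_lmult_closed:
  assumes "set u \<subseteq> letters I G" "v \<in> reduced_words I G"
  shows "foldr (lmult G) u v \<in> reduced_words I G"
  using assms by (induction u) (auto simp: letters_def intro: lmult_closed)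

lemma foldr_lmult_lmult:
  assumes "i \<in> I" "a \<in> carrier (G i)" "v \<in> reduced_words I G" "w \<in> reduced_words I G"
  shows "foldr (lmult G) (lmult G (i, a) v) w = lmult G (i, a) (foldr (lmult G) v w)"
proof (cases v)
  case Nil
  then show ?thesis by (simp add: lmult_one)
next
  case (Cons x v')
  obtain j c where x: "x = (j, c)" by force
  have jc: "j \<in> I" "c \<in> carrier (G j)" "v' \<in> reduced_words I G"
    using assms(3) Cons x by (auto simp: reduced_words_Cons)
  have w': "foldr (lmult G) v' w \<in> reduced_words I G"
    using jc(3) assms(4) by (intro foldr_lmult_closed) (auto simp: reduced_words_def)
  show ?thesis
  proof (cases "j = i")
    case True
    interpret group "G i" using groups assms(1) .
    show ?thesis
      using Cons x True jc assms lmult_lmult[OF assms(1,2) _ w', of c]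
        lmult_one[of i]
      by auto
  qed (use Cons x lmult_one[of i] in auto)
qed

lemma foldr_lmult_assoc:
  assumes "set u \<subseteq> letters I G" "v \<in> reduced_words I G" "w \<in> reduced_words I G"
  shows "foldr (lmult G) (foldr (lmult G) u v) w = foldr (lmult G) u (foldr (lmult G) v w)"
  using assms(1)
proof (induction u)
  case (Cons x u)
  then show ?case
    using assms foldr_lmult_closed[of u v]
    by (cases x) (auto simp: letters_def foldr_lmult_lmult)
qed simp

lemma foldr_lmult_Nil:
  assumes "u \<in> reduced_words I G"
  shows "foldr (lmult G) u [] = u"
  using assms
proof (induction u)
  case (Cons x u)
  then show ?case by (cases x; cases u) (auto simp: reduced_words_Cons)
qed simp

lemma free_product_left_inverse:
  assumes "set u \<subseteq> letters I G"
  shows "\<exists>v. set v \<subseteq> letters I G \<and>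
    (\<forall>w \<in> reduced_words I G. foldr (lmult G) v (foldr (lmult G) u w) = w)"
  using assms
proof (induction u)
  case Nil
  show ?case by (rule exI[of _ "[]"]) simp
next
  case (Cons x u)
  obtain i a where x: "x = (i, a)" by force
  with Cons.prems have ia: "i \<in> I" "a \<in> carrier (G i)" and u: "set u \<subseteq> letters I G"
    by (auto simp: letters_def)
  interpret group "G i" using groups ia(1) .
  obtain v where v: "set v \<subseteq> letters I G"
    "\<forall>w \<in> reduced_words I G. foldr (lmult G) v (foldr (lmult G) u w) = w"
    using Cons.IH u by blast
  have "lmult G (i, inv\<^bsub>G i\<^esub> a) (lmult G (i, a) w) = w" if "w \<in> reduced_words I G" for w
    using lmult_lmult[OF ia(1) _ ia(2) that, of "inv\<^bsub>G i\<^esub> a"] ia(2) by (simp add: lmult_one)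
  then show ?case
    using v ia u x
    by (intro exI[of _ "v @ [(i, inv\<^bsub>G i\<^esub> a)]"]) (auto simp: letters_def foldr_lmult_closed)
qed

theorem group_free_product: "group (free_product I G)"
proof (rule groupI)
  fix u assume u: "u \<in> carrier (free_product I G)"
  then have su: "set u \<subseteq> letters I G" and ru: "u \<in> reduced_words I G"
    by (auto simp: free_product_def reduced_words_def)
  obtain v where v: "set v \<subseteq> letters I G"
    "\<forall>w \<in> reduced_words I G. foldr (lmult G) v (foldr (lmult G) u w) = w"
    using free_product_left_inverse[OF su] by blast
  have "foldr (lmult G) v u = []"
    using v(2) foldr_lmult_Nil[OF ru] by (metis reduced_words_Nil)
  then have "foldr (lmult G) (foldr (lmult G) v []) u = []"
    using foldr_lmult_assoc[OF v(1) reduced_words_Nil ru] by simp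
  then show "\<exists>y\<in>carrier (free_product I G). y \<otimes>\<^bsub>free_product I G\<^esub> u = \<one>\<^bsub>free_product I G\<^esub>"
    using foldr_lmult_closed[OF v(1) reduced_words_Nil] by (auto simp: free_product_def)
next
  fix u v assume "u \<in> carrier (free_product I G)" "v \<in> carrier (free_product I G)"
  then show "u \<otimes>\<^bsub>free_product I G\<^esub> v \<in> carrier (free_product I G)"
    using foldr_lmult_closed[of u v] by (auto simp: free_product_def reduced_words_def)
next
  fix u v w
  assume "u \<in> carrier (free_product I G)" "v \<in> carrier (free_product I G)"
    "w \<in> carrier (free_product I G)"
  then show "u \<otimes>\<^bsub>free_product I G\<^esub> v \<otimes>\<^bsub>free_product I G\<^esub> w =
      u \<otimes>\<^bsub>free_product I G\<^esub> (v \<otimes>\<^bsub>free_product I G\<^esub> w)"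
    using foldr_lmult_assoc[of u v w] by (auto simp: free_product_def reduced_words_def)
qed (auto simp: free_product_def)

lemma factor_emb_hom:
  assumes "i \<in> I"
  shows "factor_emb G i \<in> hom (G i) (free_product I G)"
proof -
  interpret group "G i" using groups assms .
  show ?thesis
    using assms by (auto simp: hom_def free_product_def factor_emb_def reduced_words_Cons)
qed

lemma factor_emb_inj: "inj_on (factor_emb G i) (carrier (G i))"
  by (auto simp: inj_on_def factor_emb_def split: if_splits)

theorem free_product_universal:
  fixes H :: "('c, 'd) monoid_scheme"
  assumes H: "group H" and \<phi>: "\<And>i. i \<in> I \<Longrightarrow> \<phi> i \<in> hom (G i) H"
  shows "\<exists>f \<in> hom (free_product I G) H.
    (\<forall>i\<in>I. \<forall>a\<in>carrier (G i). f (factor_emb G i a) = \<phi> i a) \<and>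
    (\<forall>g \<in> hom (free_product I G) H. (\<forall>i\<in>I. \<forall>a\<in>carrier (G i). g (factor_emb G i a) = \<phi> i a) \<longrightarrow>
       (\<forall>u \<in> carrier (free_product I G). g u = f u))"
proof -
  interpret H: group H by fact
  interpret F: group "free_product I G" by (rule group_free_product)
  define f where "f = (\<lambda>u. foldr (\<lambda>(i, a) h. \<phi> i a \<otimes>\<^bsub>H\<^esub> h) u \<one>\<^bsub>H\<^esub>)"
  have f_simps [simp]: "f [] = \<one>\<^bsub>H\<^esub>" "f ((i, a) # u) = \<phi> i a \<otimes>\<^bsub>H\<^esub> f u" for i a u
    by (auto simp: f_def)
  have \<phi>_closed: "\<phi> i a \<in> carrier H" if "i \<in> I" "a \<in> carrier (G i)" for i a
    using \<phi>[OF that(1)] that(2) by (auto simp: hom_def)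
  have \<phi>_one: "\<phi> i \<one>\<^bsub>G i\<^esub> = \<one>\<^bsub>H\<^esub>" if "i \<in> I" for i
    using hom_one[OF \<phi>[OF that] groups[OF that] H] .
  have \<phi>_mult: "\<phi> i (a \<otimes>\<^bsub>G i\<^esub> b) = \<phi> i a \<otimes>\<^bsub>H\<^esub> \<phi> i b"
    if "i \<in> I" "a \<in> carrier (G i)" "b \<in> carrier (G i)" for i a b
    using \<phi>[OF that(1)] that by (auto simp: hom_def)
  have f_closed: "f u \<in> carrier H" if "set u \<subseteq> letters I G" for u
    using that by (induction u) (auto simp: letters_def \<phi>_closed)
  have f_lmult: "f (lmult G (i, a) u) = \<phi> i a \<otimes>\<^bsub>H\<^esub> f u"
    if "i \<in> I" "a \<in> carrier (G i)" "set u \<subseteq> letters I G" for i a u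
  proof (cases u)
    case Nil
    then show ?thesis using that by (auto simp: \<phi>_one)
  next
    case (Cons x v)
    obtain j b where x: "x = (j, b)" by force
    have jb: "j \<in> I" "b \<in> carrier (G j)" and v: "f v \<in> carrier H"
      using that Cons x f_closed[of v] by (auto simp: letters_def)
    have "\<phi> i a \<otimes>\<^bsub>H\<^esub> (\<phi> i b \<otimes>\<^bsub>H\<^esub> f v) = f v" if "j = i" "a \<otimes>\<^bsub>G i\<^esub> b = \<one>\<^bsub>G i\<^esub>"
      using \<phi>_mult[of i a b] \<open>i \<in> I\<close> \<open>a \<in> carrier (G i)\<close> jb v that
      by (simp add: \<phi>_one \<phi>_closed flip: H.m_assoc)
    then show ?thesis
      using that jb v Cons x by (auto simp: \<phi>_one \<phi>_mult \<phi>_closed H.m_assoc)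
  qed
  have f_foldr: "f (foldr (lmult G) u v) = f u \<otimes>\<^bsub>H\<^esub> f v"
    if "set u \<subseteq> letters I G" "v \<in> reduced_words I G" for u v
    using that(1)
  proof (induction u)
    case Nil
    show ?case using that(2) f_closed[of v] by (auto simp: reduced_words_def)
  next
    case (Cons x u)
    obtain i a where x: "x = (i, a)" by force
    have "set (foldr (lmult G) u v) \<subseteq> letters I G"
      using Cons.prems foldr_lmult_closed[OF _ that(2), of u] by (auto simp: reduced_words_def)
    moreover have "f v \<in> carrier H"
      using that(2) f_closed[of v] by (auto simp: reduced_words_def)
    ultimately show ?case
      using Cons x f_closed[of u]
      by (auto simp: f_lmult letters_def \<phi>_closed H.m_assoc)
  qed
  have f_hom: "f \<in> hom (free_product I G) H"
    using f_foldr f_closed by (auto simp: hom_def free_product_def reduced_words_def)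
  have f_emb: "f (factor_emb G i a) = \<phi> i a" if "i \<in> I" "a \<in> carrier (G i)" for i a
    using that by (auto simp: factor_emb_def \<phi>_one \<phi>_closed)
  have "g u = f u"
    if g: "g \<in> hom (free_product I G) H" "\<forall>i\<in>I. \<forall>a\<in>carrier (G i). g (factor_emb G i a) = \<phi> i a"
      and u: "u \<in> carrier (free_product I G)" for g u
    using u
  proof (induction u)
    case Nil
    show ?case
      using hom_one[OF g(1) F.is_group H] by (simp add: free_product_def)
  next
    case (Cons x u)
    obtain i a where x: "x = (i, a)" by force
    have ia: "i \<in> I" "a \<in> carrier (G i)" and u: "u \<in> carrier (free_product I G)"
      using Cons.prems x by (auto simp: free_product_def reduced_words_Cons)
    have "x # u = factor_emb G i a \<otimes>\<^bsub>free_product I G\<^esub> u"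
      using Cons.prems x
      by (cases u) (auto simp: free_product_def factor_emb_def reduced_words_Cons)
    moreover have "factor_emb G i a \<in> carrier (free_product I G)"
      using factor_emb_hom[OF ia(1)] ia(2) by (auto simp: hom_def)
    ultimately have "g (x # u) = \<phi> i a \<otimes>\<^bsub>H\<^esub> g u"
      using g ia u by (auto simp: hom_def)
    then show ?case using Cons.IH u x by simp
  qed
  then show ?thesis using f_hom f_emb by blast
qed

end

end

theory Submission
  imports Defs "HOL-Combinatorics.Cycles"
begin

text \<open>
  An equation \<open>h\<^sub>1^n\<^sub>1 \<cdots> h\<^sub>m^n\<^sub>m = c\<^sub>1 \<cdots> c\<^sub>k d\<^sub>1 \<cdots> d\<^sub>l\<close> amounts to a map of a surface of genus \<open>k\<close> with
  \<open>m + l\<close> boundary components. Cut along the preimage of the base points of a graph of spaces for the free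
  product, it falls into pieces that lie over the factors and pieces that lie over the centre of
  the star that joins them, and the Euler characteristic says that there are at least
  \<open>N - (2 k + l + m - 2)\<close> discs among these pieces, where \<open>N\<close> is the number of letters of the words
  \<open>h\<^sub>j^n\<^sub>j\<close>. Let all \<open>h\<^sub>j\<close> be conjugate to the cyclically reduced word \<open>x\<^sub>1 \<cdots> x\<^sub>L\<close>, \<open>L \<ge> 2\<close>, and rank every
  letter by its index. The letters around a disc cannot all have the same rank: over a factor this
  would be a torsion relation \<open>x\<^sub>i^r = 1\<close>, over the centre it would put \<open>x\<^sub>i\<close> and its cyclic successor
  into the same factor. So every disc has an ascent of ranks. On the other hand every letter is
  responsible for at most one ascent, and the \<open>n\<^sub>1 + \<cdots> + n\<^sub>m\<close> letters with index \<open>L\<close> for none. Hence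
  \<open>N - (2 k + l + m - 2) \<le> N - (n\<^sub>1 + \<cdots> + n\<^sub>m)\<close>, which is the bound on the quasiperiodicity.

  The surface is encoded by permutations of the set of letters: \<open>\<sigma>\<close> runs along the boundary words,
  the cycles of \<open>\<pi>\<close> are the boundary curves of the pieces over the factors, and those of
  \<open>\<pi>\<inverse> \<sigma>\<close> bound the central pieces. Starting from the trivial word \<open>(c\<^sub>1 \<cdots> d\<^sub>l)\<inverse> h\<^sub>1^n\<^sub>1 \<cdots> h\<^sub>m^n\<^sub>m\<close>, written out
  with all conjugating elements, mutually inverse letters are glued and deleted one pair at a time.
\<close>

section \<open>Cycles of permutations\<close>

text \<open>A cycle is kept as a list because the labels along it are multiplied in order, in a
  group that need not be abelian. Fixed points are the lists of length one.\<close>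

definition is_cycle :: "('a \<Rightarrow> 'a) \<Rightarrow> 'a list \<Rightarrow> bool" where
  "is_cycle f ws \<longleftrightarrow> ws \<noteq> [] \<and> distinct ws \<and> map f ws = rotate1 ws"

text \<open>Passing to the underlying sets counts a cycle once, whatever its starting point. Each
  fixed point in \<open>D\<close> contributes a singleton, so fixed points enter all counts
  below.\<close>

definition cycle_sets :: "('a \<Rightarrow> 'a) \<Rightarrow> 'a set \<Rightarrow> 'a set set" where
  "cycle_sets f D = {set ws |ws. is_cycle f ws \<and> set ws \<subseteq> D}"

lemma is_cycleD: "is_cycle f ws \<Longrightarrow> f ` set ws = set ws"
  by (metis is_cycle_def list.set_map set_rotate1)

lemma is_cycle_rotate1: "is_cycle f ws \<Longrightarrow> is_cycle f (rotate1 ws)"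
  by (metis is_cycle_def distinct1_rotate rotate1_is_Nil_conv rotate1_map)

lemma is_cycle_swap: "is_cycle f (A @ B) \<Longrightarrow> is_cycle f (B @ A)"
proof -
  assume *: "is_cycle f (A @ B)"
  have "is_cycle f (rotate n ws)" if "is_cycle f ws" for n ws
    using that by (induction n) (auto intro: is_cycle_rotate1)
  from this[OF *, of "length A"] show ?thesis
    by (simp add: rotate_append)
qed

lemma is_cycle_nth:
  assumes "is_cycle f ws" "k < length ws"
  shows "ws ! k = (f ^^ k) (hd ws)"
  using assms(2)
proof (induction k)
  case 0
  then show ?case using assms(1) by (simp add: is_cycle_def hd_conv_nth)
next
  case (Suc k)
  have "f (ws ! k) = rotate1 ws ! k"
    using assms(1) Suc.prems by (metis Suc_lessD is_cycle_def nth_map)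
  then show ?case using Suc by (simp add: nth_rotate1)
qed

lemma is_cycle_funpow_length:
  assumes "is_cycle f ws"
  shows "(f ^^ length ws) (hd ws) = hd ws"
proof -
  obtain n where n: "length ws = Suc n"
    using assms by (cases ws) (auto simp: is_cycle_def)
  have "f (ws ! n) = rotate1 ws ! n"
    using assms n by (metis is_cycle_def lessI nth_map)
  also have "\<dots> = hd ws"
    using n assms by (simp add: nth_rotate1 is_cycle_def hd_conv_nth)
  finally show ?thesis
    using is_cycle_nth[OF assms, of n] n by simp
qed

text \<open>The entries are the iterates of \<open>f\<close> at the head, and the head returns after
  \<open>length ws\<close> steps. A shorter cycle would therefore force a repetition in the longer
  one, which is distinct.\<close>

lemma is_cycle_hd_eq:
  assumes "is_cycle f (x # a)" "is_cycle f (x # b)"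
  shows "a = b"
proof -
  have *: "\<not> length a < length b" if "is_cycle f (x # a)" "is_cycle f (x # b)" for a b
  proof
    assume "length a < length b"
    then have "(x # b) ! length (x # a) = x"
      using is_cycle_nth[OF that(2), of "length (x # a)"] is_cycle_funpow_length[OF that(1)] by simp
    then show False
      using that(2) \<open>length a < length b\<close> by (auto simp: is_cycle_def)
  qed
  then have "length a = length b"
    using assms by (meson linorder_neqE_nat)
  then have "x # a = x # b"
    using is_cycle_nth[OF assms(1)] is_cycle_nth[OF assms(2)] by (intro nth_equalityI) auto
  then show ?thesis by simp
qed

lemma is_cycle_rotate_to:
  assumes "is_cycle f ws" "x \<in> set ws"
  obtains A B where "ws = A @ x # B" "is_cycle f (x # B @ A)"
proof -
  obtain A B where "ws = A @ x # B" using split_list assms(2) by fast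
  then show thesis using that is_cycle_swap[of f A "x # B"] assms(1) by simp
qed

lemma is_cycle_set_eq:
  assumes "is_cycle f ws" "is_cycle f ws'" "x \<in> set ws" "x \<in> set ws'"
  shows "set ws = set ws'"
proof -
  obtain A B where 1: "ws = A @ x # B" "is_cycle f (x # B @ A)"
    using is_cycle_rotate_to assms(1,3) by metis
  obtain A' B' where 2: "ws' = A' @ x # B'" "is_cycle f (x # B' @ A')"
    using is_cycle_rotate_to assms(2,4) by metis
  have "B @ A = B' @ A'"
    using is_cycle_hd_eq 1(2) 2(2) by metis
  then have "set (B @ A) = set (B' @ A')" by simp
  then show ?thesis using 1 2 by auto
qed

text \<open>The cycle is the orbit of \<open>x\<close>, listed by \<open>support\<close> up to the
  least positive power of \<open>f\<close> that returns to \<open>x\<close>.\<close>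

lemma ex_is_cycle:
  assumes "f permutes D" "finite D" "x \<in> D"
  shows "\<exists>ws. is_cycle f (x # ws) \<and> set (x # ws) \<subseteq> D"
proof -
  define n where "n = least_power f x"
  have perm: "permutation f" using assms permutation_permutes by blast
  have n: "(f ^^ n) x = x" "n > 0"
    using least_power_of_permutation[OF perm] by (auto simp: n_def)
  have D: "(f ^^ i) x \<in> D" for i
    using assms(1,3) by (induction i) (auto simp: permutes_in_image)
  let ?s = "support f x"
  have d: "distinct ?s"
    using cycle_of_permutation[OF perm] .
  have l: "length ?s = n" by (simp add: n_def)
  have "map f ?s = rotate1 ?s"
  proof (rule nth_equalityI)
    fix i assume "i < length (map f ?s)"
    then have i: "i < n" using l by simp
    show "map f ?s ! i = rotate1 ?s ! i"
    proof (cases "Suc i = n")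
      case True
      then have "f ((f ^^ i) x) = x" using n(1) by (metis comp_apply funpow.simps(2))
      then show ?thesis using True i by (auto simp: nth_rotate1 n_def)
    next
      case False
      then show ?thesis using i n by (auto simp: nth_rotate1 n_def)
    qed
  qed simp
  moreover have "?s = x # map (\<lambda>i. (f ^^ i) x) [1..<n]"
    using n(2) by (simp add: n_def upt_conv_Cons)
  moreover have "set ?s \<subseteq> D"
    by (simp only: set_map) (use D in blast)
  ultimately show ?thesis
    using d by (intro exI[of _ "map (\<lambda>i. (f ^^ i) x) [1..<n]"]) (simp only: is_cycle_def, simp)
qed

lemma finite_cycle_sets: "finite D \<Longrightarrow> finite (cycle_sets f D)"
  by (rule finite_subset[of _ "Pow D"]) (auto simp: cycle_sets_def)

lemma cycle_sets_disjoint: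
  assumes "S \<in> cycle_sets f D" "S' \<in> cycle_sets f D'" "x \<in> S" "x \<in> S'"
  shows "S = S'"
proof -
  obtain ws ws' where "S = set ws" "is_cycle f ws" "S' = set ws'" "is_cycle f ws'"
    using assms(1,2) by (auto simp: cycle_sets_def)
  then show ?thesis using is_cycle_set_eq assms(3,4) by metis
qed

section \<open>Transpositions and the number of cycles\<close>

lemma is_cycle_transpose_other:
  assumes "is_cycle f ws" "p \<notin> set ws" "q \<notin> set ws"
  shows "is_cycle (transpose p q \<circ> f) ws"
proof -
  have "map (transpose p q \<circ> f) ws = map f ws"
    using is_cycleD[OF assms(1)] assms(2,3)
    by (intro map_cong) (auto simp: transpose_def)
  then show ?thesis using assms(1) unfolding is_cycle_def by metis
qed

lemma map_transpose_other:
  "p \<notin> set ws \<Longrightarrow> q \<notin> set ws \<Longrightarrow> map (transpose p q) ws = ws"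
  by (rule map_idI) (auto simp: transpose_def)

text \<open>Composing on the left redirects only the arrows that end in \<open>p\<close> and
  \<open>q\<close>. The arrow into \<open>q\<close> comes from the end of \<open>p # B\<close> and
  now returns to \<open>p\<close>; the arrow into \<open>p\<close> comes from the end of
  \<open>q # A\<close> and now returns to \<open>q\<close>.\<close>

lemma is_cycle_transpose_split:
  assumes "is_cycle f (p # B @ q # A)"
  shows "is_cycle (transpose p q \<circ> f) (p # B)" "is_cycle (transpose p q \<circ> f) (q # A)"
proof -
  have m: "(f p # map f B) @ (f q # map f A) = (B @ [q]) @ (A @ [p])"
    and d: "distinct (p # B @ q # A)"
    using assms by (auto simp: is_cycle_def)
  have "f p # map f B = B @ [q]" "f q # map f A = A @ [p]"
    using m by (subst (asm) append_eq_append_conv; simp)+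
  moreover have "map (transpose p q) (B @ [q]) = B @ [p]" "map (transpose p q) (A @ [p]) = A @ [q]"
    using d by (auto simp: map_transpose_other)
  ultimately have "map (transpose p q) (f p # map f B) = B @ [p]"
    "map (transpose p q) (f q # map f A) = A @ [q]"
    by metis+
  then show "is_cycle (transpose p q \<circ> f) (p # B)" "is_cycle (transpose p q \<circ> f) (q # A)"
    using d by (auto simp: is_cycle_def)
qed

text \<open>The reverse redirection: two cycles are disjoint as soon as \<open>q\<close> lies
  outside the first, and exchanging the arrows into their heads strings them together.\<close>

lemma is_cycle_transpose_merge:
  assumes "is_cycle f (p # B)" "is_cycle f (q # A)" "q \<notin> set (p # B)"
  shows "is_cycle (transpose p q \<circ> f) (p # B @ q # A)"
proof -
  have disj: "set (p # B) \<inter> set (q # A) = {}"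
    using is_cycle_set_eq[OF assms(1,2)] assms(3) by force
  have "f p # map f B = B @ [p]" "f q # map f A = A @ [q]"
    using assms by (auto simp: is_cycle_def)
  moreover have "map (transpose p q) (B @ [p]) = B @ [q]" "map (transpose p q) (A @ [q]) = A @ [p]"
    using disj assms by (auto simp: map_transpose_other is_cycle_def)
  ultimately have "map (transpose p q) (f p # map f B) = B @ [q]"
    "map (transpose p q) (f q # map f A) = A @ [p]"
    by metis+
  then show ?thesis
    using disj assms by (auto simp: is_cycle_def)
qed

lemma cycle_setsI: "is_cycle f ws \<Longrightarrow> set ws \<subseteq> D \<Longrightarrow> set ws \<in> cycle_sets f D"
  by (auto simp: cycle_sets_def)

text \<open>One cycle is replaced by two, while every other cycle avoids \<open>p\<close> and
  \<open>q\<close> and survives.\<close>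

lemma card_cycle_sets_same:
  assumes D: "finite D" and c: "is_cycle f (p # B @ q # A)" "set (p # B @ q # A) \<subseteq> D"
  shows "card (cycle_sets f D) + 1 \<le> card (cycle_sets (transpose p q \<circ> f) D)"
proof -
  let ?f = "transpose p q \<circ> f"
  let ?S = "set (p # B @ q # A)" and ?S1 = "set (p # B)" and ?S2 = "set (q # A)"
  have d: "distinct (p # B @ q # A)" using c by (simp add: is_cycle_def)
  have S: "?S \<in> cycle_sets f D" using c cycle_setsI by blast
  have sub: "(cycle_sets f D - {?S}) \<union> {?S1, ?S2} \<subseteq> cycle_sets ?f D"
  proof -
    have "U \<in> cycle_sets ?f D" if U: "U \<in> cycle_sets f D" "U \<noteq> ?S" for U
    proof -
      obtain ws where ws: "U = set ws" "is_cycle f ws" "set ws \<subseteq> D"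
        using U(1) by (auto simp: cycle_sets_def)
      have "p \<notin> U" "q \<notin> U"
        using cycle_sets_disjoint[OF U(1) S] U(2) by auto
      then show ?thesis
        using is_cycle_transpose_other[OF ws(2)] ws cycle_setsI by metis
    qed
    moreover have "?S1 \<in> cycle_sets ?f D" "?S2 \<in> cycle_sets ?f D"
      using c(2) by (intro cycle_setsI is_cycle_transpose_split[OF c(1)]; auto)+
    ultimately show ?thesis by blast
  qed
  have n: "?S1 \<notin> cycle_sets f D - {?S}" "?S2 \<notin> cycle_sets f D - {?S}"
    using cycle_sets_disjoint[OF _ S, of ?S1 D p] cycle_sets_disjoint[OF _ S, of ?S2 D q] by auto
  have ne: "?S1 \<noteq> ?S2" using d by auto
  have "card (cycle_sets f D) + 1 = card ((cycle_sets f D - {?S}) \<union> {?S1, ?S2})"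
  proof -
    have "card ((cycle_sets f D - {?S}) \<union> {?S1, ?S2}) = card (cycle_sets f D - {?S}) + card {?S1, ?S2}"
      using n finite_cycle_sets[OF D] by (intro card_Un_disjoint) auto
    then show ?thesis
      using ne card_Suc_Diff1[OF finite_cycle_sets[OF D] S] by simp
  qed
  also have "\<dots> \<le> card (cycle_sets ?f D)"
    using sub by (intro card_mono finite_cycle_sets D)
  finally show ?thesis .
qed

text \<open>If \<open>p\<close> and \<open>q\<close> share a cycle, it splits and the number grows;
  if they lie on different cycles, these merge into one. So at most one cycle is lost.\<close>

lemma card_cycle_sets_transpose:
  assumes D: "finite D" and f: "f permutes D" and pq: "p \<in> D" "q \<in> D"
  shows "card (cycle_sets f D) \<le> card (cycle_sets (transpose p q \<circ> f) D) + 1"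
proof (cases "p = q")
  case True
  then show ?thesis by simp
next
  case neq: False
  let ?f = "transpose p q \<circ> f"
  obtain B where B: "is_cycle f (p # B)" "set (p # B) \<subseteq> D"
    using ex_is_cycle[OF f D pq(1)] by auto
  obtain A where A: "is_cycle f (q # A)" "set (q # A) \<subseteq> D"
    using ex_is_cycle[OF f D pq(2)] by auto
  show ?thesis
  proof (cases "q \<in> set (p # B)")
    case True
    then obtain B1 B2 where "B = B1 @ q # B2"
      using neq by (auto dest: split_list)
    then show ?thesis
      using card_cycle_sets_same[OF D, of f p B1 q B2] B by simp
  next
    case False
    let ?S = "set (p # B @ q # A)" and ?S1 = "set (p # B)" and ?S2 = "set (q # A)"
    have S: "?S1 \<in> cycle_sets f D" "?S2 \<in> cycle_sets f D"
      using A B cycle_setsI by blast+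
    have "insert ?S (cycle_sets f D - {?S1, ?S2}) \<subseteq> cycle_sets ?f D"
    proof -
      have "U \<in> cycle_sets ?f D" if U: "U \<in> cycle_sets f D" "U \<noteq> ?S1" "U \<noteq> ?S2" for U
      proof -
        obtain ws where ws: "U = set ws" "is_cycle f ws" "set ws \<subseteq> D"
          using U(1) by (auto simp: cycle_sets_def)
        have "p \<notin> U" "q \<notin> U"
          using cycle_sets_disjoint[OF U(1) S(1)] cycle_sets_disjoint[OF U(1) S(2)] U(2,3) by auto
        then show ?thesis
          using is_cycle_transpose_other[OF ws(2)] ws cycle_setsI by metis
      qed
      moreover have "?S \<in> cycle_sets ?f D"
        using is_cycle_transpose_merge[OF B(1) A(1) False] A(2) B(2) by (intro cycle_setsI) auto
      ultimately show ?thesis by blast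
    qed
    then have "card (insert ?S (cycle_sets f D - {?S1, ?S2})) \<le> card (cycle_sets ?f D)"
      by (intro card_mono finite_cycle_sets D)
    moreover have "?S \<notin> cycle_sets f D - {?S1, ?S2}"
      using cycle_sets_disjoint[OF _ S(1), of ?S D p] by auto
    moreover have "card (cycle_sets f D) \<le> card (cycle_sets f D - {?S1, ?S2}) + 2"
      using diff_card_le_card_Diff[of "{?S1, ?S2}" "cycle_sets f D"]
      by (simp add: card_insert_if split: if_splits)
    ultimately show ?thesis
      using finite_cycle_sets[OF D] by simp
  qed
qed

text \<open>Bypasses \<open>p\<close>: its predecessor is sent to \<open>f p\<close>, and
  \<open>p\<close> becomes a fixed point, so that the result permutes \<open>D - {p}\<close>. A
  fixed point is left as it is.\<close>

definition delete :: "('a \<Rightarrow> 'a) \<Rightarrow> 'a \<Rightarrow> 'a \<Rightarrow> 'a" where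
  "delete f p = transpose p (f p) \<circ> f"

lemma delete_self [simp]: "delete f p p = p"
  by (simp add: delete_def)

lemma delete_fixed: "f p = p \<Longrightarrow> delete f p = f"
  by (simp add: delete_def)

lemma permutes_transpose_comp:
  "f permutes D \<Longrightarrow> p \<in> D \<Longrightarrow> q \<in> D \<Longrightarrow> transpose p q \<circ> f permutes D"
  by (simp add: permutes_compose permutes_swap_id)

lemma permutes_remove_fixed:
  assumes "f permutes D" "f p = p"
  shows "f permutes (D - {p})"
  using assms unfolding permutes_def by (metis Diff_iff singletonD)

lemma delete_permutes:
  assumes "f permutes D" "p \<in> D"
  shows "delete f p permutes (D - {p})"
  using assms permutes_transpose_comp[of f D p "f p"] permutes_in_image[OF assms(1), of p]
  by (intro permutes_remove_fixed) (auto simp: delete_def)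

lemma is_cycle_single: "is_cycle f [p] \<longleftrightarrow> f p = p"
  by (auto simp: is_cycle_def)

lemma is_cycle_fixed:
  assumes "is_cycle f ws" "p \<in> set ws" "f p = p"
  shows "ws = [p]"
proof -
  obtain A B where AB: "ws = A @ p # B" "is_cycle f (p # B @ A)"
    using is_cycle_rotate_to[OF assms(1,2)] by metis
  have "is_cycle f [p]" using assms(3) by (simp add: is_cycle_single)
  then have "B @ A = []" using is_cycle_hd_eq AB(2) by metis
  then show ?thesis using AB(1) by simp
qed

lemma card_cycle_sets_remove_fixed:
  assumes "finite D" "p \<in> D" "f p = p"
  shows "card (cycle_sets f D) = card (cycle_sets f (D - {p})) + 1"
proof -
  have "cycle_sets f D = insert {p} (cycle_sets f (D - {p}))"
  proof
    show "cycle_sets f D \<subseteq> insert {p} (cycle_sets f (D - {p}))"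
    proof
      fix S assume "S \<in> cycle_sets f D"
      then obtain ws where ws: "S = set ws" "is_cycle f ws" "set ws \<subseteq> D"
        by (auto simp: cycle_sets_def)
      show "S \<in> insert {p} (cycle_sets f (D - {p}))"
      proof (cases "p \<in> set ws")
        case True
        then show ?thesis using is_cycle_fixed[OF ws(2) True assms(3)] ws(1) by simp
      next
        case False
        then show ?thesis using ws by (auto intro: cycle_setsI)
      qed
    qed
    show "insert {p} (cycle_sets f (D - {p})) \<subseteq> cycle_sets f D"
      using assms cycle_setsI[of f "[p]" D] by (auto simp: is_cycle_single cycle_sets_def)
  qed
  moreover have "{p} \<notin> cycle_sets f (D - {p})"
    by (auto simp: cycle_sets_def)
  ultimately show ?thesis
    using finite_cycle_sets[of "D - {p}" f] assms(1) by simp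
qed

lemma is_cycle_ConsD:
  assumes "is_cycle f (p # ws)" "f p \<noteq> p"
  obtains A where "ws = f p # A"
  using assms by (cases ws) (auto simp: is_cycle_def)

text \<open>A cycle of length at least two only becomes shorter, so one is lost only if
  \<open>p\<close> forms it alone.\<close>

lemma card_cycle_sets_delete:
  assumes D: "finite D" "f permutes D" "p \<in> D"
  shows "card (cycle_sets f D) \<le> card (cycle_sets (delete f p) (D - {p})) + (if f p = p then 1 else 0)"
proof (cases "f p = p")
  case True
  then show ?thesis
    using card_cycle_sets_remove_fixed[of D p f] D True by (simp add: delete_fixed)
next
  case False
  obtain ws where ws: "is_cycle f (p # ws)" "set (p # ws) \<subseteq> D"
    using ex_is_cycle[OF D(2,1,3)] by blast
  obtain A where "ws = f p # A" using is_cycle_ConsD[OF ws(1) False] .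
  then have "card (cycle_sets f D) + 1 \<le> card (cycle_sets (delete f p) D)"
    using card_cycle_sets_same[OF D(1), of f p "[]" "f p" A] ws by (simp add: delete_def)
  then show ?thesis
    using card_cycle_sets_remove_fixed[OF D(1,3), of "delete f p"] False by simp
qed

lemma comp_transpose:
  "bij h \<Longrightarrow> h \<circ> transpose a b = transpose (h a) (h b) \<circ> h"
  by (auto simp: fun_eq_iff transpose_def bij_def inj_eq)

text \<open>The notation \<open>inv\<close> is taken by the group inverse of \<open>HOL-Algebra\<close>.\<close>

abbreviation perm_inv :: "('a \<Rightarrow> 'a) \<Rightarrow> 'a \<Rightarrow> 'a" where
  "perm_inv \<equiv> inv_into UNIV"

text \<open>Deleting \<open>p\<close> from both permutations changes the quotient by a transposition
  followed by a deletion. The first can lose a cycle only if \<open>\<sigma>\<close> moves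
  \<open>p\<close>, the second only if \<open>\<pi>\<close> fixes \<open>p\<close>; if both hold,
  the two operations collapse into one deletion that loses nothing.\<close>

lemma card_cycle_sets_quotient_delete:
  assumes D: "finite D" "p \<in> D" and s: "\<sigma> permutes D" and t: "\<pi> permutes D"
  shows "card (cycle_sets (perm_inv \<pi> \<circ> \<sigma>) D) \<le>
    card (cycle_sets (perm_inv (delete \<pi> p) \<circ> delete \<sigma> p) (D - {p})) +
    (if (\<sigma> p = p) \<longleftrightarrow> (\<pi> p = p) then 1 else 0)"
proof -
  \<comment> \<open>The deleting transpositions are moved past \<open>perm_inv \<pi>\<close>; this
    turns them into the transpositions of \<open>c\<close> with \<open>p\<close> and of
    \<open>c\<close> with \<open>u\<close>.\<close>
  define c u where "c = perm_inv \<pi> p" and "u = perm_inv \<pi> (\<sigma> p)"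
  define \<kappa> where "\<kappa> = perm_inv \<pi> \<circ> \<sigma>"
  have ip: "perm_inv \<pi> permutes D" using t by (rule permutes_inv)
  have bij: "bij (perm_inv \<pi>)" "bij \<pi>" using ip t permutes_bij by blast+
  have kp: "\<kappa> permutes D" unfolding \<kappa>_def using s ip by (rule permutes_compose)
  have cD: "c \<in> D" using D ip by (simp add: c_def permutes_in_image)
  have uD: "u \<in> D" using D s ip by (simp add: u_def permutes_in_image)
  have [simp]: "perm_inv \<pi> (\<pi> x) = x" for x using t by (simp add: permutes_inverses)
  have cp: "c = p \<longleftrightarrow> \<pi> p = p" using t unfolding c_def by (metis permutes_inverses)
  have uc: "u = c \<longleftrightarrow> \<sigma> p = p" using bij(1) unfolding c_def u_def by (metis bij_pointE)
  have "perm_inv (delete \<pi> p) = perm_inv \<pi> \<circ> transpose p (\<pi> p)"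
    using bij(2) by (simp add: delete_def o_inv_distrib)
  also have "\<dots> = transpose c p \<circ> perm_inv \<pi>"
    using comp_transpose[OF bij(1), of p "\<pi> p"] by (simp add: c_def)
  finally have "perm_inv (delete \<pi> p) \<circ> delete \<sigma> p = transpose c p \<circ> (perm_inv \<pi> \<circ> transpose p (\<sigma> p)) \<circ> \<sigma>"
    by (simp add: delete_def comp_assoc)
  also have "perm_inv \<pi> \<circ> transpose p (\<sigma> p) = transpose c u \<circ> perm_inv \<pi>"
    using comp_transpose[OF bij(1)] by (simp add: c_def u_def)
  finally have eq: "perm_inv (delete \<pi> p) \<circ> delete \<sigma> p = transpose p c \<circ> (transpose c u \<circ> \<kappa>)"
    unfolding \<kappa>_def by (simp only: comp_assoc transpose_commute[of p c])
  let ?k1 = "transpose c u \<circ> \<kappa>"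
  have "?k1 p = c" by (simp add: \<kappa>_def u_def)
  then have eq': "perm_inv (delete \<pi> p) \<circ> delete \<sigma> p = delete ?k1 p"
    using eq by (simp add: delete_def)
  have k1: "?k1 permutes D" using permutes_transpose_comp[OF kp cD uD] .
  have 1: "card (cycle_sets ?k1 D) \<le> card (cycle_sets (delete ?k1 p) (D - {p})) + (if c = p then 1 else 0)"
    using card_cycle_sets_delete[OF D(1) k1 D(2)] \<open>?k1 p = c\<close> by metis
  have 2: "card (cycle_sets \<kappa> D) \<le> card (cycle_sets ?k1 D) + 1"
    using card_cycle_sets_transpose[OF D(1) kp cD uD] .
  show ?thesis
  proof (cases "\<sigma> p = p")
    case True
    then have "?k1 = \<kappa>" using uc by (simp add: fun_eq_iff)
    then show ?thesis using 1 cp True unfolding eq' \<kappa>_def[symmetric] by auto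
  next
    case sp: False
    show ?thesis
    proof (cases "\<pi> p = p")
      case False
      then show ?thesis using 1 2 cp sp unfolding eq' \<kappa>_def[symmetric] by auto
    next
      case True
      \<comment> \<open>Here \<open>?k1\<close> already fixes \<open>p\<close>, so both operations
        together delete \<open>p\<close> from \<open>\<kappa>\<close>, which moves
        \<open>p\<close>.\<close>
      then have "c = p" using cp by simp
      have kp': "\<kappa> p = u" by (simp add: \<kappa>_def u_def)
      then have "delete ?k1 p = delete \<kappa> p"
        using \<open>c = p\<close> \<open>?k1 p = c\<close> by (simp add: delete_def)
      moreover have "\<kappa> p \<noteq> p" using kp' uc \<open>c = p\<close> sp by simp
      ultimately show ?thesis
        using card_cycle_sets_delete[OF D(1) kp D(2)] sp True unfolding eq' \<kappa>_def[symmetric] by simp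
    qed
  qed
qed

section \<open>Cycles with trivial label product\<close>

context group
begin

text \<open>Whether the product is one does not depend on the starting point of the cycle, so this
  is a property of the set, although it is expressed through some list.\<close>

definition trivial_cycles :: "('c \<Rightarrow> 'a) \<Rightarrow> ('c \<Rightarrow> 'c) \<Rightarrow> 'c set \<Rightarrow> 'c set set" where
  "trivial_cycles g f D =
    {set ws |ws. is_cycle f ws \<and> set ws \<subseteq> D \<and> list_product G (map g ws) = \<one>}"

lemma list_product_Nil [simp]: "list_product G [] = \<one>"
  and list_product_Cons [simp]: "list_product G (x # xs) = x \<otimes> list_product G xs"
  by (simp_all add: list_product_def)

lemma list_product_closed [simp, intro]:
  "set xs \<subseteq> carrier G \<Longrightarrow> list_product G xs \<in> carrier G"
  by (induction xs) auto

lemma list_product_append: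
  "set xs \<subseteq> carrier G \<Longrightarrow> set ys \<subseteq> carrier G \<Longrightarrow>
    list_product G (xs @ ys) = list_product G xs \<otimes> list_product G ys"
  by (induction xs) (auto simp: m_assoc)

lemma mult_one_swap:
  "x \<in> carrier G \<Longrightarrow> y \<in> carrier G \<Longrightarrow> x \<otimes> y = \<one> \<Longrightarrow> y \<otimes> x = \<one>"
  by (metis inv_comm)

lemma list_product_swap:
  assumes "set xs \<subseteq> carrier G" "set ys \<subseteq> carrier G" "list_product G (xs @ ys) = \<one>"
  shows "list_product G (ys @ xs) = \<one>"
  using assms mult_one_swap by (simp add: list_product_append)

lemma trivial_cycles_subset: "trivial_cycles g f D \<subseteq> cycle_sets f D"
  by (auto simp: trivial_cycles_def cycle_sets_def)

lemma finite_trivial_cycles: "finite D \<Longrightarrow> finite (trivial_cycles g f D)"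
  using finite_subset[OF trivial_cycles_subset finite_cycle_sets] .

text \<open>Two lists for the same cycle are rotations of each other, and
  \<open>x \<otimes> y = \<one>\<close> implies \<open>y \<otimes> x = \<one>\<close>.\<close>

lemma trivial_cycles_iff:
  assumes "is_cycle f ws" "set ws \<subseteq> D" "g ` D \<subseteq> carrier G"
  shows "set ws \<in> trivial_cycles g f D \<longleftrightarrow> list_product G (map g ws) = \<one>"
proof
  assume "set ws \<in> trivial_cycles g f D"
  then obtain vs where vs: "set ws = set vs" "is_cycle f vs" "list_product G (map g vs) = \<one>"
    by (auto simp: trivial_cycles_def)
  obtain x xs where x: "ws = x # xs" using assms(1) by (cases ws) (auto simp: is_cycle_def)
  then have "x \<in> set vs" using vs(1) by (metis list.set_intros(1))
  then obtain A B where AB: "vs = A @ x # B" "is_cycle f (x # B @ A)"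
    using is_cycle_rotate_to[OF vs(2)] by metis
  then have "xs = B @ A" using is_cycle_hd_eq assms(1) x by metis
  then have "ws = (x # B) @ A" using x by simp
  moreover have "set A \<subseteq> D" "set (x # B) \<subseteq> D"
    using vs(1) AB(1) assms(2) by auto
  then have "set (map g A) \<subseteq> carrier G" "set (map g (x # B)) \<subseteq> carrier G"
    using assms(3) by (simp_all only: set_map) blast+
  ultimately show "list_product G (map g ws) = \<one>"
    using list_product_swap[of "map g A" "map g (x # B)"] vs(3) AB(1) by simp
next
  assume "list_product G (map g ws) = \<one>"
  then show "set ws \<in> trivial_cycles g f D"
    using assms unfolding trivial_cycles_def by blast
qed

lemma trivial_cyclesE:
  assumes "S \<in> trivial_cycles g f D" "p \<in> S" "g ` D \<subseteq> carrier G"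
  obtains ws where "S = set (p # ws)" "is_cycle f (p # ws)" "set (p # ws) \<subseteq> D"
    "list_product G (map g (p # ws)) = \<one>"
proof -
  obtain vs where vs: "S = set vs" "is_cycle f vs" "set vs \<subseteq> D"
    using assms(1) by (auto simp: trivial_cycles_def)
  obtain A B where AB: "vs = A @ p # B" "is_cycle f (p # B @ A)"
    using is_cycle_rotate_to[OF vs(2)] vs(1) assms(2) by metis
  have S: "S = set (p # B @ A)" using AB(1) vs(1) by auto
  then have "list_product G (map g (p # B @ A)) = \<one>"
    using trivial_cycles_iff[OF AB(2) _ assms(3)] assms(1) vs by blast
  then show thesis using that[OF S AB(2)] S vs by blast
qed

lemma trivial_cycles_other:
  assumes "S \<in> trivial_cycles g f D" "p \<notin> S" "q \<notin> S"
    "\<And>x. x \<in> S \<Longrightarrow> g' x = g x" "S \<subseteq> D'"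
  shows "S \<in> trivial_cycles g' (transpose p q \<circ> f) D'"
proof -
  obtain ws where ws: "S = set ws" "is_cycle f ws" "list_product G (map g ws) = \<one>"
    using assms(1) by (auto simp: trivial_cycles_def)
  have m: "map g' ws = map g ws" using assms(4) ws(1) by simp
  have "is_cycle (transpose p q \<circ> f) ws"
    using is_cycle_transpose_other[OF ws(2)] assms(2,3) ws(1) by blast
  moreover have "list_product G (map g' ws) = \<one>" using m ws(3) by metis
  ultimately show ?thesis
    using assms(5) ws(1) unfolding trivial_cycles_def by blast
qed

lemma trivial_cycles_image_mem:
  assumes "S \<in> trivial_cycles g f D" "f x \<in> S" "bij f"
  shows "x \<in> S"
proof -
  obtain ws where ws: "S = set ws" "is_cycle f ws"
    using assms(1) by (auto simp: trivial_cycles_def)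
  then have "f ` S = S" using is_cycleD by metis
  then show ?thesis using assms(2,3) by (metis bij_is_inj image_iff inj_eq)
qed

lemma card_le_Suc_of_Diff:
  assumes "finite T" "S - {U} \<subseteq> T"
  shows "card S \<le> card T + 1"
  using card_mono[OF assms] diff_card_le_card_Diff[of "{U}" S] by simp

text \<open>Only the cycle through \<open>p\<close> is at risk; every other one misses both
  \<open>p\<close> and \<open>f p\<close>.\<close>

lemma card_trivial_cycles_delete_le_Suc:
  assumes D: "finite D" "f permutes D" "p \<in> D" and g: "g ` D \<subseteq> carrier G"
  shows "card (trivial_cycles g f D) \<le> card (trivial_cycles g (delete f p) (D - {p})) + 1"
proof -
  obtain ws where ws: "is_cycle f (p # ws)" "set (p # ws) \<subseteq> D"
    using ex_is_cycle[OF D(2,1,3)] by blast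
  have S: "set (p # ws) \<in> cycle_sets f D" using ws cycle_setsI by blast
  have "trivial_cycles g f D - {set (p # ws)} \<subseteq> trivial_cycles g (delete f p) (D - {p})"
  proof
    fix U assume U: "U \<in> trivial_cycles g f D - {set (p # ws)}"
    then have UT: "U \<in> trivial_cycles g f D" by blast
    have "U \<subseteq> D" using UT by (auto simp: trivial_cycles_def)
    have "p \<notin> U"
      using cycle_sets_disjoint[OF _ S, of U D p] U trivial_cycles_subset by fastforce
    moreover have "f p \<notin> U"
      using trivial_cycles_image_mem[OF UT] permutes_bij[OF D(2)] \<open>p \<notin> U\<close> by blast
    ultimately show "U \<in> trivial_cycles g (delete f p) (D - {p})"
      unfolding delete_def using \<open>U \<subseteq> D\<close> by (intro trivial_cycles_other[OF UT]) auto
  qed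
  then show ?thesis
    using card_le_Suc_of_Diff[OF finite_trivial_cycles] D(1) by blast
qed

text \<open>Removing a letter labelled one keeps the product along its cycle, and
  \<open>f p \<noteq> p\<close> leaves that cycle nonempty. As cycles are disjoint, removing
  \<open>p\<close> is injective on them.\<close>

lemma card_trivial_cycles_delete_one:
  assumes D: "finite D" "f permutes D" "p \<in> D" and g: "g ` D \<subseteq> carrier G"
    and p: "f p \<noteq> p" "g p = \<one>"
  shows "card (trivial_cycles g f D) \<le> card (trivial_cycles g (delete f p) (D - {p}))"
proof -
  let ?h = "\<lambda>S. S - {p}"
  have ne: "\<exists>x. x \<in> ?h S" if S: "S \<in> trivial_cycles g f D" for S
  proof (cases "p \<in> S")
    case True
    then obtain ws where ws: "S = set (p # ws)" "is_cycle f (p # ws)"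
      using trivial_cyclesE[of S g f D p] S True g by metis
    then obtain A where "ws = f p # A" using is_cycle_ConsD p(1) by metis
    then show ?thesis using ws p(1) by auto
  next
    case False
    have "S \<noteq> {}" using S by (auto simp: trivial_cycles_def is_cycle_def)
    then show ?thesis using False by blast
  qed
  have "inj_on ?h (trivial_cycles g f D)"
  proof
    fix S S' assume *: "S \<in> trivial_cycles g f D" "S' \<in> trivial_cycles g f D" "?h S = ?h S'"
    then obtain x where "x \<in> S" "x \<in> S'" using ne[OF *(1)] by blast
    then show "S = S'"
      using cycle_sets_disjoint * trivial_cycles_subset by (metis subsetD)
  qed
  moreover have "?h ` trivial_cycles g f D \<subseteq> trivial_cycles g (delete f p) (D - {p})"
  proof
    fix U assume "U \<in> ?h ` trivial_cycles g f D"
    then obtain S where S: "S \<in> trivial_cycles g f D" "U = S - {p}" by blast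
    show "U \<in> trivial_cycles g (delete f p) (D - {p})"
    proof (cases "p \<in> S")
      case True
      then obtain ws where ws: "S = set (p # ws)" "is_cycle f (p # ws)" "set (p # ws) \<subseteq> D"
        "list_product G (map g (p # ws)) = \<one>"
        using trivial_cyclesE[of S g f D p] S(1) True g by metis
      then obtain A where A: "ws = f p # A" using is_cycle_ConsD p(1) by metis
      have "is_cycle (delete f p) ws"
        using is_cycle_transpose_split(2)[of f p "[]" "f p" A] ws(2) A by (simp add: delete_def)
      moreover have "list_product G (map g ws) = \<one>"
      proof -
        have "set (map g ws) \<subseteq> carrier G" using ws(3) g by auto
        then show ?thesis using ws(4) p(2) list_product_closed by simp
      qed
      moreover have "U = set ws"
        using ws(1,2) S(2) by (auto simp: is_cycle_def)
      ultimately show ?thesis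
        using ws(2,3) unfolding trivial_cycles_def by (auto simp: is_cycle_def)
    next
      case False
      moreover have "f p \<notin> S"
        using trivial_cycles_image_mem[OF S(1)] permutes_bij[OF D(2)] False by blast
      moreover have "S \<subseteq> D" using S(1) by (auto simp: trivial_cycles_def)
      ultimately show ?thesis
        using trivial_cycles_other[OF S(1), of p "f p" g "D - {p}"] unfolding delete_def S(2) by auto
    qed
  qed
  ultimately show ?thesis
    using card_inj_on_le finite_trivial_cycles D(1) by (metis finite_Diff)
qed

text \<open>The singleton of \<open>p\<close> has a nontrivial product, so it was never counted, and
  deleting a fixed point does not change \<open>f\<close>.\<close>

lemma card_trivial_cycles_delete_fixed:
  assumes D: "finite D" "f permutes D" "p \<in> D" and g: "g ` D \<subseteq> carrier G"
    and p: "f p = p" "g p \<noteq> \<one>"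
  shows "card (trivial_cycles g f D) \<le> card (trivial_cycles g (delete f p) (D - {p}))"
proof (rule card_mono)
  show "finite (trivial_cycles g (delete f p) (D - {p}))"
    using finite_trivial_cycles D(1) by blast
  show "trivial_cycles g f D \<subseteq> trivial_cycles g (delete f p) (D - {p})"
  proof
    fix S assume S: "S \<in> trivial_cycles g f D"
    have "p \<notin> S"
    proof
      assume "p \<in> S"
      then obtain ws where ws: "is_cycle f (p # ws)" "list_product G (map g (p # ws)) = \<one>"
        using trivial_cyclesE[of S g f D p] S g by metis
      then have "ws = []" using is_cycle_fixed[of f "p # ws" p] p(1) by simp
      then show False using ws(2) p(2) g D(3) by auto
    qed
    then show "S \<in> trivial_cycles g (delete f p) (D - {p})"
      using S using delete_fixed[of f p] p(1) unfolding trivial_cycles_def by auto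
  qed
qed

text \<open>If \<open>p\<close> and \<open>q\<close> share a cycle, only that cycle is at risk. If
  they lie on two trivial cycles, the remainders of these have products \<open>inv (g p)\<close> and
  \<open>g p\<close>, so the merged cycle is trivial again. If \<open>q\<close> directly follows
  \<open>p\<close>, the split yields the trivial singleton of \<open>p\<close> and a cycle with the
  same product as before.\<close>

lemma card_trivial_cycles_glue:
  assumes D: "finite D" "f permutes D" "p \<in> D" "q \<in> D" "p \<noteq> q" and g: "g ` D \<subseteq> carrier G"
    and inv: "g q = inv (g p)"
  defines "f' \<equiv> transpose p q \<circ> f" and "g' \<equiv> g(p := \<one>, q := \<one>)"
  shows "card (trivial_cycles g f D) \<le> card (trivial_cycles g' f' D) + 1"
    and "f p = q \<Longrightarrow> card (trivial_cycles g f D) + 1 \<le> card (trivial_cycles g' f' D)"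
proof -
  let ?T = "trivial_cycles g f D" and ?T' = "trivial_cycles g' f' D"
  have gp: "g p \<in> carrier G" using g D(3) by blast
  have gc: "set ws \<subseteq> D \<Longrightarrow> set (map g ws) \<subseteq> carrier G" for ws using g by auto
  have fin: "finite ?T" "finite ?T'" using D(1) by (simp_all add: finite_trivial_cycles)
  obtain B where B: "is_cycle f (p # B)" "set (p # B) \<subseteq> D"
    using ex_is_cycle[OF D(2,1,3)] by auto
  have SB: "set (p # B) \<in> cycle_sets f D" using B cycle_setsI by blast
  have other: "S \<in> ?T'" if "S \<in> ?T" "p \<notin> S" "q \<notin> S" for S
    unfolding f'_def using that
    by (intro trivial_cycles_other[OF that]) (auto simp: g'_def trivial_cycles_def)
  have map_g': "map g' ws = map g ws" if "p \<notin> set ws" "q \<notin> set ws" for ws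
    using that by (auto simp: g'_def)
  show "card ?T \<le> card ?T' + 1"
  proof (cases "q \<in> set (p # B)")
    case True
    have "?T - {set (p # B)} \<subseteq> ?T'"
    proof
      fix S assume S: "S \<in> ?T - {set (p # B)}"
      then have "p \<notin> S" "q \<notin> S"
        using cycle_sets_disjoint[OF _ SB, of S D] True trivial_cycles_subset by fastforce+
      then show "S \<in> ?T'" using other S by blast
    qed
    then show ?thesis using card_le_Suc_of_Diff[OF fin(2)] by blast
  next
    case False
    obtain A where A: "is_cycle f (q # A)" "set (q # A) \<subseteq> D"
      using ex_is_cycle[OF D(2,1,4)] by auto
    have SA: "set (q # A) \<in> cycle_sets f D" using A cycle_setsI by blast
    have sub: "?T - {set (p # B), set (q # A)} \<subseteq> ?T'"
    proof
      fix S assume S: "S \<in> ?T - {set (p # B), set (q # A)}"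
      then have "p \<notin> S" "q \<notin> S"
        using cycle_sets_disjoint[OF _ SB, of S D p] cycle_sets_disjoint[OF _ SA, of S D q]
          trivial_cycles_subset by fastforce+
      then show "S \<in> ?T'" using other S by blast
    qed
    show ?thesis
    proof (cases "set (p # B) \<in> ?T \<and> set (q # A) \<in> ?T")
      case True
      have disj: "set (p # B) \<inter> set (q # A) = {}"
        using is_cycle_set_eq[OF B(1) A(1)] False by force
      let ?S = "set (p # B @ q # A)"
      have c: "is_cycle f' (p # B @ q # A)"
        unfolding f'_def using is_cycle_transpose_merge[OF B(1) A(1) False] .
      let ?b = "list_product G (map g B)" and ?a = "list_product G (map g A)"
      have cl: "?a \<in> carrier G" "?b \<in> carrier G"
        using gc[of A] gc[of B] A(2) B(2) by (auto intro: list_product_closed)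
      have "g p \<otimes> ?b = \<one>" "inv (g p) \<otimes> ?a = \<one>"
        using True trivial_cycles_iff[OF B g] trivial_cycles_iff[OF A g] inv by simp_all
      then have "?b = inv (g p)" "?a = g p"
        using gp cl by (metis inv_equality inv_comm inv_inv inv_closed)+
      moreover have m: "map g' (p # B @ q # A) = \<one> # map g B @ \<one> # map g A"
        using disj B(1) A(1) False by (simp add: map_g' is_cycle_def) (simp add: g'_def)
      ultimately have "list_product G (map g' (p # B @ q # A)) = \<one>"
        using gp cl gc[of A] gc[of B] A(2) B(2) unfolding m by (simp add: list_product_append)
      moreover have "?S \<subseteq> D" using A(2) B(2) by auto
      ultimately have "?S \<in> ?T'"
        using c unfolding trivial_cycles_def by blast
      moreover have "?S \<notin> ?T - {set (p # B), set (q # A)}"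
        using cycle_sets_disjoint[OF _ SB, of ?S D p] trivial_cycles_subset by fastforce
      ultimately have "card (?T - {set (p # B), set (q # A)}) + 1 \<le> card ?T'"
        using sub card_mono[of ?T' "insert ?S (?T - {set (p # B), set (q # A)})"] fin by simp
      moreover have "card ?T \<le> card (?T - {set (p # B), set (q # A)}) + 2"
        using diff_card_le_card_Diff[of "{set (p # B), set (q # A)}" ?T]
        by (simp add: card_insert_if split: if_splits)
      ultimately show ?thesis by simp
    next
      \<comment> \<open>At most one of the two merged cycles is trivial, and only this one can be
        lost.\<close>
      case False
      then have "?T - {set (p # B)} \<subseteq> ?T' \<or> ?T - {set (q # A)} \<subseteq> ?T'"
        using sub by blast
      then show ?thesis using card_le_Suc_of_Diff[OF fin(2)] by blast
    qed
  qed
  show "card ?T + 1 \<le> card ?T'" if fp: "f p = q"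
  proof -
    obtain A where A: "B = q # A" using is_cycle_ConsD[OF B(1)] fp D(5) by metis
    let ?S = "set (p # B)" and ?S1 = "set [p]" and ?S2 = "set (q # A)"
    have c: "is_cycle f' [p]" "is_cycle f' (q # A)"
      unfolding f'_def using is_cycle_transpose_split[of f p "[]" q A] B(1) A by simp_all
    have g'D: "g' ` D \<subseteq> carrier G" using g by (auto simp: g'_def)
    have sub: "?T - {?S} \<subseteq> ?T'"
    proof
      fix S assume S: "S \<in> ?T - {?S}"
      have "p \<notin> S" "q \<notin> S"
        using cycle_sets_disjoint[OF _ SB, of S D] S A trivial_cycles_subset by fastforce+
      then show "S \<in> ?T'" using other S by blast
    qed
    have 1: "?S1 \<in> ?T'"
      using trivial_cycles_iff[OF c(1) _ g'D] D(3) by (simp add: g'_def)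
    have n1: "?S1 \<notin> ?T - {?S}" and n2: "?S2 \<notin> ?T - {?S}"
      using cycle_sets_disjoint[OF _ SB, of _ D] A D(5) trivial_cycles_subset by fastforce+
    show ?thesis
    proof (cases "?S \<in> ?T")
      case True
      have dA: "p \<notin> set A" "q \<notin> set A" using B(1) A by (auto simp: is_cycle_def)
      have cA: "list_product G (map g A) \<in> carrier G"
        using gc[of A] A B(2) by (auto intro: list_product_closed)
      have "g p \<otimes> (inv (g p) \<otimes> list_product G (map g A)) = \<one>"
        using True trivial_cycles_iff[OF B g] A inv by simp
      then have "list_product G (map g A) = \<one>"
        using gp cA by (simp flip: m_assoc)
      then have "list_product G (map g' (q # A)) = \<one>"
        using map_g'[OF dA] gc by (simp del: map_eq_conv) (simp add: g'_def)
      then have 2: "?S2 \<in> ?T'"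
        using trivial_cycles_iff[OF c(2) _ g'D] A B(2) by simp
      have "card (insert ?S1 (insert ?S2 (?T - {?S}))) \<le> card ?T'"
        using 1 2 sub fin(2) by (intro card_mono) auto
      moreover have "?S1 \<noteq> ?S2" using D(5) dA by auto
      ultimately show ?thesis
        using n1 n2 fin(1) True card_Suc_Diff1[OF fin(1) True] by simp
    next
      case False
      then have "insert ?S1 ?T \<subseteq> ?T'" "?S1 \<notin> ?T" using sub 1 n1 by auto
      then show ?thesis using card_mono[OF fin(2), of "insert ?S1 ?T"] fin(1) by simp
    qed
  qed
qed

end

section \<open>Diagrams and their moves\<close>

lemma is_cycle_delete_other:
  assumes "is_cycle f ws" "p \<notin> set ws" "inj f"
  shows "is_cycle (delete f p) ws"
proof -
  have "f p \<notin> set ws"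
    using is_cycleD[OF assms(1)] assms(2,3) by (metis image_iff inj_eq)
  then show ?thesis
    unfolding delete_def using is_cycle_transpose_other assms(1,2) by metis
qed

lemma is_cycle_delete:
  assumes "is_cycle f (p # ws)" "ws \<noteq> []"
  shows "is_cycle (delete f p) ws"
proof -
  obtain A where "ws = f p # A"
    using assms by (cases ws) (auto simp: is_cycle_def)
  then show ?thesis
    using is_cycle_transpose_split(2)[of f p "[]" "f p" A] assms(1) by (simp add: delete_def)
qed

text \<open>The transposition merges the fixed point \<open>q\<close> into the cycle just before
  \<open>f p\<close>, that is, right after \<open>p\<close>.\<close>

lemma is_cycle_insert:
  assumes "is_cycle f (p # A)" "f q = q" "q \<notin> set (p # A)"
  shows "is_cycle (transpose q (f p) \<circ> f) (p # q # A)"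
proof -
  have c: "is_cycle f (A @ [p])"
    using is_cycle_swap[of f "[p]" A] assms(1) by simp
  obtain A' where A': "A @ [p] = f p # A'"
    using assms(1) by (cases A) (auto simp: is_cycle_def)
  have "f p \<in> set (p # A)" using arg_cong[OF A', of set] by auto
  then have "is_cycle (transpose q (f p) \<circ> f) (q # [] @ f p # A')"
    using c A' assms(2,3) by (intro is_cycle_transpose_merge) (auto simp: is_cycle_single)
  then have "is_cycle (transpose q (f p) \<circ> f) ((q # A) @ [p])"
    using A' by simp
  then show ?thesis using is_cycle_swap by fastforce
qed

context group
begin

text \<open>
  The number \<open>s\<close> bounds minus the Euler characteristic of the surface; only the cycles of \<open>\<pi>\<close> with
  trivial product can be filled by discs. The colour \<open>c\<close> of a letter is the index of its factor.
\<close>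

definition diagram :: "nat set \<Rightarrow> (nat \<Rightarrow> nat) \<Rightarrow> (nat \<Rightarrow> nat) \<Rightarrow> (nat \<Rightarrow> 'i) \<Rightarrow> (nat \<Rightarrow> 'a) \<Rightarrow> int \<Rightarrow> bool"
  where "diagram D \<sigma> \<pi> c g s \<longleftrightarrow>
    finite D \<and> \<sigma> permutes D \<and> \<pi> permutes D \<and> (\<forall>x\<in>D. c (\<pi> x) = c x) \<and> g ` D \<subseteq> carrier G \<and>
    int (card D) \<le> s + int (card (trivial_cycles g \<pi> D)) + int (card (cycle_sets (perm_inv \<pi> \<circ> \<sigma>) D))"

text \<open>The list \<open>U\<close> of cyclic words is the boundary of a surface with \<open>- \<chi> \<le> s\<close>.\<close>

definition bounds :: "('i \<times> 'a) list list \<Rightarrow> int \<Rightarrow> bool" where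
  "bounds U s \<longleftrightarrow> (\<exists>D \<sigma> \<pi> c g V. diagram D \<sigma> \<pi> c g s \<and> distinct (concat V) \<and> set (concat V) = D \<and>
     (\<forall>ws \<in> set V. is_cycle \<sigma> ws) \<and> U = map (map (\<lambda>x. (c x, g x))) V)"

lemma boundsI:
  assumes "diagram D \<sigma> \<pi> c g s" "distinct (concat V)" "set (concat V) = D"
    "\<forall>ws \<in> set V. is_cycle \<sigma> ws" "U = map (map (\<lambda>x. (c x, g x))) V"
  shows "bounds U s"
  unfolding bounds_def using assms
  by (intro exI[of _ D] exI[of _ \<sigma>] exI[of _ \<pi>] exI[of _ c] exI[of _ g] exI[of _ V]) simp

text \<open>Both permutations are composed on the left with the same transposition, which cancels in
  \<open>perm_inv \<pi> \<circ> \<sigma>\<close>. So only the trivial cycles of \<open>\<pi>\<close>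
  matter: at most one is lost, and one is gained if \<open>\<pi>\<close> sends \<open>p\<close> to
  \<open>q\<close>.\<close>

lemma
  assumes d: "diagram D \<sigma> \<pi> c g s" and pq: "p \<in> D" "q \<in> D" "p \<noteq> q" "c p = c q" "g q = inv (g p)"
  shows diagram_glue: "diagram D (transpose p q \<circ> \<sigma>) (transpose p q \<circ> \<pi>) c (g(p := \<one>, q := \<one>)) (s + 1)"
    and diagram_glue_adjacent: "\<pi> p = q \<Longrightarrow>
      diagram D (transpose p q \<circ> \<sigma>) (transpose p q \<circ> \<pi>) c (g(p := \<one>, q := \<one>)) (s - 1)"
proof -
  let ?t = "transpose p q"
  have d': "finite D" "\<sigma> permutes D" "\<pi> permutes D" "\<forall>x\<in>D. c (\<pi> x) = c x" "g ` D \<subseteq> carrier G"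
    "int (card D) \<le> s + int (card (trivial_cycles g \<pi> D)) + int (card (cycle_sets (perm_inv \<pi> \<circ> \<sigma>) D))"
    using d by (simp_all add: diagram_def)
  have "perm_inv (?t \<circ> \<pi>) = perm_inv \<pi> \<circ> ?t"
    using permutes_bij[OF d'(3)] by (simp add: o_inv_distrib)
  then have k: "perm_inv (?t \<circ> \<pi>) \<circ> (?t \<circ> \<sigma>) = perm_inv \<pi> \<circ> \<sigma>"
    by (simp add: fun_eq_iff)
  have p: "?t \<circ> \<sigma> permutes D" "?t \<circ> \<pi> permutes D"
    using permutes_transpose_comp[OF d'(2) pq(1,2)] permutes_transpose_comp[OF d'(3) pq(1,2)] by simp_all
  have "c (?t y) = c y" for y using pq(4) by (simp add: transpose_def)
  then have c: "\<forall>x\<in>D. c ((?t \<circ> \<pi>) x) = c x"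
    using d'(4) by simp
  have g: "(g(p := \<one>, q := \<one>)) ` D \<subseteq> carrier G"
    using d'(5) by auto
  note T = card_trivial_cycles_glue[OF d'(1,3) pq(1,2,3) d'(5) pq(5)]
  show "diagram D (?t \<circ> \<sigma>) (?t \<circ> \<pi>) c (g(p := \<one>, q := \<one>)) (s + 1)"
    using T(1) d' p c g unfolding diagram_def k by linarith
  show "diagram D (?t \<circ> \<sigma>) (?t \<circ> \<pi>) c (g(p := \<one>, q := \<one>)) (s - 1)" if "\<pi> p = q"
    using T(2)[OF that] d' p c g unfolding diagram_def k by linarith
qed

text \<open>The letter that leaves \<open>D\<close> accounts for the \<open>+ 1\<close>: the two
  disc counts together may drop by one while \<open>s\<close> stays the same.\<close>

lemma diagram_delete:
  assumes d: "diagram D \<sigma> \<pi> c g s" and p: "p \<in> D"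
    and le: "int (card (trivial_cycles g \<pi> D)) + int (card (cycle_sets (perm_inv \<pi> \<circ> \<sigma>) D)) + s \<le>
      int (card (trivial_cycles g (delete \<pi> p) (D - {p}))) +
      int (card (cycle_sets (perm_inv (delete \<pi> p) \<circ> delete \<sigma> p) (D - {p}))) + t + 1"
  shows "diagram (D - {p}) (delete \<sigma> p) (delete \<pi> p) c g t"
proof -
  have d': "finite D" "\<sigma> permutes D" "\<pi> permutes D" "\<forall>x\<in>D. c (\<pi> x) = c x" "g ` D \<subseteq> carrier G"
    "int (card D) \<le> s + int (card (trivial_cycles g \<pi> D)) + int (card (cycle_sets (perm_inv \<pi> \<circ> \<sigma>) D))"
    using d by (simp_all add: diagram_def)
  have "c (delete \<pi> p x) = c x" if "x \<in> D - {p}" for x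
  proof -
    have "delete \<pi> p x = \<pi> p \<and> \<pi> x = p \<or> delete \<pi> p x = \<pi> x"
      using permutes_inj[OF d'(3)] that by (auto simp: delete_def transpose_def inj_eq)
    then show ?thesis using d'(4) that p by auto
  qed
  moreover have "card D = card (D - {p}) + 1"
    using d'(1) p by (metis Suc_eq_plus1 card_Suc_Diff1)
  ultimately show ?thesis
    using d' le delete_permutes[OF _ p] unfolding diagram_def by auto
qed

text \<open>The joint loss in the two disc counts is at most 1, 0, 2 and 1 in the four cases,
  against one letter removed from \<open>D\<close>. In the first and the last case it depends on
  \<open>\<pi> p = p\<close> which of the two counts may lose.\<close>

lemma
  assumes d: "diagram D \<sigma> \<pi> c g s" and p: "p \<in> D"
  shows diagram_delete_one: "\<sigma> p \<noteq> p \<Longrightarrow> g p = \<one> \<Longrightarrow>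
      diagram (D - {p}) (delete \<sigma> p) (delete \<pi> p) c g s"
    and diagram_delete_loop: "\<sigma> p = p \<Longrightarrow> \<pi> p \<noteq> p \<Longrightarrow> g p = \<one> \<Longrightarrow>
      diagram (D - {p}) (delete \<sigma> p) (delete \<pi> p) c g (s - 1)"
    and diagram_delete_isolated: "\<sigma> p = p \<Longrightarrow> \<pi> p = p \<Longrightarrow>
      diagram (D - {p}) (delete \<sigma> p) (delete \<pi> p) c g (s + 1)"
    and diagram_delete_nontrivial: "\<sigma> p = p \<Longrightarrow> g p \<noteq> \<one> \<Longrightarrow>
      diagram (D - {p}) (delete \<sigma> p) (delete \<pi> p) c g s"
proof -
  have d': "finite D" "\<sigma> permutes D" "\<pi> permutes D" "g ` D \<subseteq> carrier G"
    using d by (simp_all add: diagram_def)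
  note T = card_trivial_cycles_delete_le_Suc[OF d'(1,3) p d'(4)]
    and T1 = card_trivial_cycles_delete_one[OF d'(1,3) p d'(4)]
    and T2 = card_trivial_cycles_delete_fixed[OF d'(1,3) p d'(4)]
    and K = card_cycle_sets_quotient_delete[OF d'(1) p d'(2,3)]
  show "diagram (D - {p}) (delete \<sigma> p) (delete \<pi> p) c g s" if "\<sigma> p \<noteq> p" "g p = \<one>"
    using that T T1 K by (intro diagram_delete[OF d p]) (cases "\<pi> p = p"; simp)
  show "diagram (D - {p}) (delete \<sigma> p) (delete \<pi> p) c g (s - 1)"
    if "\<sigma> p = p" "\<pi> p \<noteq> p" "g p = \<one>"
    using that T1 K by (intro diagram_delete[OF d p]) simp
  show "diagram (D - {p}) (delete \<sigma> p) (delete \<pi> p) c g (s + 1)" if "\<sigma> p = p" "\<pi> p = p"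
    using that T K by (intro diagram_delete[OF d p]) simp
  show "diagram (D - {p}) (delete \<sigma> p) (delete \<pi> p) c g s" if "\<sigma> p = p" "g p \<noteq> \<one>"
    using that T T2 K by (intro diagram_delete[OF d p]) (cases "\<pi> p = p"; simp)
qed

text \<open>
  If the glued pair bounds a disc of its own, gluing produces an isolated point; deleting it costs
  what the gluing has gained.
\<close>

lemma diagram_cancel:
  assumes d: "diagram D \<sigma> \<pi> c g s" and pq: "p \<in> D" "q \<in> D" "p \<noteq> q" "c p = c q" "g q = inv (g p)"
    and s: "\<sigma> p = q" "\<sigma> q \<noteq> p"
  shows "\<exists>\<pi>'. diagram (D - {p} - {q}) (delete (delete (transpose p q \<circ> \<sigma>) p) q) \<pi>' c (g(p := \<one>, q := \<one>)) s"
proof -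
  let ?s = "transpose p q \<circ> \<sigma>" and ?p = "transpose p q \<circ> \<pi>" and ?g = "g(p := \<one>, q := \<one>)"
  have sp: "?s p = p" using s by simp
  have "\<sigma> q \<noteq> q" using s(1) pq(3) permutes_inj[of \<sigma> D] d by (metis diagram_def injD)
  then have sq: "?s q \<noteq> q" using s(2) by (auto simp: transpose_def)
  have g: "?g p = \<one>" "?g q = \<one>" by simp_all
  have "diagram (D - {p}) (delete ?s p) (delete ?p p) c ?g s"
  proof (cases "?p p = p")
    case True
    then have "\<pi> p = q" by (auto simp: transpose_def split: if_splits)
    from diagram_delete_isolated[OF diagram_glue_adjacent[OF d pq this] pq(1) sp True]
    show ?thesis by (simp only: diff_add_cancel)
  next
    \<comment> \<open>Now the gluing costs one, and removing the loop that it creates for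
      \<open>\<sigma>\<close> at \<open>p\<close> gives it back.\<close>
    case False
    from diagram_delete_loop[OF diagram_glue[OF d pq] pq(1) sp False g(1)]
    show ?thesis by (simp only: add_diff_cancel)
  qed
  moreover have "delete ?s p q \<noteq> q"
    using sp sq delete_fixed[of ?s p] by metis
  ultimately show ?thesis
    using diagram_delete_one[of "D - {p}" "delete ?s p" "delete ?p p" c ?g s q] pq g by blast
qed

section \<open>Moves on cyclic boundary words\<close>

lemma boundsE:
  assumes "bounds (W # U) s"
  obtains D \<sigma> \<pi> c g ws V where "diagram D \<sigma> \<pi> c g s" "distinct (ws @ concat V)"
    "D = set ws \<union> set (concat V)" "is_cycle \<sigma> ws" "\<forall>vs \<in> set V. is_cycle \<sigma> vs"
    "W = map (\<lambda>x. (c x, g x)) ws" "U = map (map (\<lambda>x. (c x, g x))) V"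
proof -
  obtain D \<sigma> \<pi> c g V' where *: "diagram D \<sigma> \<pi> c g s" "distinct (concat V')" "set (concat V') = D"
     "\<forall>ws \<in> set V'. is_cycle \<sigma> ws" "W # U = map (map (\<lambda>x. (c x, g x))) V'"
    using assms unfolding bounds_def by (elim exE conjE) (rule that)
  then obtain ws V where V': "V' = ws # V" by (cases V') auto
  show thesis
    using *(2-5) unfolding V' by (intro that[OF *(1), of ws V]) simp_all
qed

lemma bounds_rotate:
  assumes "bounds ((A @ B) # U) s"
  shows "bounds ((B @ A) # U) s"
proof -
  obtain D \<sigma> \<pi> c g ws V where *: "diagram D \<sigma> \<pi> c g s" "distinct (ws @ concat V)"
    "D = set ws \<union> set (concat V)" "is_cycle \<sigma> ws" "\<forall>vs \<in> set V. is_cycle \<sigma> vs"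
    "A @ B = map (\<lambda>x. (c x, g x)) ws" "U = map (map (\<lambda>x. (c x, g x))) V"
    using assms by (rule boundsE)
  obtain a b where ab: "ws = a @ b" "A = map (\<lambda>x. (c x, g x)) a" "B = map (\<lambda>x. (c x, g x)) b"
    using *(6) unfolding append_eq_map_conv by blast
  show ?thesis
    using * ab is_cycle_swap[of \<sigma> a b] by (intro boundsI[OF *(1), of "(b @ a) # V"]) auto
qed

lemma bounds_swap: "bounds (A # B # U) s \<Longrightarrow> bounds (B # A # U) s"
proof -
  assume "bounds (A # B # U) s"
  then obtain D \<sigma> \<pi> c g V' where *: "diagram D \<sigma> \<pi> c g s" "distinct (concat V')" "set (concat V') = D"
     "\<forall>ws \<in> set V'. is_cycle \<sigma> ws" "A # B # U = map (map (\<lambda>x. (c x, g x))) V'"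
    unfolding bounds_def by (elim exE conjE) (rule that)
  then obtain a b V where V': "V' = a # b # V" by (cases V'; cases "tl V'") auto
  show "bounds (B # A # U) s"
    using *(2-5) unfolding V' by (intro boundsI[OF *(1), of "b # a # V"]) auto
qed

definition letter_inv :: "'i \<times> 'a \<Rightarrow> 'i \<times> 'a" where
  "letter_inv x = (fst x, inv (snd x))"

text \<open>Gluing two inverse letters of one boundary curve leaves two curves, at a cost of one.
  Both letters get the label one; as neither \<open>A\<close> nor \<open>B\<close> is empty, neither
  letter is alone on its curve, and both are erased for free.\<close>

lemma bounds_split:
  assumes b: "bounds ((x # B @ letter_inv x # A) # U) s" and ne: "A \<noteq> []" "B \<noteq> []"
  shows "bounds (A # B # U) (s + 1)"
proof -
  obtain D \<sigma> \<pi> c g ws V where *: "diagram D \<sigma> \<pi> c g s" "distinct (ws @ concat V)"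
    "D = set ws \<union> set (concat V)" "is_cycle \<sigma> ws" "\<forall>vs \<in> set V. is_cycle \<sigma> vs"
    "x # B @ letter_inv x # A = map (\<lambda>x. (c x, g x)) ws" "U = map (map (\<lambda>x. (c x, g x))) V"
    using b by (rule boundsE)
  let ?l = "\<lambda>x. (c x, g x)"
  obtain p bs q as where ws: "ws = p # bs @ q # as" "x = ?l p" "B = map ?l bs"
    "letter_inv x = ?l q" "A = map ?l as"
    using *(6) by (auto simp: Cons_eq_map_conv append_eq_map_conv)
  have pq: "p \<in> D" "q \<in> D" "p \<noteq> q" "c p = c q" "g q = inv (g p)"
    using ws *(2,3) by (auto simp: letter_inv_def)
  have ne': "as \<noteq> []" "bs \<noteq> []" using ne ws by auto
  let ?s = "transpose p q \<circ> \<sigma>" and ?p = "transpose p q \<circ> \<pi>" and ?g = "g(p := \<one>, q := \<one>)"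
  have d1: "diagram D ?s ?p c ?g (s + 1)" using diagram_glue[OF *(1) pq] .
  have c1: "is_cycle ?s (p # bs)" "is_cycle ?s (q # as)"
    using is_cycle_transpose_split *(4) ws(1) by metis+
  have inj1: "inj ?s" using d1 permutes_inj unfolding diagram_def by blast
  have "?s p \<noteq> p" using c1(1) ne'(2) is_cycle_fixed by fastforce
  then have d2: "diagram (D - {p}) (delete ?s p) (delete ?p p) c ?g (s + 1)"
    using diagram_delete_one[OF d1 pq(1)] by simp
  have c2: "is_cycle (delete ?s p) bs" "is_cycle (delete ?s p) (q # as)"
    using is_cycle_delete[OF c1(1) ne'(2)] is_cycle_delete_other[OF c1(2) _ inj1] ws(1) *(2) by auto
  have inj2: "inj (delete ?s p)" using d2 permutes_inj unfolding diagram_def by blast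
  have "delete ?s p q \<noteq> q" using c2(2) ne'(1) is_cycle_fixed by fastforce
  then have d3: "diagram (D - {p} - {q}) (delete (delete ?s p) q) (delete (delete ?p p) q) c ?g (s + 1)"
    using diagram_delete_one[OF d2] pq by simp
  have c3: "is_cycle (delete (delete ?s p) q) bs" "is_cycle (delete (delete ?s p) q) as"
    using is_cycle_delete[OF c2(2) ne'(1)] is_cycle_delete_other[OF c2(1) _ inj2] ws(1) *(2) by auto
  have "is_cycle (delete (delete ?s p) q) vs" if "vs \<in> set V" for vs
  proof -
    have "p \<notin> set vs" "q \<notin> set vs" using that ws(1) *(2) by auto
    then show ?thesis
      using *(5) that is_cycle_transpose_other is_cycle_delete_other inj1 inj2 by metis
  qed
  then show ?thesis
    using c3 ws(1,3,5) *(2,3,7) by (intro boundsI[OF d3, of "as # bs # V"]) auto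
qed

text \<open>Gluing along letters of two boundary curves joins them into one, again at a cost of one.
  Since \<open>A @ B\<close> is nonempty, the second letter is not alone on its curve when it is
  erased.\<close>

lemma bounds_merge:
  assumes b: "bounds ((x # A) # (letter_inv x # B) # U) s" and ne: "A @ B \<noteq> []"
  shows "bounds ((A @ B) # U) (s + 1)"
proof -
  obtain D \<sigma> \<pi> c g ws V' where *: "diagram D \<sigma> \<pi> c g s" "distinct (ws @ concat V')"
    "D = set ws \<union> set (concat V')" "is_cycle \<sigma> ws" "\<forall>vs \<in> set V'. is_cycle \<sigma> vs"
    "x # A = map (\<lambda>x. (c x, g x)) ws" "(letter_inv x # B) # U = map (map (\<lambda>x. (c x, g x))) V'"
    using b by (rule boundsE)
  let ?l = "\<lambda>x. (c x, g x)"
  obtain p as q bs V where ws: "ws = p # as" "x = ?l p" "A = map ?l as"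
    "V' = (q # bs) # V" "letter_inv x = ?l q" "B = map ?l bs" "U = map (map ?l) V"
    using *(6,7) by (auto simp: Cons_eq_map_conv)
  have pq: "p \<in> D" "q \<in> D" "p \<noteq> q" "c p = c q" "g q = inv (g p)"
    using ws *(2,3) by (auto simp: letter_inv_def)
  have ne': "as @ bs \<noteq> []" using ne ws by auto
  let ?s = "transpose p q \<circ> \<sigma>" and ?p = "transpose p q \<circ> \<pi>" and ?g = "g(p := \<one>, q := \<one>)"
  have d1: "diagram D ?s ?p c ?g (s + 1)" using diagram_glue[OF *(1) pq] .
  have "is_cycle ?s (p # as @ q # bs)"
    using *(2,4,5) ws by (intro is_cycle_transpose_merge) auto
  then have c1: "is_cycle ?s (p # as @ q # bs)" .
  have inj1: "inj ?s" using d1 permutes_inj unfolding diagram_def by blast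
  have "?s p \<noteq> p" using c1 is_cycle_fixed by fastforce
  then have d2: "diagram (D - {p}) (delete ?s p) (delete ?p p) c ?g (s + 1)"
    using diagram_delete_one[OF d1 pq(1)] by simp
  have "is_cycle (delete ?s p) (as @ q # bs)"
    using is_cycle_delete[OF c1] by simp
  then have c2: "is_cycle (delete ?s p) (q # bs @ as)"
    using is_cycle_swap[of _ as "q # bs"] by simp
  have inj2: "inj (delete ?s p)" using d2 permutes_inj unfolding diagram_def by blast
  have "delete ?s p q \<noteq> q" using c2 ne' is_cycle_fixed[OF c2, of q] by auto
  then have d3: "diagram (D - {p} - {q}) (delete (delete ?s p) q) (delete (delete ?p p) q) c ?g (s + 1)"
    using diagram_delete_one[OF d2] pq by simp
  have "is_cycle (delete (delete ?s p) q) (bs @ as)"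
    using is_cycle_delete[OF c2] ne' by auto
  then have c3: "is_cycle (delete (delete ?s p) q) (as @ bs)"
    using is_cycle_swap by blast
  have "is_cycle (delete (delete ?s p) q) vs" if "vs \<in> set V" for vs
  proof -
    have "p \<notin> set vs" "q \<notin> set vs" "is_cycle \<sigma> vs" using that ws(1,4) *(2,5) by auto
    then show ?thesis
      using is_cycle_transpose_other is_cycle_delete_other inj1 inj2 by metis
  qed
  then show ?thesis
    using c3 ws *(2,3) by (intro boundsI[OF d3, of "(as @ bs) # V"]) auto
qed

text \<open>Cyclically, \<open>x\<close> is followed at once by its inverse, so the pair folds up
  without changing \<open>s\<close>. On the other side the letters of \<open>B\<close> keep the two
  apart, as \<open>diagram_cancel\<close> requires.\<close>

lemma bounds_cancel:
  assumes b: "bounds ((letter_inv x # B @ [x]) # U) s" and ne: "B \<noteq> []"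
  shows "bounds (B # U) s"
proof -
  obtain D \<sigma> \<pi> c g ws V where *: "diagram D \<sigma> \<pi> c g s" "distinct (ws @ concat V)"
    "D = set ws \<union> set (concat V)" "is_cycle \<sigma> ws" "\<forall>vs \<in> set V. is_cycle \<sigma> vs"
    "letter_inv x # B @ [x] = map (\<lambda>x. (c x, g x)) ws" "U = map (map (\<lambda>x. (c x, g x))) V"
    using b by (rule boundsE)
  let ?l = "\<lambda>x. (c x, g x)"
  obtain q bs p where ws: "ws = q # bs @ [p]" "x = ?l p" "B = map ?l bs" "letter_inv x = ?l q"
    using *(6) by (auto simp: Cons_eq_map_conv append_eq_map_conv)
  have pq: "p \<in> D" "q \<in> D" "p \<noteq> q" "c p = c q" "g q = inv (g p)"
    using ws *(2,3) by (auto simp: letter_inv_def)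
  have ne': "bs \<noteq> []" using ne ws by auto
  have c0: "is_cycle \<sigma> (p # [] @ q # bs)"
    using is_cycle_swap[of \<sigma> "q # bs" "[p]"] *(4) ws(1) by simp
  have s: "\<sigma> p = q" using c0 by (simp add: is_cycle_def)
  have s': "\<sigma> q \<noteq> p" using *(2,4) ws(1) ne' by (cases bs) (auto simp: is_cycle_def)
  let ?s = "transpose p q \<circ> \<sigma>" and ?g = "g(p := \<one>, q := \<one>)"
  obtain \<pi>' where d3: "diagram (D - {p} - {q}) (delete (delete ?s p) q) \<pi>' c ?g s"
    using diagram_cancel[OF *(1) pq s s'] by blast
  have perm: "?s permutes D"
    using *(1) permutes_transpose_comp[OF _ pq(1,2)] by (simp add: diagram_def)
  have inj1: "inj ?s" using permutes_inj[OF perm] .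
  have inj2: "inj (delete ?s p)" using permutes_inj[OF delete_permutes[OF perm pq(1)]] .
  have "is_cycle ?s (q # bs)" using is_cycle_transpose_split(2)[OF c0] .
  then have "is_cycle (delete ?s p) (q # bs)"
    using is_cycle_delete_other[OF _ _ inj1, of "q # bs" p] ws(1) *(2) by auto
  then have c3: "is_cycle (delete (delete ?s p) q) bs"
    using is_cycle_delete ne' by metis
  have "is_cycle (delete (delete ?s p) q) vs" if "vs \<in> set V" for vs
  proof -
    have "p \<notin> set vs" "q \<notin> set vs" using that ws(1) *(2) by auto
    then show ?thesis
      using *(5) that is_cycle_transpose_other is_cycle_delete_other inj1 inj2 by metis
  qed
  then show ?thesis
    using c3 ws(1,3) *(2,3,7) by (intro boundsI[OF d3, of "bs # V"]) auto
qed

text \<open>If \<open>\<pi>\<close> fixes the only letter of the curve, its nontrivial label means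
  that no trivial cycle is lost, only a cycle of the quotient; otherwise only a trivial cycle can be
  lost. Either way the loss is paid for by the letter itself.\<close>

lemma bounds_drop:
  assumes b: "bounds ([x] # U) s" and ne: "snd x \<noteq> \<one>"
  shows "bounds U s"
proof -
  obtain D \<sigma> \<pi> c g ws V where *: "diagram D \<sigma> \<pi> c g s" "distinct (ws @ concat V)"
    "D = set ws \<union> set (concat V)" "is_cycle \<sigma> ws" "\<forall>vs \<in> set V. is_cycle \<sigma> vs"
    "[x] = map (\<lambda>x. (c x, g x)) ws" "U = map (map (\<lambda>x. (c x, g x))) V"
    using b by (rule boundsE)
  obtain p where p: "ws = [p]" "x = (c p, g p)" using *(6) by auto
  have sp: "\<sigma> p = p" using *(4) p(1) by (simp add: is_cycle_single)
  have "diagram (D - {p}) (delete \<sigma> p) (delete \<pi> p) c g s"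
    using diagram_delete_nontrivial[OF *(1) _ sp] p ne *(3) by simp
  then show ?thesis
    using * p delete_fixed[of \<sigma> p] sp by (intro boundsI[of "D - {p}" "delete \<sigma> p" "delete \<pi> p" c g s V]) auto
qed

text \<open>The new letter is fixed by \<open>\<pi>\<close> and labelled one, hence a trivial cycle
  that pays for the larger \<open>D\<close>. In the quotient it first joins as a fixed point, and
  the transposition then loses at most one cycle.\<close>

lemma diagram_insert_one:
  assumes d: "diagram D \<sigma> \<pi> c g s" and p: "p \<notin> D" and z: "z \<in> D"
  shows "diagram (insert p D) (transpose p z \<circ> \<sigma>) \<pi> (c(p := i)) (g(p := \<one>)) s"
proof -
  have d': "finite D" "\<sigma> permutes D" "\<pi> permutes D" "\<forall>x\<in>D. c (\<pi> x) = c x" "g ` D \<subseteq> carrier G"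
    "int (card D) \<le> s + int (card (trivial_cycles g \<pi> D)) + int (card (cycle_sets (perm_inv \<pi> \<circ> \<sigma>) D))"
    using d by (simp_all add: diagram_def)
  let ?D = "insert p D" and ?\<kappa> = "perm_inv \<pi> \<circ> \<sigma>" and ?g = "g(p := \<one>)"
  have perm: "\<sigma> permutes ?D" "\<pi> permutes ?D"
    using d'(2,3) by (auto intro: permutes_subset)
  have ip: "perm_inv \<pi> permutes D" "perm_inv \<pi> permutes ?D"
    using permutes_inv d'(3) perm(2) by blast+
  have kp: "?\<kappa> permutes ?D" using permutes_compose[OF perm(1) ip(2)] .
  have fixed: "\<pi> p = p" "\<sigma> p = p" "perm_inv \<pi> p = p"
    using d'(2,3) ip(1) p by (simp_all add: permutes_not_in)
  let ?u = "perm_inv \<pi> z"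
  have u: "?u \<in> ?D" using permutes_in_image[OF ip(2), of z] z by simp
  have "perm_inv \<pi> \<circ> transpose p z = transpose p ?u \<circ> perm_inv \<pi>"
    using comp_transpose[OF permutes_bij[OF ip(1)], of p z] fixed(3) by simp
  then have k: "perm_inv \<pi> \<circ> (transpose p z \<circ> \<sigma>) = transpose p ?u \<circ> ?\<kappa>"
    by (metis comp_assoc)
  have "card (cycle_sets ?\<kappa> ?D) = card (cycle_sets ?\<kappa> D) + 1"
    using card_cycle_sets_remove_fixed[of ?D p ?\<kappa>] fixed d'(1) p by simp
  then have K: "card (cycle_sets ?\<kappa> D) \<le> card (cycle_sets (transpose p ?u \<circ> ?\<kappa>) ?D)"
    using card_cycle_sets_transpose[OF _ kp _ u, of p] d'(1) by simp
  have "S \<in> trivial_cycles ?g \<pi> ?D" if S: "S \<in> trivial_cycles g \<pi> D" for S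
  proof -
    obtain ws where ws: "S = set ws" "is_cycle \<pi> ws" "set ws \<subseteq> D" "list_product G (map g ws) = \<one>"
      using S by (auto simp: trivial_cycles_def)
    have "map ?g ws = map g ws" using ws(3) p by auto
    then have "list_product G (map ?g ws) = \<one>" using ws(4) by metis
    then show ?thesis using ws(1-3) unfolding trivial_cycles_def by blast
  qed
  moreover have "set [p] \<in> trivial_cycles ?g \<pi> ?D"
    unfolding trivial_cycles_def using fixed(1) by (intro CollectI exI[of _ "[p]"]) (simp add: is_cycle_single)
  ultimately have "insert {p} (trivial_cycles g \<pi> D) \<subseteq> trivial_cycles ?g \<pi> ?D" by auto
  then have "card (insert {p} (trivial_cycles g \<pi> D)) \<le> card (trivial_cycles ?g \<pi> ?D)"
    using d'(1) by (intro card_mono finite_trivial_cycles) auto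
  moreover have "{p} \<notin> trivial_cycles g \<pi> D" using p by (auto simp: trivial_cycles_def)
  ultimately have T: "card (trivial_cycles g \<pi> D) + 1 \<le> card (trivial_cycles ?g \<pi> ?D)"
    using finite_trivial_cycles[OF d'(1)] by simp
  have "(c(p := i)) (\<pi> x) = (c(p := i)) x" if "x \<in> ?D" for x
    using that fixed(1) d'(4) p permutes_in_image[OF d'(3), of x] by auto
  moreover have "transpose p z \<circ> \<sigma> permutes ?D"
    using permutes_transpose_comp[OF perm(1)] z by simp
  ultimately show ?thesis
    using K T d' perm(2) p unfolding diagram_def k by auto
qed

text \<open>The new letter \<open>q\<close> follows \<open>p\<close> both along the boundary and
  around the piece over the factor, so all label products persist. An additional cycle of the
  quotient, with \<open>p\<close> as its only letter, pays for \<open>q\<close>.\<close>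

lemma diagram_divide:
  assumes d: "diagram D \<sigma> \<pi> c g s" and q: "q \<notin> D" and p: "p \<in> D"
    and ab: "a \<in> carrier G" "b \<in> carrier G" "g p = a \<otimes> b"
  shows "diagram (insert q D) (transpose q (\<sigma> p) \<circ> \<sigma>) (transpose q (\<pi> p) \<circ> \<pi>)
    (c(q := c p)) (g(p := a, q := b)) s"
proof -
  have d': "finite D" "\<sigma> permutes D" "\<pi> permutes D" "\<forall>x\<in>D. c (\<pi> x) = c x" "g ` D \<subseteq> carrier G"
    "int (card D) \<le> s + int (card (trivial_cycles g \<pi> D)) + int (card (cycle_sets (perm_inv \<pi> \<circ> \<sigma>) D))"
    using d by (simp_all add: diagram_def)
  let ?D = "insert q D" and ?\<kappa> = "perm_inv \<pi> \<circ> \<sigma>" and ?g = "g(p := a, q := b)"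
  let ?p = "transpose q (\<pi> p) \<circ> \<pi>"
  have perm: "\<sigma> permutes ?D" "\<pi> permutes ?D"
    using d'(2,3) by (auto intro: permutes_subset)
  have ip: "perm_inv \<pi> permutes D" "perm_inv \<pi> permutes ?D"
    using permutes_inv d'(3) perm(2) by blast+
  have kp: "?\<kappa> permutes ?D" using permutes_compose[OF perm(1) ip(2)] .
  have fixed: "\<pi> q = q" "\<sigma> q = q" "perm_inv \<pi> q = q"
    using d'(2,3) ip(1) q by (simp_all add: permutes_not_in)
  have pD: "\<pi> p \<in> D" "\<sigma> p \<in> D" "p \<noteq> q"
    using p q d'(2,3) by (auto simp: permutes_in_image)
  \<comment> \<open>This inserts \<open>q\<close> into \<open>?\<kappa>\<close> right after
    \<open>p\<close>; the transposition of \<open>p\<close> and \<open>q\<close> then splits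
    \<open>p\<close> off as a cycle of its own.\<close>
  let ?k1 = "transpose q (?\<kappa> p) \<circ> ?\<kappa>"
  have bij: "bij (perm_inv \<pi>)" "bij \<pi>" using permutes_bij ip(1) d'(3) by blast+
  have inv_pi: "perm_inv \<pi> (\<pi> p) = p" using d'(3) by (simp add: permutes_inverses)
  have "perm_inv ?p = perm_inv \<pi> \<circ> transpose q (\<pi> p)"
    using bij(2) by (simp add: o_inv_distrib)
  also have "\<dots> = transpose p q \<circ> perm_inv \<pi>"
    using comp_transpose[OF bij(1), of q "\<pi> p"] fixed(3) inv_pi by (simp add: transpose_commute)
  finally have "perm_inv ?p \<circ> (transpose q (\<sigma> p) \<circ> \<sigma>) =
      transpose p q \<circ> (perm_inv \<pi> \<circ> transpose q (\<sigma> p)) \<circ> \<sigma>"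
    by (simp only: comp_assoc)
  also have "perm_inv \<pi> \<circ> transpose q (\<sigma> p) = transpose q (?\<kappa> p) \<circ> perm_inv \<pi>"
    using comp_transpose[OF bij(1), of q "\<sigma> p"] fixed(3) by simp
  finally have k: "perm_inv ?p \<circ> (transpose q (\<sigma> p) \<circ> \<sigma>) = transpose p q \<circ> ?k1"
    by (simp only: comp_assoc)
  have kD: "?\<kappa> p \<in> ?D" using kp p by (simp only: permutes_in_image) simp
  have fin: "finite ?D" using d'(1) by simp
  have "card (cycle_sets ?\<kappa> ?D) = card (cycle_sets ?\<kappa> D) + 1"
    using card_cycle_sets_remove_fixed[of ?D q ?\<kappa>] fixed d'(1) q by simp
  moreover have "card (cycle_sets ?\<kappa> ?D) \<le> card (cycle_sets ?k1 ?D) + 1"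
    using card_cycle_sets_transpose[OF fin kp _ kD, of q] by simp
  moreover have "card (cycle_sets ?k1 ?D) + 1 \<le> card (cycle_sets (transpose p q \<circ> ?k1) ?D)"
  proof -
    have k1: "?k1 permutes ?D" using permutes_transpose_comp[OF kp _ kD, of q] by simp
    obtain ws where ws: "is_cycle ?k1 (p # ws)" "set (p # ws) \<subseteq> ?D"
      using ex_is_cycle[OF k1 fin, of p] p by auto
    have "?k1 p = q" by simp
    then obtain A where "ws = q # A" using is_cycle_ConsD[OF ws(1)] pD(3) by metis
    then show ?thesis using card_cycle_sets_same[OF fin, of ?k1 p "[]" q A] ws by simp
  qed
  ultimately have K: "card (cycle_sets ?\<kappa> D) + 1 \<le> card (cycle_sets (transpose p q \<circ> ?k1) ?D)"
    by linarith
  let ?h = "\<lambda>S. if p \<in> S then insert q S else S"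
  have TD: "S \<subseteq> D" if "S \<in> trivial_cycles g \<pi> D" for S
    using that by (auto simp: trivial_cycles_def)
  have "inj_on ?h (trivial_cycles g \<pi> D)"
  proof
    fix S S' assume *: "S \<in> trivial_cycles g \<pi> D" "S' \<in> trivial_cycles g \<pi> D" "?h S = ?h S'"
    then have "?h S - {q} = ?h S' - {q}" by simp
    moreover have "?h S - {q} = S" "?h S' - {q} = S'"
      using TD[OF *(1)] TD[OF *(2)] q by auto
    ultimately show "S = S'" by metis
  qed
  moreover have "?h ` trivial_cycles g \<pi> D \<subseteq> trivial_cycles ?g ?p ?D"
  proof
    fix U assume "U \<in> ?h ` trivial_cycles g \<pi> D"
    then obtain S where S: "S \<in> trivial_cycles g \<pi> D" "U = ?h S" by blast
    show "U \<in> trivial_cycles ?g ?p ?D"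
    proof (cases "p \<in> S")
      case True
      then obtain ws where ws: "S = set (p # ws)" "is_cycle \<pi> (p # ws)" "set (p # ws) \<subseteq> D"
        "list_product G (map g (p # ws)) = \<one>"
        using trivial_cyclesE[of S g \<pi> D p] S(1) d'(5) by metis
      have nin: "q \<notin> set (p # ws)" using ws(3) q by auto
      have "is_cycle ?p (p # q # ws)"
        using is_cycle_insert[of \<pi> p ws q, OF ws(2) fixed(1) nin] .
      moreover have "list_product G (map ?g (p # q # ws)) = \<one>"
      proof -
        have "p \<notin> set ws" using ws(2) by (simp add: is_cycle_def)
        then have m: "map ?g ws = map g ws" using nin by auto
        have "set (map g ws) \<subseteq> carrier G" using ws(3) d'(5) by auto
        then have "list_product G (map g ws) \<in> carrier G" by (rule list_product_closed)
        then have "list_product G (map g (p # ws)) = a \<otimes> (b \<otimes> list_product G (map g ws))"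
          using ab by (simp add: m_assoc)
        moreover have "list_product G (map ?g (p # q # ws)) = a \<otimes> (b \<otimes> list_product G (map ?g ws))"
          using pD(3) by simp
        ultimately show ?thesis using ws(4) m by metis
      qed
      moreover have "U = set (p # q # ws)" using S(2) True ws(1) by auto
      moreover have "set (p # q # ws) \<subseteq> ?D" using ws(3) by auto
      ultimately show ?thesis unfolding trivial_cycles_def by blast
    next
      case False
      have "\<pi> p \<notin> S"
        using trivial_cycles_image_mem[OF S(1)] bij(2) False by blast
      then show ?thesis
        using False S(2) TD[OF S(1)] q by (auto intro!: trivial_cycles_other[OF S(1)])
    qed
  qed
  ultimately have T: "card (trivial_cycles g \<pi> D) \<le> card (trivial_cycles ?g ?p ?D)"
    by (intro card_inj_on_le[of ?h] finite_trivial_cycles[OF fin])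
  have "(c(q := c p)) (?p x) = (c(q := c p)) x" if "x \<in> ?D" for x
  proof (cases "x = q")
    case True
    have "\<pi> p \<noteq> q" using pD(1) q by blast
    then show ?thesis using True fixed(1) d'(4) p by simp
  next
    case False
    then have x: "x \<in> D" "\<pi> x \<in> D" using that permutes_in_image[OF d'(3)] by auto
    show ?thesis
    proof (cases "\<pi> x = \<pi> p")
      case True
      then have "x = p" using permutes_inj[OF d'(3)] by (simp add: inj_eq)
      then show ?thesis using pD by simp
    next
      case ne: False
      then show ?thesis using x False d'(4) q by (auto simp: transpose_def)
    qed
  qed
  moreover have "transpose q (\<sigma> p) \<circ> \<sigma> permutes ?D" "?p permutes ?D"
    using permutes_transpose_comp[OF perm(1), of q "\<sigma> p"] permutes_transpose_comp[OF perm(2), of q "\<pi> p"] pD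
    by simp_all
  ultimately show ?thesis
    using K T d' q ab unfolding diagram_def k by auto
qed

lemma bounds_insert_one:
  assumes "bounds [W] s"
  shows "bounds [(i, \<one>) # W] s"
proof -
  obtain D \<sigma> \<pi> c g ws where *: "diagram D \<sigma> \<pi> c g s" "D = set ws" "is_cycle \<sigma> ws"
    "W = map (\<lambda>x. (c x, g x)) ws"
    using assms by (rule boundsE) auto
  obtain z zs where z: "ws = z # zs" using *(3) by (cases ws) (auto simp: is_cycle_def)
  obtain p where p: "p \<notin> D" using *(2) by (metis List.finite_set ex_new_if_finite infinite_UNIV_nat)
  have "\<sigma> p = p" using *(1) p permutes_not_in[of \<sigma> D p] by (simp add: diagram_def)
  then have "is_cycle (transpose p z \<circ> \<sigma>) (p # [] @ z # zs)"
    using *(2,3) p z by (intro is_cycle_transpose_merge) (auto simp: is_cycle_single)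
  then have c: "is_cycle (transpose p z \<circ> \<sigma>) (p # ws)" using z by simp
  have "z \<in> D" using *(2) z by simp
  note d = diagram_insert_one[OF *(1) p this, of i]
  show ?thesis
    using c *(2,4) p by (intro boundsI[OF d, of "[p # ws]"]) (auto simp: is_cycle_def)
qed

lemma bounds_divide:
  assumes b: "bounds [(i, x \<otimes> y) # W] s" and xy: "x \<in> carrier G" "y \<in> carrier G"
  shows "bounds [(i, x) # (i, y) # W] s"
proof -
  obtain D \<sigma> \<pi> c g ws where *: "diagram D \<sigma> \<pi> c g s" "D = set ws" "is_cycle \<sigma> ws"
    "(i, x \<otimes> y) # W = map (\<lambda>x. (c x, g x)) ws"
    using b by (rule boundsE) auto
  obtain p zs where z: "ws = p # zs" "c p = i" "g p = x \<otimes> y" "W = map (\<lambda>x. (c x, g x)) zs"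
    using *(4) by auto
  obtain q where q: "q \<notin> D" using *(2) by (metis List.finite_set ex_new_if_finite infinite_UNIV_nat)
  have "\<sigma> q = q" using *(1) q permutes_not_in[of \<sigma> D q] by (simp add: diagram_def)
  then have c: "is_cycle (transpose q (\<sigma> p) \<circ> \<sigma>) (p # q # zs)"
    using is_cycle_insert[of \<sigma> p zs q] *(2,3) z(1) q by simp
  have "p \<in> D" using *(2) z by simp
  note d = diagram_divide[OF *(1) q this xy z(3)]
  show ?thesis
    using c *(2,3) z q by (intro boundsI[OF d, of "[p # q # zs]"]) (auto simp: is_cycle_def)
qed

text \<open>The disc with one trivial letter on its boundary: one letter, one trivial cycle and one
  cycle of the quotient, so \<open>1 \<le> -1 + 1 + 1\<close>.\<close>

lemma bounds_one: "bounds [[(i, \<one>)]] (-1)"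
proof -
  have "is_cycle id [0::nat]" by (simp add: is_cycle_def)
  then have "set [0::nat] \<in> cycle_sets (perm_inv id \<circ> id) {0}"
    "set [0::nat] \<in> trivial_cycles (\<lambda>_. \<one>) id {0}"
    unfolding trivial_cycles_def cycle_sets_def
    by (auto intro!: exI[of _ "[0]"])
  then have "card {{0::nat}} \<le> card (cycle_sets (perm_inv id \<circ> id) {0::nat})"
    "card {{0::nat}} \<le> card (trivial_cycles (\<lambda>_. \<one>) id {0::nat})"
    by (intro card_mono finite_cycle_sets finite_trivial_cycles; simp)+
  then have "diagram {0} id id (\<lambda>_. i) (\<lambda>_. \<one>) (-1)"
    unfolding diagram_def by (auto simp: permutes_id)
  then show ?thesis
    using \<open>is_cycle id [0]\<close> by (intro boundsI[of _ id id "\<lambda>_. i" "\<lambda>_. \<one>" _ "[[0]]"]) auto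
qed

end

section \<open>Powers of a cyclically reduced word\<close>

lemma nth_concat_replicate:
  "k < n * length K \<Longrightarrow> concat (replicate n K) ! k = K ! (k mod length K)"
proof (induction n arbitrary: k)
  case (Suc n)
  then show ?case
    by (cases "k < length K") (auto simp: nth_append le_mod_geq)
qed simp

lemma length_filter_concat_replicate_upt:
  assumes "L > 0"
  shows "length (filter (\<lambda>i. i = L - 1) (concat (replicate n [0..<L]))) = n"
proof (induction n)
  case (Suc n)
  obtain m where "L = Suc m" using assms by (cases L) auto
  then have "filter (\<lambda>i. i = L - 1) [0..<L] = [L - 1]"
    by (auto simp: filter_empty_conv)
  then show ?case using Suc by simp
qed simp

text \<open>Choosing a point of \<open>A\<close> in each member of \<open>F\<close> is injective.
  This turns the existence of an ascent in every disc into an inequality between numbers.\<close>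

lemma card_le_of_disjoint:
  assumes "finite A" and "\<And>S. S \<in> F \<Longrightarrow> S \<inter> A \<noteq> {}"
    and "\<And>S S' x. S \<in> F \<Longrightarrow> S' \<in> F \<Longrightarrow> x \<in> S \<Longrightarrow> x \<in> S' \<Longrightarrow> S = S'"
  shows "card F \<le> card A"
proof -
  define f where "f S = (SOME x. x \<in> S \<inter> A)" for S
  have f: "f S \<in> S \<inter> A" if "S \<in> F" for S
    unfolding f_def using assms(2)[OF that] by (rule some_in_eq[THEN iffD2])
  have "inj_on f F"
    using f assms(3) by (intro inj_onI) (metis IntD1)
  then show ?thesis using f assms(1) by (intro card_inj_on_le[of f]) auto
qed

text \<open>A rank that never rises along a cycle cannot fall either: \<open>f\<close> permutes the
  cycle, so the ranks of the letters and of their images have the same sum.\<close>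

lemma is_cycle_no_ascent:
  fixes r :: "'c \<Rightarrow> nat"
  assumes c: "is_cycle f ws" and le: "\<And>x. x \<in> set ws \<Longrightarrow> r (f x) \<le> r x" and x: "x \<in> set ws"
  shows "r (f x) = r x"
proof (rule ccontr)
  assume "r (f x) \<noteq> r x"
  then have "r (f x) < r x" using le[OF x] by simp
  then have "(\<Sum>x\<in>set ws. r (f x)) < sum r (set ws)"
    using le x by (intro sum_strict_mono_ex1) auto
  moreover have "inj_on f (set ws)"
    using is_cycleD[OF c] by (intro eq_card_imp_inj_on) auto
  then have "(\<Sum>x\<in>set ws. r (f x)) = sum r (set ws)"
    using is_cycleD[OF c] sum.reindex[of f "set ws" r] by simp
  ultimately show False by simp
qed

lemma is_cycle_const:
  assumes c: "is_cycle f ws" and eq: "\<And>x. x \<in> set ws \<Longrightarrow> r (f x) = r x" and x: "x \<in> set ws"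
  shows "r x = r (hd ws)"
proof -
  have hd: "hd ws \<in> set ws" using c by (simp add: is_cycle_def)
  have "(f ^^ k) (hd ws) \<in> set ws \<and> r ((f ^^ k) (hd ws)) = r (hd ws)" for k
  proof (induction k)
    case (Suc k)
    then show ?case using eq is_cycleD[OF c] by auto
  qed (use hd in simp)
  then show ?thesis using is_cycle_nth[OF c] x by (metis in_set_conv_nth)
qed

section \<open>Moves along whole words: conjugators, commutators and products\<close>

context group
begin

lemma inv_cancel_left [simp]:
  "x \<in> carrier G \<Longrightarrow> y \<in> carrier G \<Longrightarrow> inv x \<otimes> (x \<otimes> y) = y"
  "x \<in> carrier G \<Longrightarrow> y \<in> carrier G \<Longrightarrow> x \<otimes> (inv x \<otimes> y) = y"
  by (simp_all flip: m_assoc)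

definition word_inv :: "('i \<times> 'a) list \<Rightarrow> ('i \<times> 'a) list" where
  "word_inv W = rev (map letter_inv W)"

definition word_prod :: "('i \<times> 'a) list \<Rightarrow> 'a" where
  "word_prod W = list_product G (map snd W)"

abbreviation is_word :: "('i \<times> 'a) list \<Rightarrow> bool" where
  "is_word W \<equiv> snd ` set W \<subseteq> carrier G"

lemma word_inv_simps [simp]:
  "word_inv [] = []" "word_inv (x # W) = word_inv W @ [letter_inv x]"
  "word_inv (W @ W') = word_inv W' @ word_inv W" "word_inv W = [] \<longleftrightarrow> W = []"
  by (simp_all add: word_inv_def)

lemma letter_inv_inv: "snd x \<in> carrier G \<Longrightarrow> letter_inv (letter_inv x) = x"
  by (simp add: letter_inv_def prod_eq_iff)

lemma word_inv_inv: "is_word W \<Longrightarrow> word_inv (word_inv W) = W"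
  by (induction W) (auto simp: letter_inv_inv)

lemma is_word_inv: "is_word W \<Longrightarrow> is_word (word_inv W)"
  by (auto simp: word_inv_def letter_inv_def)

lemma word_prod_closed: "is_word W \<Longrightarrow> word_prod W \<in> carrier G"
  by (auto simp: word_prod_def intro!: list_product_closed)

lemma word_prod_append:
  "is_word W \<Longrightarrow> is_word W' \<Longrightarrow> word_prod (W @ W') = word_prod W \<otimes> word_prod W'"
  by (simp add: word_prod_def list_product_append)

lemma word_prod_Nil [simp]: "word_prod [] = \<one>"
  and word_prod_Cons [simp]: "word_prod (x # W) = snd x \<otimes> word_prod W"
  by (simp_all add: word_prod_def)

lemma word_prod_inv: "is_word W \<Longrightarrow> word_prod (word_inv W) = inv (word_prod W)"
proof (induction W)
  case (Cons x W)
  then show ?case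
    by (simp add: word_prod_append is_word_inv letter_inv_def inv_mult_group word_prod_closed)
qed simp

text \<open>The pairs of inverse letters in \<open>word_inv X @ X\<close> fold up from the inside
  outwards, each for free, while \<open>R\<close> keeps the word nonempty.\<close>

lemma bounds_cancel_inv_word:
  assumes "bounds ((word_inv X @ X @ R) # U) s" "R \<noteq> []" "is_word X"
  shows "bounds (R # U) s"
  using assms(1,3)
proof (induction X)
  case (Cons z X)
  have z: "letter_inv (letter_inv z) = z" using Cons.prems(2) by (simp add: letter_inv_inv)
  have "bounds (((word_inv X @ [letter_inv z]) @ (z # X @ R)) # U) s"
    using Cons.prems(1) by simp
  \<comment> \<open>The rotation moves the innermost pair to the two ends, the shape that
    \<open>bounds_cancel\<close> expects, with \<open>letter_inv z\<close> in the role of its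
    \<open>x\<close>.\<close>
  from bounds_rotate[OF this]
  have "bounds ((letter_inv (letter_inv z) # (X @ R @ word_inv X) @ [letter_inv z]) # U) s"
    using z by simp
  from bounds_cancel[OF this] have "bounds (((X @ R) @ word_inv X) # U) s"
    using assms(2) by simp
  from bounds_rotate[OF this] show ?case
    using Cons by simp
qed simp

lemma bounds_cancel_word:
  assumes "bounds ((X @ word_inv X @ R) # U) s" "R \<noteq> []" "is_word X"
  shows "bounds (R # U) s"
  using bounds_cancel_inv_word[of "word_inv X" R U s] assms by (simp add: word_inv_inv is_word_inv)

lemma bounds_cancel_conj:
  assumes "bounds ((word_inv P @ B @ P) # U) s" "B \<noteq> []" "is_word P"
  shows "bounds (B # U) s"
proof -
  have "bounds (((word_inv P @ B) @ P) # U) s" using assms(1) by simp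
  from bounds_rotate[OF this] show ?thesis
    using bounds_cancel_word assms(2,3) by simp
qed

text \<open>Only the last letter of \<open>P\<close> is used for splitting; the rest of
  \<open>P\<close> then conjugates \<open>B\<close> on a curve of its own and folds up for free.
  Hence the cost is one, whatever the length of \<open>P\<close>.\<close>

lemma bounds_split_conj:
  assumes b: "bounds ((word_inv P @ B @ P @ R) # U) s" and ne: "B \<noteq> []" "P \<noteq> []" "R \<noteq> []"
    and P: "is_word P"
  shows "bounds (B # R # U) (s + 1)"
proof -
  obtain P0 z where Pz: "P = P0 @ [z]" using ne(2) by (metis rev_exhaust)
  have z: "letter_inv (letter_inv z) = z" using P Pz by (simp add: letter_inv_inv)
  have "bounds ((letter_inv z # (word_inv P0 @ B @ P0) @ letter_inv (letter_inv z) # R) # U) s"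
    using b Pz z by simp
  from bounds_split[OF this] have "bounds (R # (word_inv P0 @ B @ P0) # U) (s + 1)"
    using ne by simp
  from bounds_cancel_conj[OF bounds_swap[OF this] ne(1)] show ?thesis
    using P Pz by simp
qed

text \<open>A handle costs two: gluing along \<open>X\<close> splits off the curve
  \<open>word_inv Y\<close>, and gluing along the first letter of \<open>Y\<close> merges it back.
  The rest of \<open>Y\<close> folds up.\<close>

lemma bounds_commutator:
  assumes b: "bounds ((word_inv X @ word_inv Y @ X @ Y @ R) # U) s"
    and ne: "X \<noteq> []" "Y \<noteq> []" "R \<noteq> []" and XY: "is_word X" "is_word Y"
  shows "bounds (R # U) (s + 2)"
proof -
  have "bounds (word_inv Y # (Y @ R) # U) (s + 1)"
    using bounds_split_conj[OF b] ne XY by simp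
  moreover obtain y Y1 where Y: "Y = y # Y1" using ne(2) by (cases Y) auto
  ultimately have "bounds ((word_inv Y1 @ [letter_inv y]) # (Y @ R) # U) (s + 1)" by simp
  from bounds_swap[OF bounds_rotate[OF this]]
  have "bounds ((y # Y1 @ R) # (letter_inv y # word_inv Y1) # U) (s + 1)"
    using Y by simp
  from bounds_merge[OF this] have "bounds (((Y1 @ R) @ word_inv Y1) # U) (s + 2)"
    using ne(3) by (simp add: add.assoc)
  from bounds_rotate[OF this] show ?thesis
    using bounds_cancel_inv_word[of Y1 R U "s + 2"] ne(3) XY(2) Y by simp
qed

lemma bounds_commutators:
  assumes "bounds ((concat (map (\<lambda>(X, Y). word_inv X @ word_inv Y @ X @ Y) Cs) @ R) # U) s"
    "R \<noteq> []" "\<forall>(X, Y) \<in> set Cs. X \<noteq> [] \<and> Y \<noteq> [] \<and> is_word X \<and> is_word Y"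
  shows "bounds (R # U) (s + 2 * int (length Cs))"
  using assms(1,3)
proof (induction Cs arbitrary: s)
  case (Cons C Cs)
  obtain X Y where C: "C = (X, Y)" by force
  let ?R = "concat (map (\<lambda>(X, Y). word_inv X @ word_inv Y @ X @ Y) Cs) @ R"
  have "bounds (?R # U) (s + 2)"
    using Cons.prems assms(2) C by (intro bounds_commutator[of X Y]) auto
  from Cons.IH[OF this] show ?case using Cons.prems(2) by (simp add: algebra_simps)
qed simp

text \<open>Splitting off the letter of each conjugate costs one; the resulting one-letter curve has
  a nontrivial label and is dropped at no further cost.\<close>

lemma bounds_elliptics:
  assumes "bounds ((concat (map (\<lambda>(P, e). word_inv P @ [e] @ P) Ds) @ R) # U) s"
    "R \<noteq> []" "\<forall>(P, e) \<in> set Ds. P \<noteq> [] \<and> is_word P \<and> snd e \<noteq> \<one>"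
  shows "bounds (R # U) (s + int (length Ds))"
  using assms(1,3)
proof (induction Ds arbitrary: s)
  case (Cons C Ds)
  obtain P e where C: "C = (P, e)" by (cases C)
  let ?R = "concat (map (\<lambda>(P, e). word_inv P @ [e] @ P) Ds) @ R"
  have "bounds ([e] # ?R # U) (s + 1)"
    using Cons.prems assms(2) C by (intro bounds_split_conj[of P]) auto
  then have "bounds (?R # U) (s + 1)"
    using bounds_drop[of e "?R # U" "s + 1"] Cons.prems(2) C by simp
  from Cons.IH[OF this] show ?case using Cons.prems(2) by (simp add: algebra_simps)
qed simp

text \<open>The last conjugate is already alone on its curve and only has its conjugator folded up,
  so one splitting fewer than the number of words suffices. The order is reversed because each
  separated word is put behind the one still to be processed.\<close>

lemma bounds_conjugates:
  assumes "bounds ((concat (map (\<lambda>(P, B). word_inv P @ B @ P) Hs)) # U) s" "Hs \<noteq> []"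
    "\<forall>(P, B) \<in> set Hs. P \<noteq> [] \<and> is_word P \<and> B \<noteq> []"
  shows "bounds (rev (map snd Hs) @ U) (s + int (length Hs) - 1)"
  using assms(2,1,3)
proof (induction Hs arbitrary: U s rule: list_nonempty_induct)
  case (single H)
  then show ?case using bounds_cancel_conj[of "fst H" "snd H" U s] by (auto simp: case_prod_beta)
next
  case (cons H Hs)
  obtain P B where H: "H = (P, B)" by force
  let ?R = "concat (map (\<lambda>(P, B). word_inv P @ B @ P) Hs)"
  have "?R \<noteq> []"
    using cons.hyps cons.prems(2) by (cases Hs) auto
  then have "bounds (B # ?R # U) (s + 1)"
    using cons.prems H by (intro bounds_split_conj[of P]) auto
  from cons.IH[OF bounds_swap[OF this]] show ?case using cons.prems(2) H by (simp add: algebra_simps)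
qed

section \<open>Counting ascents of ranks\<close>

lemma list_product_replicate: "x \<in> carrier G \<Longrightarrow> list_product G (replicate n x) = x [^] n"
proof (induction n)
  case (Suc n)
  then show ?case using nat_pow_Suc2[of x n] by simp
qed simp

text \<open>The rank of a letter is its position modulo the length of \<open>K\<close>. Every disc
  contains an ascent, every letter accounts for at most one ascent, and the
  \<open>sum_list ns\<close> letters of top rank account for none; the inequality in
  \<open>diagram\<close> then gives the bound.\<close>

lemma bounds_powers:
  fixes K :: "('i \<times> 'a) list"
  assumes b: "bounds (map (\<lambda>n. concat (replicate n K)) ns) s" and K: "K \<noteq> []"
    and adj: "\<And>k. k < length K \<Longrightarrow> fst (K ! k) \<noteq> fst (K ! (Suc k mod length K))"
    and tf: "\<And>x n. x \<in> set K \<Longrightarrow> n > 0 \<Longrightarrow> snd x [^] (n::nat) \<noteq> \<one>"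
  shows "int (sum_list ns) \<le> s"
proof -
  define L where "L = length K"
  have L: "L > 0" using K by (simp add: L_def)
  obtain D \<sigma> \<pi> and c :: "nat \<Rightarrow> 'i" and g V where d: "diagram D \<sigma> \<pi> c g s"
    and V: "distinct (concat V)" "set (concat V) = D" "\<forall>ws \<in> set V. is_cycle \<sigma> ws"
      "map (\<lambda>n. concat (replicate n K)) ns = map (map (\<lambda>x. (c x, g x))) V"
    using b unfolding bounds_def by (elim exE conjE) (rule that)
  have d': "finite D" "\<sigma> permutes D" "\<pi> permutes D" "\<forall>x\<in>D. c (\<pi> x) = c x" "g ` D \<subseteq> carrier G"
    "int (card D) \<le> s + int (card (trivial_cycles g \<pi> D)) + int (card (cycle_sets (perm_inv \<pi> \<circ> \<sigma>) D))"
    using d by (simp_all add: diagram_def)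
  let ?l = "\<lambda>x. (c x, g x)"
  have lenV: "length V = length ns" using V(4) by (metis length_map)
  have V_nth: "map ?l (V ! j) = concat (replicate (ns ! j) K)" if "j < length V" for j
    using arg_cong[OF V(4), of "\<lambda>x. x ! j"] that lenV by simp
  have len: "length (V ! j) = ns ! j * L" if "j < length V" for j
    using arg_cong[OF V_nth[OF that], of length] by (simp add: L_def length_concat sum_list_replicate)
  \<comment> \<open>The position chosen by \<open>SOME\<close> is unique, because the boundary
    cycles are distinct lists and mutually disjoint. As their lengths are multiples of
    \<open>L\<close>, the rank also advances cyclically from the end of a word to its
    beginning.\<close>
  define r where "r x = (SOME k. \<exists>ws\<in>set V. k < length ws \<and> ws ! k = x) mod L" for x
  have r: "r (ws ! k) = k mod L" if "ws \<in> set V" "k < length ws" for ws k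
  proof -
    define k' where "k' = (SOME k'. \<exists>ws'\<in>set V. k' < length ws' \<and> ws' ! k' = ws ! k)"
    have "\<exists>k'. \<exists>ws'\<in>set V. k' < length ws' \<and> ws' ! k' = ws ! k" using that by blast
    from someI_ex[OF this] obtain ws' where ws': "ws' \<in> set V" "k' < length ws'" "ws' ! k' = ws ! k"
      unfolding k'_def[symmetric] by blast
    have "ws' = ws"
    proof (rule ccontr)
      assume "ws' \<noteq> ws"
      then have "set ws' \<inter> set ws = {}"
        using V(1) ws'(1) that(1) by (simp add: distinct_concat_iff)
      then show False using ws'(2,3) that(2) by (metis disjoint_iff nth_mem)
    qed
    moreover have "distinct ws" using V(3) that(1) by (simp add: is_cycle_def)
    ultimately show ?thesis
      using ws'(2,3) that(2) unfolding r_def k'_def[symmetric] by (simp add: nth_eq_iff_index_eq)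
  qed
  have r_lt: "r x < L" for x using L by (simp add: r_def)
  have pos: "\<exists>j<length V. \<exists>k<length (V ! j). x = V ! j ! k" if "x \<in> D" for x
    using that V(2) by (auto simp: in_set_conv_nth) (metis in_set_conv_nth)
  have r_\<sigma>: "r (\<sigma> x) = Suc (r x) mod L" and lab: "?l x = K ! r x" if "x \<in> D" for x
  proof -
    obtain j k where jk: "j < length V" "k < length (V ! j)" "x = V ! j ! k" using pos \<open>x \<in> D\<close> by blast
    then have ws: "V ! j \<in> set V" by simp
    have "\<sigma> x = map \<sigma> (V ! j) ! k" using jk by simp
    also have "map \<sigma> (V ! j) = rotate1 (V ! j)" using V(3) ws by (simp add: is_cycle_def)
    also have "rotate1 (V ! j) ! k = V ! j ! (Suc k mod length (V ! j))"
      using jk(2) by (rule nth_rotate1)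
    finally have "r (\<sigma> x) = Suc k mod length (V ! j) mod L"
      using r[OF ws, of "Suc k mod length (V ! j)"] jk(2) by (metis mod_less_divisor gr_implies_not0 not_gr0)
    also have "\<dots> = Suc k mod L" using len[OF jk(1)] by (simp add: mod_mod_cancel)
    finally show "r (\<sigma> x) = Suc (r x) mod L" using r[OF ws jk(2)] jk(3) by (simp add: mod_Suc_eq)
    have "?l x = map ?l (V ! j) ! k" using jk by simp
    also have "\<dots> = K ! (k mod L)"
      using V_nth[OF jk(1)] nth_concat_replicate[of k "ns ! j" K] len[OF jk(1)] jk(2) by (simp add: L_def)
    finally show "?l x = K ! r x" using r[OF ws jk(2)] jk(3) by simp
  qed
  have c_r: "c x = fst (K ! r x)" and g_r: "g x = snd (K ! r x)" if "x \<in> D" for x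
    using lab[OF that] by (metis fst_conv, metis snd_conv)
  define W where "W = {x \<in> D. r x = L - 1}"
  have card_W: "card W = sum_list ns"
  proof -
    let ?P = "\<lambda>x. r x = L - 1"
    have "length (filter ?P (V ! j)) = ns ! j" if j: "j < length V" for j
    proof -
      have "map r (V ! j) = concat (replicate (ns ! j) [0..<L])"
        using len[OF j] r j
        by (intro nth_equalityI)
          (auto simp: length_concat sum_list_replicate nth_concat_replicate L)
      then have "length (filter (\<lambda>i. i = L - 1) (map r (V ! j))) = ns ! j"
        using length_filter_concat_replicate_upt[OF L] by simp
      then show ?thesis by (simp add: filter_map comp_def)
    qed
    then have "map (\<lambda>ws. length (filter ?P ws)) V = ns"
      using lenV by (intro nth_equalityI) auto
    then have "sum_list ns = length (filter ?P (concat V))"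
      by (simp add: filter_concat length_concat comp_def)
    also have "\<dots> = card (set (filter ?P (concat V)))"
      using V(1) distinct_card by (metis distinct_filter)
    also have "set (filter ?P (concat V)) = W" using V(2) by (auto simp: W_def)
    finally show ?thesis by simp
  qed
  let ?\<kappa> = "perm_inv \<pi> \<circ> \<sigma>"
  have \<kappa>: "?\<kappa> permutes D" using permutes_compose[OF d'(2) permutes_inv[OF d'(3)]] .
  have \<kappa>D: "?\<kappa> x \<in> D" if "x \<in> D" for x using permutes_in_image[OF \<kappa>] that by blast
  have \<pi>\<kappa>: "\<pi> (?\<kappa> x) = \<sigma> x" for x using d'(3) by (simp add: permutes_inverses)
  \<comment> \<open>The step from \<open>x\<close> to \<open>\<sigma> x\<close> passes through
    \<open>?\<kappa> x\<close>, since \<open>\<pi> (?\<kappa> x) = \<sigma> x\<close>. The sets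
    \<open>A\<close> and \<open>B'\<close> are the ascents on the two halves of this step;
    \<open>B'\<close> indexes by the start of the step the ascents of \<open>\<pi>\<close> collected
    in \<open>B\<close>.\<close>
  define A where "A = {x \<in> D. r x < r (?\<kappa> x)}"
  define B where "B = {x \<in> D. r x < r (\<pi> x)}"
  define B' where "B' = {x \<in> D. r (?\<kappa> x) < r (\<sigma> x)}"
  have fin: "finite A" "finite B" "finite B'" "finite W"
    using d'(1) by (simp_all add: A_def B_def B'_def W_def)
  have "card (cycle_sets ?\<kappa> D) \<le> card A"
  proof (rule card_le_of_disjoint[OF fin(1)])
    show "S \<inter> A \<noteq> {}" if S: "S \<in> cycle_sets ?\<kappa> D" for S
    proof
      assume empty: "S \<inter> A = {}"
      obtain ws where ws: "S = set ws" "is_cycle ?\<kappa> ws" "set ws \<subseteq> D"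
        using S by (auto simp: cycle_sets_def)
      then have hd: "hd ws \<in> set ws" by (simp add: is_cycle_def)
      let ?x = "hd ws"
      have x: "?x \<in> D" using hd ws(3) by blast
      \<comment> \<open>With constant rank, a letter of \<open>K\<close> and its cyclic successor
        would have the same colour, because \<open>\<pi>\<close> preserves colours. This contradicts
        \<open>adj\<close>.\<close>
      have "r (?\<kappa> ?x) = r ?x"
      proof (rule is_cycle_no_ascent[OF ws(2) _ hd])
        fix y assume "y \<in> set ws"
        then show "r (?\<kappa> y) \<le> r y" using empty ws(1,3) unfolding A_def by fastforce
      qed
      then have "fst (K ! r ?x) = c (?\<kappa> ?x)" using c_r[OF \<kappa>D[OF x]] by simp
      also have "\<dots> = c (\<sigma> ?x)" using d'(4) \<kappa>D[OF x] \<pi>\<kappa> by metis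
      also have "\<dots> = fst (K ! (Suc (r ?x) mod L))"
        using c_r[of "\<sigma> ?x"] x permutes_in_image[OF d'(2)] r_\<sigma>[OF x] by simp
      finally show False using adj[of "r ?x"] r_lt[of ?x] by (simp add: L_def)
    qed
  qed (rule cycle_sets_disjoint)
  moreover have "card (trivial_cycles g \<pi> D) \<le> card B"
  proof (rule card_le_of_disjoint[OF fin(2)])
    show "S \<inter> B \<noteq> {}" if S: "S \<in> trivial_cycles g \<pi> D" for S
    proof
      assume empty: "S \<inter> B = {}"
      obtain ws where ws: "S = set ws" "is_cycle \<pi> ws" "set ws \<subseteq> D" "list_product G (map g ws) = \<one>"
        using S by (auto simp: trivial_cycles_def)
      have le: "r (\<pi> y) \<le> r y" if "y \<in> set ws" for y
        using that empty ws(1,3) unfolding B_def by fastforce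
      have "r (\<pi> y) = r y" if "y \<in> set ws" for y
        using is_cycle_no_ascent[of \<pi> ws r, OF ws(2) le that] .
      then have "r y = r (hd ws)" if "y \<in> set ws" for y
        using is_cycle_const[of \<pi> ws r, OF ws(2) _ that] by blast
      \<comment> \<open>Constant rank makes all labels on the cycle equal, so the trivial product is
        a power of one letter, against \<open>tf\<close>.\<close>
      then have "map g ws = map (\<lambda>_. snd (K ! r (hd ws))) ws"
        using g_r ws(3) by (intro map_cong) auto
      then have m: "map g ws = replicate (length ws) (snd (K ! r (hd ws)))"
        by (simp add: map_replicate_const)
      have hd: "hd ws \<in> D" "length ws > 0" using ws(2,3) by (auto simp: is_cycle_def)
      have "snd (K ! r (hd ws)) \<in> carrier G" using g_r[OF hd(1)] d'(5) hd(1) by (metis image_subset_iff)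
      then have "snd (K ! r (hd ws)) [^] length ws = \<one>"
        using ws(4) m list_product_replicate by metis
      then show False using tf[OF _ hd(2)] r_lt[of "hd ws"] by (simp add: L_def)
    qed
    show "S = S'" if "S \<in> trivial_cycles g \<pi> D" "S' \<in> trivial_cycles g \<pi> D" "x \<in> S" "x \<in> S'"
      for S S' x
      using that by (intro cycle_sets_disjoint[of S \<pi> D S' D x] subsetD[OF trivial_cycles_subset])
  qed
  moreover have "card B \<le> card B'"
  proof -
    have "B \<subseteq> ?\<kappa> ` B'"
    proof
      fix y assume y: "y \<in> B"
      then have "y \<in> ?\<kappa> ` D" using permutes_image[OF \<kappa>] by (simp add: B_def)
      then obtain x where "x \<in> D" "y = ?\<kappa> x" by blast
      then show "y \<in> ?\<kappa> ` B'" using y \<pi>\<kappa>[of x] unfolding B_def B'_def by auto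
    qed
    then show ?thesis using surj_card_le[OF fin(3)] by blast
  qed
  moreover have "card A + card B' + card W \<le> card D"
  proof -
    \<comment> \<open>Along \<open>\<sigma>\<close> the rank rises by at most one, so no step has
      ascents on both halves. A step from top rank has none: its first half cannot rise, and it ends
      at rank 0.\<close>
    have "r (\<sigma> x) \<le> Suc (r x)" if "x \<in> D" for x
      using r_\<sigma>[OF that] by (simp add: mod_less_eq_dividend)
    then have "A \<inter> B' = {}" unfolding A_def B'_def by fastforce
    moreover have "r (\<sigma> x) = 0" if "x \<in> W" for x
      using r_\<sigma>[of x] that L by (simp add: W_def)
    then have "B' \<inter> W = {}" unfolding B'_def by fastforce
    moreover have "A \<inter> W = {}"
    proof -
      have "\<not> L - 1 < r y" for y using r_lt[of y] by simp
      then show ?thesis unfolding A_def W_def by fastforce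
    qed
    ultimately have "card (A \<union> B' \<union> W) = card A + card B' + card W"
      using fin by (subst card_Un_disjoint; simp add: card_Un_disjoint Int_Un_distrib2)
    moreover have "A \<union> B' \<union> W \<subseteq> D" by (auto simp: A_def B'_def W_def)
    ultimately show ?thesis using card_mono[OF d'(1)] by metis
  qed
  ultimately show ?thesis using d'(6) card_W by linarith
qed

end

section \<open>Words in the free product\<close>

context group
begin

lemma list_product_concat:
  "\<forall>W \<in> set Ws. is_word W \<Longrightarrow> word_prod (concat Ws) = list_product G (map word_prod Ws)"
proof (induction Ws)
  case (Cons W Ws)
  then have "is_word (concat Ws)"
    unfolding set_concat image_UN by (meson UN_least list.set_intros(2))
  then show ?case using Cons word_prod_append[of W "concat Ws"] by simp
qed simp

lemma word_prod_replicate: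
  assumes "is_word K"
  shows "word_prod (concat (replicate n K)) = word_prod K [^] n"
  using list_product_concat[of "replicate n K"] assms
  by (simp add: list_product_replicate word_prod_closed)

lemma conjugate_pow:
  assumes "x \<in> carrier G" "g \<in> carrier G"
  shows "(inv g \<otimes> x \<otimes> g) [^] (n::nat) = inv g \<otimes> x [^] n \<otimes> g"
  using assms by (induction n) (simp_all add: m_assoc)

lemma inv_list_product:
  "set xs \<subseteq> carrier G \<Longrightarrow> inv (list_product G xs) = list_product G (rev (map (\<lambda>x. inv x) xs))"
proof (induction xs)
  case (Cons x xs)
  have "set (rev (map (\<lambda>x. inv x) xs)) \<subseteq> carrier G" using Cons.prems by auto
  then show ?case using Cons by (simp add: inv_mult_group list_product_append)
qed simp

lemma list_product_filter_one:
  "set xs \<subseteq> carrier G \<Longrightarrow> list_product G (filter (\<lambda>x. x \<noteq> \<one>) xs) = list_product G xs"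
proof (induction xs)
  case (Cons x xs)
  then show ?case by (auto intro: list_product_closed)
qed simp

lemma commutators_closed: "commutators G \<subseteq> carrier G"
  by (auto simp: commutators_def comm_def)

text \<open>The inverse of \<open>comm G a b\<close> is \<open>comm G b a\<close>.\<close>

lemma inv_commutators: "x \<in> commutators G \<Longrightarrow> inv x \<in> commutators G"
proof -
  assume "x \<in> commutators G"
  then obtain a b where ab: "a \<in> carrier G" "b \<in> carrier G" "x = comm G a b"
    by (auto simp: commutators_def)
  then have "inv x = comm G b a"
    by (simp add: comm_def inv_mult_group m_assoc)
  then show ?thesis using ab by (auto simp: commutators_def)
qed

end

text \<open>The colour and the label of a letter in a diagram. The index is stored separately
  because \<open>factor_emb\<close> forgets it for the trivial element.\<close>

definition emb_letter :: "('i \<Rightarrow> ('a, 'b) monoid_scheme) \<Rightarrow> 'i \<times> 'a \<Rightarrow> 'i \<times> ('i \<times> 'a) list" where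
  "emb_letter G x = (fst x, factor_emb G (fst x) (snd x))"

lemma length_lmult: "length (lmult G x v) \<le> Suc (length v)"
  by (cases "(G, x, v)" rule: lmult.cases) auto

lemma length_foldr_lmult: "length (foldr (lmult G) u v) \<le> length u + length v"
proof (induction u)
  case (Cons x u)
  then show ?case using length_lmult[of G x "foldr (lmult G) u v"] by simp
qed simp

lemma reduced_words_letters: "u \<in> reduced_words I G \<Longrightarrow> set u \<subseteq> letters I G"
  by (simp add: reduced_words_def)

lemma not_reduced_word_cases:
  assumes "u \<notin> reduced_words I G" "set u \<subseteq> letters I G"
  obtains (one) X i Y where "u = X @ (i, \<one>\<^bsub>G i\<^esub>) # Y"
  | (adjacent) X i a b Y where "u = X @ (i, a) # (i, b) # Y"
proof (cases "\<exists>(i, a) \<in> set u. a = \<one>\<^bsub>G i\<^esub>")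
  case True
  then show thesis using one by (auto dest: split_list)
next
  case False
  then obtain k where k: "Suc k < length u" "fst (u ! k) = fst (u ! Suc k)"
    using assms unfolding reduced_words_def by blast
  have "u = take k u @ u ! k # u ! Suc k # drop (Suc (Suc k)) u"
    using k(1) by (metis Cons_nth_drop_Suc Suc_lessD append_take_drop_id)
  then show thesis using adjacent k(2) by (metis prod.collapse)
qed

section \<open>Words over the factors and the discs that trivial words bound\<close>

context
  fixes I :: "'i set" and G :: "'i \<Rightarrow> ('a, 'b) monoid_scheme"
  assumes groups: "\<And>i. i \<in> I \<Longrightarrow> group (G i)"
begin

interpretation F: group "free_product I G"
  using groups by (rule group_free_product)

private abbreviation (input) "F \<equiv> free_product I G"

lemma one_F: "\<one>\<^bsub>F\<^esub> = []" by (simp add: free_product_def)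

lemma carrier_F: "carrier F = reduced_words I G" by (simp add: free_product_def)

lemma mult_F: "u \<otimes>\<^bsub>F\<^esub> v = foldr (lmult G) u v" by (simp add: free_product_def)

lemma lmult_one_letter: "lmult G (i, \<one>\<^bsub>G i\<^esub>) v = v"
  by (rule lmult_one[of I]) (rule groups)

lemma factor_emb_group_hom: "i \<in> I \<Longrightarrow> group_hom (G i) F (factor_emb G i)"
  using factor_emb_hom[of I G i] groups F.is_group
  by (simp add: group_hom_def group_hom_axioms_def)

lemma factor_emb_closed: "i \<in> I \<Longrightarrow> a \<in> carrier (G i) \<Longrightarrow> factor_emb G i a \<in> carrier F"
  using group_hom.hom_closed[OF factor_emb_group_hom] .

lemma factor_emb_mult_F: "factor_emb G i a \<otimes>\<^bsub>F\<^esub> v = lmult G (i, a) v"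
  using lmult_one_letter[of i v] by (simp add: mult_F factor_emb_def)

lemma emb_letter_closed: "x \<in> letters I G \<Longrightarrow> snd (emb_letter G x) \<in> carrier F"
  by (auto simp: emb_letter_def letters_def intro: factor_emb_closed)

lemma word_prod_emb: "F.word_prod (map (emb_letter G) u) = foldr (lmult G) u []"
  by (induction u) (simp_all add: one_F emb_letter_def factor_emb_mult_F)

lemma letter_inv_emb:
  assumes "x \<in> letters I G"
  shows "F.letter_inv (emb_letter G x) \<in> emb_letter G ` letters I G"
proof -
  obtain i a where x: "x = (i, a)" "i \<in> I" "a \<in> carrier (G i)"
    using assms by (auto simp: letters_def)
  interpret Gi: group "G i" using groups x(2) .
  have "F.letter_inv (emb_letter G x) = emb_letter G (i, inv\<^bsub>G i\<^esub> a)"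
    using group_hom.hom_inv[OF factor_emb_group_hom[OF x(2)] x(3)] x(1)
    by (simp add: F.letter_inv_def emb_letter_def)
  then show ?thesis using x by (auto simp: letters_def)
qed

text \<open>A nonempty word with trivial product is not reduced, so it has a trivial letter or two
  neighbours from one factor. A disc for the shortened word is turned back into one for
  \<open>u\<close> by inserting or dividing a letter, which keeps the value
  \<open>-1\<close>.\<close>

lemma bounds_trivial_emb:
  assumes "set u \<subseteq> letters I G" "u \<noteq> []" "foldr (lmult G) u [] = []"
  shows "F.bounds [map (emb_letter G) u] (-1)"
  using assms
proof (induction "length u" arbitrary: u rule: less_induct)
  case less
  let ?e = "map (emb_letter G)"
  have "u \<notin> reduced_words I G"
    using foldr_lmult_Nil[of I G u, OF groups] less.prems by auto
  from this less.prems(1) show ?case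
  proof (cases rule: not_reduced_word_cases)
    case (one X i Y)
    have e: "emb_letter G (i, \<one>\<^bsub>G i\<^esub>) = (i, \<one>\<^bsub>F\<^esub>)"
      by (simp add: emb_letter_def factor_emb_def one_F)
    show ?thesis
    proof (cases "X @ Y = []")
      case True
      then show ?thesis using one e F.bounds_one[of i] by simp
    next
      case False
      have "foldr (lmult G) (X @ Y) [] = []"
        using less.prems(3) one lmult_one_letter by simp
      then have "F.bounds [?e (X @ Y)] (-1)"
        using less.hyps[of "X @ Y"] less.prems(1) one False by simp
      then have "F.bounds [?e Y @ ?e X] (-1)"
        using F.bounds_rotate[of "?e X" "?e Y" "[]"] by simp
      from F.bounds_insert_one[OF this, of i]
      have "F.bounds [((i, \<one>\<^bsub>F\<^esub>) # ?e Y) @ ?e X] (-1)" by simp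
      from F.bounds_rotate[OF this] show ?thesis using one e by simp
    qed
  next
    case (adjacent X i a b Y)
    have ab: "i \<in> I" "a \<in> carrier (G i)" "b \<in> carrier (G i)" "set Y \<subseteq> letters I G"
      using less.prems(1) adjacent by (auto simp: letters_def)
    interpret Gi: group "G i" using groups ab(1) .
    let ?u = "X @ (i, a \<otimes>\<^bsub>G i\<^esub> b) # Y"
    have "foldr (lmult G) Y [] \<in> reduced_words I G"
      using foldr_lmult_closed[of I G Y "[]", OF groups ab(4)] by simp
    then have "foldr (lmult G) ?u [] = []"
      using less.prems(3) adjacent lmult_lmult[of I G i a b, OF groups ab(1-3)] by simp
    then have "F.bounds [?e ?u] (-1)"
      using less.hyps[of ?u] less.prems(1) adjacent by (auto simp: letters_def)
    then have "F.bounds [?e X @ (i, factor_emb G i (a \<otimes>\<^bsub>G i\<^esub> b)) # ?e Y] (-1)"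
      by (simp add: emb_letter_def)
    from F.bounds_rotate[OF this]
    have "F.bounds [(i, factor_emb G i a \<otimes>\<^bsub>F\<^esub> factor_emb G i b) # ?e Y @ ?e X] (-1)"
      using group_hom.hom_mult[OF factor_emb_group_hom[OF ab(1)] ab(2,3)] by simp
    from F.bounds_divide[OF this factor_emb_closed[OF ab(1,2)] factor_emb_closed[OF ab(1,3)]]
    have "F.bounds [((i, factor_emb G i a) # (i, factor_emb G i b) # ?e Y) @ ?e X] (-1)" by simp
    from F.bounds_rotate[OF this] show ?thesis
      using adjacent by (simp add: emb_letter_def)
  qed
qed

definition is_factor_word :: "('i \<times> ('i \<times> 'a) list) list \<Rightarrow> bool" where
  "is_factor_word W \<longleftrightarrow> set W \<subseteq> emb_letter G ` letters I G"

lemma bounds_trivial: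
  assumes "is_factor_word W" "W \<noteq> []" "F.word_prod W = \<one>\<^bsub>F\<^esub>"
  shows "F.bounds [W] (-1)"
proof -
  have "W \<in> lists (emb_letter G ` letters I G)"
    using assms(1) by (auto simp: is_factor_word_def)
  then obtain u where "W = map (emb_letter G) u" "set u \<subseteq> letters I G"
    by (auto simp: lists_image)
  then show ?thesis
    using bounds_trivial_emb[of u] assms(2,3) by (simp add: word_prod_emb one_F)
qed

lemma is_factor_word_is_word: "is_factor_word W \<Longrightarrow> F.is_word W"
  using emb_letter_closed unfolding is_factor_word_def by blast

lemma is_factor_word_inv: "is_factor_word W \<Longrightarrow> is_factor_word (F.word_inv W)"
  using letter_inv_emb unfolding is_factor_word_def F.word_inv_def by auto

lemma ex_factor_word:
  assumes "I \<noteq> {}" "x \<in> carrier F"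
  shows "\<exists>W. W \<noteq> [] \<and> is_factor_word W \<and> F.word_prod W = x"
proof -
  obtain i where i: "i \<in> I" using assms(1) by blast
  interpret Gi: group "G i" using groups i .
  have "foldr (lmult G) x [] = x"
    using foldr_lmult_Nil[of I G x, OF groups] assms(2) by (simp add: carrier_F)
  moreover have "set x \<subseteq> letters I G"
    using assms(2) by (simp add: carrier_F reduced_words_letters)
  ultimately show ?thesis
    \<comment> \<open>The leading trivial letter makes the word nonempty even for the identity;
      splitting along a conjugator takes at least one letter.\<close>
    using i by (intro exI[of _ "map (emb_letter G) ((i, \<one>\<^bsub>G i\<^esub>) # x)"])
      (auto simp: is_factor_word_def word_prod_emb lmult_one_letter letters_def simp del: list.map)
qed

section \<open>Conjugacy into a factor and cyclic reduction\<close>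

lemma factor_elems_iff: "y \<in> factor_elems I G \<longleftrightarrow> (\<exists>i\<in>I. \<exists>a\<in>carrier (G i). y = factor_emb G i a)"
  by (auto simp: factor_elems_def)

lemma factor_elems_closed: "factor_elems I G \<subseteq> carrier F"
  using factor_emb_closed by (auto simp: factor_elems_iff)

text \<open>The direction of conjugation is reversed here, so that \<open>x\<close> is expressed
  through the factor element, as the words below require.\<close>

lemma conj_to_factor_iff:
  "conj_to_factor I G x \<longleftrightarrow> (\<exists>y\<in>factor_elems I G. \<exists>g\<in>carrier F. x = inv\<^bsub>F\<^esub> g \<otimes>\<^bsub>F\<^esub> y \<otimes>\<^bsub>F\<^esub> g)"
  (is "?L \<longleftrightarrow> ?R")
proof
  assume ?L
  then obtain y g where *: "y \<in> factor_elems I G" "x \<in> carrier F" "g \<in> carrier F"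
    "y = inv\<^bsub>F\<^esub> g \<otimes>\<^bsub>F\<^esub> x \<otimes>\<^bsub>F\<^esub> g"
    by (auto simp: conj_to_factor_def conjugate_def)
  then have "x = inv\<^bsub>F\<^esub> (inv\<^bsub>F\<^esub> g) \<otimes>\<^bsub>F\<^esub> y \<otimes>\<^bsub>F\<^esub> inv\<^bsub>F\<^esub> g"
    by (simp add: F.m_assoc)
  then show ?R using * F.inv_closed by blast
next
  assume ?R
  then obtain y g where *: "y \<in> factor_elems I G" "g \<in> carrier F"
    "x = inv\<^bsub>F\<^esub> g \<otimes>\<^bsub>F\<^esub> y \<otimes>\<^bsub>F\<^esub> g" by blast
  then have y: "y \<in> carrier F" using factor_elems_closed by blast
  then have "y = inv\<^bsub>F\<^esub> (inv\<^bsub>F\<^esub> g) \<otimes>\<^bsub>F\<^esub> x \<otimes>\<^bsub>F\<^esub> inv\<^bsub>F\<^esub> g"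
    using * by (simp add: F.m_assoc)
  moreover have "x \<in> carrier F" using * y by simp
  ultimately show ?L
    using *(1,2) y F.inv_closed unfolding conj_to_factor_def conjugate_def by blast
qed

lemma conj_to_factor_closed: "conj_to_factor I G x \<Longrightarrow> x \<in> carrier F"
  by (auto simp: conj_to_factor_def conjugate_def)

lemma conj_to_factor_conj:
  assumes "conj_to_factor I G x" "g \<in> carrier F"
  shows "conj_to_factor I G (inv\<^bsub>F\<^esub> g \<otimes>\<^bsub>F\<^esub> x \<otimes>\<^bsub>F\<^esub> g)"
proof -
  obtain y h where *: "y \<in> factor_elems I G" "h \<in> carrier F" "x = inv\<^bsub>F\<^esub> h \<otimes>\<^bsub>F\<^esub> y \<otimes>\<^bsub>F\<^esub> h"
    using assms(1) by (auto simp: conj_to_factor_iff)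
  moreover have "y \<in> carrier F" using *(1) factor_elems_closed by blast
  ultimately have "inv\<^bsub>F\<^esub> g \<otimes>\<^bsub>F\<^esub> x \<otimes>\<^bsub>F\<^esub> g = inv\<^bsub>F\<^esub> (h \<otimes>\<^bsub>F\<^esub> g) \<otimes>\<^bsub>F\<^esub> y \<otimes>\<^bsub>F\<^esub> (h \<otimes>\<^bsub>F\<^esub> g)"
    using assms(2) by (simp add: F.m_assoc F.inv_mult_group)
  then show ?thesis
    unfolding conj_to_factor_iff using * assms(2) F.m_closed by blast
qed

lemma factor_elems_conj_to_factor: "x \<in> factor_elems I G \<Longrightarrow> conj_to_factor I G x"
  unfolding conj_to_factor_iff using factor_elems_closed
  by (intro bexI[of _ x] bexI[of _ "\<one>\<^bsub>F\<^esub>"]) auto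

lemma conj_to_factor_inv:
  assumes "conj_to_factor I G x"
  shows "conj_to_factor I G (inv\<^bsub>F\<^esub> x)"
proof -
  obtain y h where *: "y \<in> factor_elems I G" "h \<in> carrier F" "x = inv\<^bsub>F\<^esub> h \<otimes>\<^bsub>F\<^esub> y \<otimes>\<^bsub>F\<^esub> h"
    using assms(1) by (auto simp: conj_to_factor_iff)
  then obtain i a where ia: "i \<in> I" "a \<in> carrier (G i)" "y = factor_emb G i a"
    by (auto simp: factor_elems_iff)
  interpret Gi: group "G i" using groups ia(1) .
  have "inv\<^bsub>F\<^esub> y = factor_emb G i (inv\<^bsub>G i\<^esub> a)"
    using group_hom.hom_inv[OF factor_emb_group_hom[OF ia(1)] ia(2)] ia(3) by simp
  then have "inv\<^bsub>F\<^esub> y \<in> factor_elems I G" using ia by (auto simp: factor_elems_iff)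
  moreover have "inv\<^bsub>F\<^esub> x = inv\<^bsub>F\<^esub> h \<otimes>\<^bsub>F\<^esub> inv\<^bsub>F\<^esub> y \<otimes>\<^bsub>F\<^esub> h"
    using * factor_elems_closed by (auto simp: F.inv_mult_group F.m_assoc)
  ultimately show ?thesis unfolding conj_to_factor_iff using *(2) by blast
qed

text \<open>As long as the first and last letters come from the same factor, moving the first one to
  the end merges the two and shortens the word. This cannot end in a word with at most one letter,
  since \<open>x\<close> is not conjugate into a factor.\<close>

lemma cyclically_reduced:
  assumes "I \<noteq> {}" "x \<in> carrier F" "\<not> conj_to_factor I G x"
  shows "\<exists>k\<in>carrier F. \<exists>g\<in>carrier F. x = inv\<^bsub>F\<^esub> g \<otimes>\<^bsub>F\<^esub> k \<otimes>\<^bsub>F\<^esub> g \<and> k \<noteq> [] \<and>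
    fst (hd k) \<noteq> fst (last k)"
  using assms(2,3)
proof (induction "length x" arbitrary: x rule: less_induct)
  case less
  have red: "x \<in> reduced_words I G" using less.prems(1) by (simp add: carrier_F)
  obtain i0 where i0: "i0 \<in> I" using assms(1) by blast
  interpret G0: group "G i0" using groups i0 .
  \<comment> \<open>This is where \<open>I \<noteq> {}\<close> enters: the identity lies in a factor
    as soon as there is one.\<close>
  have "[] \<in> factor_elems I G"
    using i0 by (auto simp: factor_elems_iff factor_emb_def intro!: bexI[of _ i0] bexI[of _ "\<one>\<^bsub>G i0\<^esub>"])
  then have ne: "x \<noteq> []" using factor_elems_conj_to_factor less.prems(2) by blast
  show ?case
  proof (cases "fst (hd x) = fst (last x)")
    case False
    then show ?thesis
      using less.prems(1) ne by (intro bexI[of _ x] bexI[of _ "\<one>\<^bsub>F\<^esub>"]) auto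
  next
    case True
    obtain i a y where x: "x = (i, a) # y" using ne by (cases x) auto
    then have ia: "i \<in> I" "a \<in> carrier (G i)" "a \<noteq> \<one>\<^bsub>G i\<^esub>" and y: "y \<in> carrier F"
      using red by (auto simp: reduced_words_Cons carrier_F)
    interpret Gi: group "G i" using groups ia(1) .
    let ?e = "factor_emb G i a"
    have e: "?e \<in> carrier F" "?e = [(i, a)]"
      using factor_emb_closed[OF ia(1,2)] ia(3) by (simp, simp add: factor_emb_def)
    have "y \<noteq> []"
    proof
      assume "y = []"
      then have "x = ?e" using x e(2) by simp
      then have "x \<in> factor_elems I G" using ia unfolding factor_elems_iff by blast
      then show False using factor_elems_conj_to_factor less.prems(2) by blast
    qed
    then obtain z j b where z: "y = z @ [(j, b)]" by (metis rev_exhaust surj_pair)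
    then have j: "j = i" using True x by simp
    have xe: "x = ?e \<otimes>\<^bsub>F\<^esub> y"
      using red x ia(3) by (cases y) (auto simp: factor_emb_mult_F reduced_words_Cons)
    let ?x = "y \<otimes>\<^bsub>F\<^esub> ?e"
    \<comment> \<open>The letter moved to the end is absorbed by the last letter
      \<open>(i, b)\<close>, so at most one letter remains of the two.\<close>
    have "length (foldr (lmult G) z (lmult G (i, b) [(i, a)])) \<le> length z + 1"
      using length_foldr_lmult[of G z "lmult G (i, b) [(i, a)]"] by (simp split: if_splits)
    then have "length ?x < length x"
      using x z j e(2) by (simp add: mult_F)
    moreover have "\<not> conj_to_factor I G ?x"
    proof
      assume "conj_to_factor I G ?x"
      from conj_to_factor_conj[OF this F.inv_closed[OF e(1)]]
      have "conj_to_factor I G x" using xe y e(1) by (simp add: F.m_assoc)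
      then show False using less.prems(2) by blast
    qed
    ultimately obtain k g where *: "k \<in> carrier F" "g \<in> carrier F"
      "?x = inv\<^bsub>F\<^esub> g \<otimes>\<^bsub>F\<^esub> k \<otimes>\<^bsub>F\<^esub> g" "k \<noteq> []" "fst (hd k) \<noteq> fst (last k)"
      using less.hyps[of ?x] y e(1) by auto
    have "x = ?e \<otimes>\<^bsub>F\<^esub> ?x \<otimes>\<^bsub>F\<^esub> inv\<^bsub>F\<^esub> ?e"
      using xe y e(1) by (simp add: F.m_assoc)
    also have "\<dots> = inv\<^bsub>F\<^esub> (g \<otimes>\<^bsub>F\<^esub> inv\<^bsub>F\<^esub> ?e) \<otimes>\<^bsub>F\<^esub> k \<otimes>\<^bsub>F\<^esub> (g \<otimes>\<^bsub>F\<^esub> inv\<^bsub>F\<^esub> ?e)"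
      unfolding *(3) using * e(1) by (simp add: F.m_assoc F.inv_mult_group)
    finally show ?thesis using * e(1) by (intro bexI[of _ k] bexI[of _ "g \<otimes>\<^bsub>F\<^esub> inv\<^bsub>F\<^esub> ?e"]) auto
  qed
qed

section \<open>From an equation in the free product to the bound\<close>

lemma factor_word_choice:
  assumes "I \<noteq> {}"
  shows "\<exists>wd. \<forall>x\<in>carrier F. wd x \<noteq> [] \<and> is_factor_word (wd x) \<and> F.word_prod (wd x) = x"
  using ex_factor_word[OF assms] by metis

lemma is_factor_word_append [simp]:
  "is_factor_word (A @ B) \<longleftrightarrow> is_factor_word A \<and> is_factor_word B"
  by (auto simp: is_factor_word_def)

lemma is_factor_word_concat:
  "(\<And>W. W \<in> set Ws \<Longrightarrow> is_factor_word W) \<Longrightarrow> is_factor_word (concat Ws)"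
  by (auto simp: is_factor_word_def)

lemma word_prod_concat_map:
  assumes "\<And>x. x \<in> set xs \<Longrightarrow> is_factor_word (f x) \<and> F.word_prod (f x) = h x"
  shows "F.word_prod (concat (map f xs)) = list_product F (map h xs)"
proof -
  have "map F.word_prod (map f xs) = map h xs" using assms by simp
  moreover have "\<forall>W\<in>set (map f xs). F.is_word W"
    using assms is_factor_word_is_word by auto
  ultimately show ?thesis using F.list_product_concat by metis
qed

lemma factor_torsion_free:
  assumes "torsion_free (G i)" "i \<in> I" "a \<in> carrier (G i)" "a \<noteq> \<one>\<^bsub>G i\<^esub>" "n > 0"
  shows "factor_emb G i a [^]\<^bsub>F\<^esub> (n::nat) \<noteq> \<one>\<^bsub>F\<^esub>"
proof -
  interpret Gi: group "G i" using groups assms(2) .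
  have "factor_emb G i (a [^]\<^bsub>G i\<^esub> n) = factor_emb G i a [^]\<^bsub>F\<^esub> n"
    using group_hom.hom_nat_pow[OF factor_emb_group_hom[OF assms(2)]] assms(3) by blast
  moreover have "a [^]\<^bsub>G i\<^esub> n \<noteq> \<one>\<^bsub>G i\<^esub>"
    using assms unfolding torsion_free_def by blast
  ultimately show ?thesis by (metis factor_emb_def list.distinct(1) one_F)
qed

text \<open>The equation yields a word that bounds a disc, with value \<open>-1\<close>. Taking off
  \<open>ds\<close>, \<open>cs\<close> and the powers adds \<open>length ds\<close>,
  \<open>2 * length cs\<close> and \<open>length hs - 1\<close>, and \<open>bounds_powers\<close>
  compares the total with the sum of the exponents.\<close>

lemma quasiperiodic_bound:
  assumes I: "I \<noteq> {}" and tf: "\<And>i. i \<in> I \<Longrightarrow> torsion_free (G i)"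
    and cs: "set cs \<subseteq> commutators F"
    and ds: "\<And>d. d \<in> set ds \<Longrightarrow> conj_to_factor I G d \<and> d \<noteq> \<one>\<^bsub>F\<^esub>"
    and k: "k \<in> carrier F" "k \<noteq> []" "fst (hd k) \<noteq> fst (last k)"
    and hs: "hs \<noteq> []" "\<And>g n. (g, n) \<in> set hs \<Longrightarrow> g \<in> carrier F \<and> n > 0"
    and eq: "list_product F ds \<otimes>\<^bsub>F\<^esub> (list_product F cs \<otimes>\<^bsub>F\<^esub>
      list_product F (map (\<lambda>(g, n). inv\<^bsub>F\<^esub> g \<otimes>\<^bsub>F\<^esub> k [^]\<^bsub>F\<^esub> (n::nat) \<otimes>\<^bsub>F\<^esub> g) hs)) = \<one>\<^bsub>F\<^esub>"
  shows "sum_list (map snd hs) + 2 \<le> 2 * length cs + length ds + length hs"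
proof -
  obtain wd where "\<forall>x\<in>carrier F. wd x \<noteq> [] \<and> is_factor_word (wd x) \<and> F.word_prod (wd x) = x"
    using factor_word_choice[OF I] ..
  then have wd: "wd x \<noteq> [] \<and> is_factor_word (wd x) \<and> F.word_prod (wd x) = x"
    if "x \<in> carrier F" for x
    using that by (rule bspec)
  have "\<forall>c\<in>set cs. \<exists>p. fst p \<in> carrier F \<and> snd p \<in> carrier F \<and> c = comm F (fst p) (snd p)"
  proof
    fix c assume "c \<in> set cs"
    then obtain x y where "x \<in> carrier F" "y \<in> carrier F" "c = comm F x y"
      using cs unfolding commutators_def by blast
    then show "\<exists>p. fst p \<in> carrier F \<and> snd p \<in> carrier F \<and> c = comm F (fst p) (snd p)"
      by (intro exI[of _ "(x, y)"]) simp
  qed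
  from bchoice[OF this] obtain cf where cf': "\<forall>c\<in>set cs.
      fst (cf c) \<in> carrier F \<and> snd (cf c) \<in> carrier F \<and> c = comm F (fst (cf c)) (snd (cf c))" ..
  note cf = bspec[OF cf']
  have "\<forall>d\<in>set ds. \<exists>p. fst p \<in> carrier F \<and> snd p \<in> emb_letter G ` letters I G \<and>
      d = inv\<^bsub>F\<^esub> (fst p) \<otimes>\<^bsub>F\<^esub> snd (snd p) \<otimes>\<^bsub>F\<^esub> fst p"
  proof
    fix d assume "d \<in> set ds"
    then obtain y g where y: "y \<in> factor_elems I G" and g: "g \<in> carrier F"
      "d = inv\<^bsub>F\<^esub> g \<otimes>\<^bsub>F\<^esub> y \<otimes>\<^bsub>F\<^esub> g"
      using ds[of d] unfolding conj_to_factor_iff by blast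
    from y obtain i a where "i \<in> I" "a \<in> carrier (G i)" and ya: "y = factor_emb G i a"
      unfolding factor_elems_iff by blast
    then have "emb_letter G (i, a) \<in> emb_letter G ` letters I G"
      by (intro imageI) (simp add: letters_def)
    with g ya show "\<exists>p. fst p \<in> carrier F \<and> snd p \<in> emb_letter G ` letters I G \<and>
        d = inv\<^bsub>F\<^esub> (fst p) \<otimes>\<^bsub>F\<^esub> snd (snd p) \<otimes>\<^bsub>F\<^esub> fst p"
      by (intro exI[of _ "(g, emb_letter G (i, a))"]) (simp add: emb_letter_def)
  qed
  from bchoice[OF this] obtain df where df': "\<forall>d\<in>set ds.
      fst (df d) \<in> carrier F \<and> snd (df d) \<in> emb_letter G ` letters I G \<and>
      d = inv\<^bsub>F\<^esub> (fst (df d)) \<otimes>\<^bsub>F\<^esub> snd (snd (df d)) \<otimes>\<^bsub>F\<^esub> fst (df d)" ..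
  note df = bspec[OF df']
  have df_closed: "snd (snd (df d)) \<in> carrier F" if "d \<in> set ds" for d
    using df[OF that] emb_letter_closed by auto
  define K where "K = map (emb_letter G) k"
  have kl: "set k \<subseteq> letters I G" using k(1) by (simp add: carrier_F reduced_words_letters)
  have K: "is_factor_word K" "K \<noteq> []" "F.word_prod K = k"
    using kl k(1,2) foldr_lmult_Nil[of I G k, OF groups]
    by (auto simp: is_factor_word_def K_def word_prod_emb carrier_F)
  \<comment> \<open>All conjugators are spelled out without reduction, in exactly the shape that the
    splitting moves take apart.\<close>
  define cw where "cw c = F.word_inv (wd (fst (cf c))) @ F.word_inv (wd (snd (cf c))) @
      wd (fst (cf c)) @ wd (snd (cf c))" for c
  define dw where "dw d = F.word_inv (wd (fst (df d))) @ [snd (df d)] @ wd (fst (df d))" for d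
  define hw where "hw p = F.word_inv (wd (fst p)) @ concat (replicate (snd p) K) @ wd (fst p)"
    for p :: "('i \<times> 'a) list \<times> nat"
  have cw: "is_factor_word (cw c) \<and> F.word_prod (cw c) = id c" if "c \<in> set cs" for c
  proof -
    note c = cf[OF that]
    note 1 = wd[OF c[THEN conjunct1]] wd[OF c[THEN conjunct2, THEN conjunct1]]
    have w: "F.is_word (wd (fst (cf c)))" "F.is_word (wd (snd (cf c)))"
      using 1 is_factor_word_is_word by blast+
    have "F.word_prod (cw c) = comm F (fst (cf c)) (snd (cf c))"
      using 1 w c F.is_word_inv[OF w(1)] F.is_word_inv[OF w(2)]
      unfolding cw_def comm_def
      by (simp add: F.word_prod_append F.word_prod_inv image_Un F.m_assoc)
    then show ?thesis
      using 1 c is_factor_word_inv by (simp add: cw_def)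
  qed
  have dw: "is_factor_word (dw d) \<and> F.word_prod (dw d) = id d" if "d \<in> set ds" for d
  proof -
    note d = df[OF that]
    note 1 = wd[OF d[THEN conjunct1]]
    have w: "F.is_word (wd (fst (df d)))" using 1 is_factor_word_is_word by blast
    have "F.word_prod (dw d) = inv\<^bsub>F\<^esub> (fst (df d)) \<otimes>\<^bsub>F\<^esub> snd (snd (df d)) \<otimes>\<^bsub>F\<^esub> fst (df d)"
      using 1 w d[THEN conjunct1] F.is_word_inv[OF w] df_closed[OF that]
      unfolding dw_def
      by (simp add: F.word_prod_append F.word_prod_inv F.m_assoc)
    then have "F.word_prod (dw d) = id d"
      using d by (metis id_apply)
    moreover have "is_factor_word [snd (df d)]"
      using d by (simp add: is_factor_word_def)
    ultimately show ?thesis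
      using 1 is_factor_word_inv unfolding dw_def by (simp only: is_factor_word_append simp_thms)
  qed
  let ?h = "\<lambda>(g, n). inv\<^bsub>F\<^esub> g \<otimes>\<^bsub>F\<^esub> k [^]\<^bsub>F\<^esub> (n::nat) \<otimes>\<^bsub>F\<^esub> g"
  have hw: "is_factor_word (hw p) \<and> F.word_prod (hw p) = ?h p" if "p \<in> set hs" for p
  proof -
    obtain g n where p: "p = (g, n)" by force
    have g: "g \<in> carrier F" using hs(2) that p by blast
    note 1 = wd[OF g]
    have w: "F.is_word (wd g)" using 1 is_factor_word_is_word by blast
    have Kn: "is_factor_word (concat (replicate n K))"
      using K(1) by (intro is_factor_word_concat) simp
    have "F.word_prod (hw p) = inv\<^bsub>F\<^esub> g \<otimes>\<^bsub>F\<^esub> (F.word_prod (concat (replicate n K)) \<otimes>\<^bsub>F\<^esub> g)"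
      using 1 w p F.is_word_inv[OF w] is_factor_word_is_word[OF Kn]
      unfolding hw_def by (simp add: F.word_prod_append F.word_prod_inv image_Un)
    also have "F.word_prod (concat (replicate n K)) = k [^]\<^bsub>F\<^esub> n"
      using F.word_prod_replicate[OF is_factor_word_is_word[OF K(1)]] K(3) by simp
    finally show ?thesis
      using 1 p g k(1) Kn is_factor_word_inv by (simp add: hw_def F.m_assoc)
  qed
  let ?C = "concat (map cw cs)" and ?D = "concat (map dw ds)" and ?H = "concat (map hw hs)"
  have fw: "is_factor_word ?C" "is_factor_word ?D" "is_factor_word ?H"
    using cw dw hw by (intro is_factor_word_concat; auto)+
  have ne: "?H \<noteq> []"
  proof -
    obtain g n hs' where "hs = (g, n) # hs'" using hs(1) by (cases hs) auto
    then show ?thesis using hs(2)[of g n] wd[of g] by (simp add: hw_def)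
  qed
  have "F.word_prod (?D @ ?C @ ?H) = F.word_prod ?D \<otimes>\<^bsub>F\<^esub> (F.word_prod ?C \<otimes>\<^bsub>F\<^esub> F.word_prod ?H)"
    using fw by (simp add: F.word_prod_append is_factor_word_is_word image_Un del: set_concat)
  also have "\<dots> = \<one>\<^bsub>F\<^esub>"
    using word_prod_concat_map[of cs cw id] word_prod_concat_map[of ds dw id]
      word_prod_concat_map[of hs hw ?h] cw dw hw eq by simp
  finally have "F.bounds [?D @ ?C @ ?H] (-1)"
    using fw ne by (intro bounds_trivial) auto
  moreover have "?D = concat (map (\<lambda>(P, e). F.word_inv P @ [e] @ P)
      (map (\<lambda>d. (wd (fst (df d)), snd (df d))) ds))"
    by (simp add: dw_def[abs_def] comp_def)
  \<comment> \<open>Since \<open>d\<close> is nontrivial, so is the label of its letter;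
    \<open>bounds_elliptics\<close> relies on this to drop the one-letter curve.\<close>
  moreover have "snd (snd (df d)) \<noteq> \<one>\<^bsub>F\<^esub>" if "d \<in> set ds" for d
  proof
    assume "snd (snd (df d)) = \<one>\<^bsub>F\<^esub>"
    then have "inv\<^bsub>F\<^esub> (fst (df d)) \<otimes>\<^bsub>F\<^esub> snd (snd (df d)) \<otimes>\<^bsub>F\<^esub> fst (df d) = \<one>\<^bsub>F\<^esub>"
      using df[OF that, THEN conjunct1] by simp
    then have "d = \<one>\<^bsub>F\<^esub>" using df[OF that] by metis
    then show False using ds[OF that] by blast
  qed
  ultimately have "F.bounds [?C @ ?H] (-1 + int (length ds))"
    using F.bounds_elliptics[of "map (\<lambda>d. (wd (fst (df d)), snd (df d))) ds" "?C @ ?H" "[]" "-1"]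
      ne df wd is_factor_word_is_word by auto
  moreover have "?C = concat (map (\<lambda>(X, Y). F.word_inv X @ F.word_inv Y @ X @ Y)
      (map (\<lambda>c. (wd (fst (cf c)), wd (snd (cf c)))) cs))"
    by (simp add: cw_def[abs_def] comp_def)
  ultimately have "F.bounds [?H] (-1 + int (length ds) + 2 * int (length cs))"
    using F.bounds_commutators[of "map (\<lambda>c. (wd (fst (cf c)), wd (snd (cf c)))) cs" ?H "[]"]
      ne cf wd is_factor_word_is_word by auto
  moreover have "?H = concat (map (\<lambda>(P, B). F.word_inv P @ B @ P)
      (map (\<lambda>p. (wd (fst p), concat (replicate (snd p) K))) hs))"
    by (simp add: hw_def[abs_def] comp_def)
  moreover have "\<forall>(P, B) \<in> set (map (\<lambda>p. (wd (fst p), concat (replicate (snd p) K))) hs).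
      P \<noteq> [] \<and> F.is_word P \<and> B \<noteq> []"
  proof -
    have "wd (fst p) \<noteq> [] \<and> F.is_word (wd (fst p)) \<and> concat (replicate (snd p) K) \<noteq> []"
      if "p \<in> set hs" for p
    proof -
      have "fst p \<in> carrier F" "snd p > 0" using hs(2)[of "fst p" "snd p"] that by simp_all
      then show ?thesis using wd[of "fst p"] is_factor_word_is_word[of "wd (fst p)"] K(2) by simp
    qed
    then show ?thesis by (simp only: set_map ball_simps split) blast
  qed
  \<comment> \<open>The \<open>-1\<close> of the disc and the \<open>- 1\<close> for the power that
    needs no splitting make up the \<open>+ 2\<close> of the claim.\<close>
  ultimately have "F.bounds (rev (map snd (map (\<lambda>p. (wd (fst p), concat (replicate (snd p) K))) hs)) @ [])
      (-1 + int (length ds) + 2 * int (length cs) + int (length hs) - 1)"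
    using F.bounds_conjugates[of "map (\<lambda>p. (wd (fst p), concat (replicate (snd p) K))) hs" "[]"
      "-1 + int (length ds) + 2 * int (length cs)"] hs(1)
    by simp
  then have "F.bounds (map (\<lambda>n. concat (replicate n K)) (rev (map snd hs)))
      (-1 + int (length ds) + 2 * int (length cs) + int (length hs) - 1)"
    by (simp add: rev_map comp_def)
  then have "int (sum_list (rev (map snd hs))) \<le>
      -1 + int (length ds) + 2 * int (length cs) + int (length hs) - 1"
  proof (rule F.bounds_powers[OF _ K(2)])
    fix j assume j: "j < length K"
    \<comment> \<open>Within the word this holds because \<open>k\<close> is reduced; from the last
      letter back to the first it is the cyclic condition on \<open>k\<close>.\<close>
    show "fst (K ! j) \<noteq> fst (K ! (Suc j mod length K))"
    proof (cases "Suc j < length k")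
      case True
      then have "fst (k ! j) \<noteq> fst (k ! Suc j)"
        using k(1) by (simp add: carrier_F reduced_words_def)
      then show ?thesis using True by (simp add: K_def emb_letter_def)
    next
      case False
      then have "length k = Suc j" using j by (simp add: K_def)
      then show ?thesis
        using k(2,3) by (simp add: K_def emb_letter_def hd_conv_nth last_conv_nth)
    qed
  next
    fix x and n :: nat assume "x \<in> set K" "n > 0"
    then obtain i a where ia: "(i, a) \<in> set k" "x = emb_letter G (i, a)" by (auto simp: K_def)
    then have "i \<in> I" "a \<in> carrier (G i)" "a \<noteq> \<one>\<^bsub>G i\<^esub>"
      using k(1) by (auto simp: carrier_F reduced_words_def letters_def)
    then show "snd x [^]\<^bsub>F\<^esub> n \<noteq> \<one>\<^bsub>F\<^esub>"
      using factor_torsion_free[of i a n] tf \<open>n > 0\<close> ia(2) by (simp add: emb_letter_def)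
  qed
  then show ?thesis by simp
qed

lemma list_product_conjugates:
  assumes "\<And>p. p \<in> set ps \<Longrightarrow> gf p \<in> carrier F \<and> fst p = inv\<^bsub>F\<^esub> (gf p) \<otimes>\<^bsub>F\<^esub> k \<otimes>\<^bsub>F\<^esub> gf p"
    "k \<in> carrier F"
  shows "map (\<lambda>(h, n). h [^]\<^bsub>F\<^esub> (n::nat)) ps =
    map (\<lambda>(g, n). inv\<^bsub>F\<^esub> g \<otimes>\<^bsub>F\<^esub> k [^]\<^bsub>F\<^esub> n \<otimes>\<^bsub>F\<^esub> g) (map (\<lambda>p. (gf p, snd p)) ps)"
proof -
  have "fst p [^]\<^bsub>F\<^esub> snd p = inv\<^bsub>F\<^esub> (gf p) \<otimes>\<^bsub>F\<^esub> k [^]\<^bsub>F\<^esub> snd p \<otimes>\<^bsub>F\<^esub> gf p"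
    if "p \<in> set ps" for p
    using F.conjugate_pow[OF assms(2), of "gf p" "snd p"] assms(1)[OF that] by metis
  then show ?thesis by (simp add: case_prod_beta)
qed

text \<open>All bases are conjugates of one cyclically reduced \<open>k\<close>. The mixed
  factorization is moved to the other side by inversion, which reverses its order and preserves both
  commutators and conjugates of factor elements.\<close>

lemma quasiperiodic_factorization_bound:
  assumes I: "I \<noteq> {}" and tf: "\<And>i. i \<in> I \<Longrightarrow> torsion_free (G i)"
    and mf: "mixed_factorization I G w cs ds" and qf: "quasiperiodic_factorization I G w ps"
  shows "(\<Sum>(h, n)\<leftarrow>ps. n - 1) + 2 \<le> 2 * length cs + length ds"
proof -
  obtain h0 n0 ps' where ps: "ps = (h0, n0) # ps'"
    using qf unfolding quasiperiodic_factorization_def by (cases ps) auto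
  have h0: "h0 \<in> carrier F" "\<not> conj_to_factor I G h0"
    using qf ps unfolding quasiperiodic_factorization_def by auto
  obtain k g0 where k: "k \<in> carrier F" "g0 \<in> carrier F" "h0 = inv\<^bsub>F\<^esub> g0 \<otimes>\<^bsub>F\<^esub> k \<otimes>\<^bsub>F\<^esub> g0"
    "k \<noteq> []" "fst (hd k) \<noteq> fst (last k)"
    using cyclically_reduced[OF I h0] by blast
  have "\<forall>p\<in>set ps. \<exists>g. g \<in> carrier F \<and> fst p = inv\<^bsub>F\<^esub> g \<otimes>\<^bsub>F\<^esub> k \<otimes>\<^bsub>F\<^esub> g"
  proof
    fix p assume p: "p \<in> set ps"
    have "conjugate F h0 (fst p)"
      using qf p ps unfolding quasiperiodic_factorization_def by fastforce
    then obtain g where g: "g \<in> carrier F" "fst p = inv\<^bsub>F\<^esub> g \<otimes>\<^bsub>F\<^esub> h0 \<otimes>\<^bsub>F\<^esub> g"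
      by (auto simp: conjugate_def)
    have "fst p = inv\<^bsub>F\<^esub> (g0 \<otimes>\<^bsub>F\<^esub> g) \<otimes>\<^bsub>F\<^esub> k \<otimes>\<^bsub>F\<^esub> (g0 \<otimes>\<^bsub>F\<^esub> g)"
      unfolding g(2) k(3) using g(1) k(1,2) by (simp add: F.m_assoc F.inv_mult_group)
    then show "\<exists>g. g \<in> carrier F \<and> fst p = inv\<^bsub>F\<^esub> g \<otimes>\<^bsub>F\<^esub> k \<otimes>\<^bsub>F\<^esub> g"
      using g(1) k(2) F.m_closed by blast
  qed
  from bchoice[OF this] obtain gf where
    gf': "\<forall>p\<in>set ps. gf p \<in> carrier F \<and> fst p = inv\<^bsub>F\<^esub> (gf p) \<otimes>\<^bsub>F\<^esub> k \<otimes>\<^bsub>F\<^esub> gf p" ..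
  note gf = bspec[OF gf']
  let ?hs = "map (\<lambda>p. (gf p, snd p)) ps"
  let ?h = "\<lambda>(g, n). inv\<^bsub>F\<^esub> g \<otimes>\<^bsub>F\<^esub> k [^]\<^bsub>F\<^esub> (n::nat) \<otimes>\<^bsub>F\<^esub> g"
  have w: "w = list_product F (map ?h ?hs)"
    using qf list_product_conjugates[of ps gf k, OF gf k(1)]
    unfolding quasiperiodic_factorization_def by metis
  have pos: "snd p > 0" if "p \<in> set ps" for p
    using qf that unfolding quasiperiodic_factorization_def by fastforce
  let ?cs = "rev (map (\<lambda>x. inv\<^bsub>F\<^esub> x) cs)" and ?ds = "rev (map (\<lambda>x. inv\<^bsub>F\<^esub> x) ds)"
  \<comment> \<open>Discarding trivial elements leaves the product unchanged and can only improve
    the bound.\<close>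
  let ?ds' = "filter (\<lambda>d. d \<noteq> \<one>\<^bsub>F\<^esub>) ?ds"
  have cs: "set cs \<subseteq> commutators F" and ds: "\<forall>d\<in>set ds. conj_to_factor I G d"
    and w': "w = list_product F (cs @ ds)"
    using mf by (simp_all add: mixed_factorization_def)
  have cl: "set cs \<subseteq> carrier F" "set ds \<subseteq> carrier F"
    using cs ds F.commutators_closed conj_to_factor_closed by blast+
  then have cl': "set ?cs \<subseteq> carrier F" "set ?ds \<subseteq> carrier F" by auto
  have wF: "w \<in> carrier F" using w' cl by (auto intro: F.list_product_closed)
  have "inv\<^bsub>F\<^esub> w = list_product F ?ds \<otimes>\<^bsub>F\<^esub> list_product F ?cs"
    using w' cl F.inv_list_product[of "cs @ ds"] F.list_product_append[OF cl'(2,1)] by simp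
  then have "list_product F ?ds' \<otimes>\<^bsub>F\<^esub> (list_product F ?cs \<otimes>\<^bsub>F\<^esub> w) = inv\<^bsub>F\<^esub> w \<otimes>\<^bsub>F\<^esub> w"
    using F.list_product_filter_one[OF cl'(2)] F.list_product_closed[OF cl'(1)]
      F.list_product_closed[OF cl'(2)] wF by (simp add: F.m_assoc)
  then have eq: "list_product F ?ds' \<otimes>\<^bsub>F\<^esub> (list_product F ?cs \<otimes>\<^bsub>F\<^esub> list_product F (map ?h ?hs)) = \<one>\<^bsub>F\<^esub>"
    using w wF by simp
  have "sum_list (map snd ?hs) + 2 \<le> 2 * length ?cs + length ?ds' + length ?hs"
  proof (rule quasiperiodic_bound[OF I tf _ _ k(1,4,5) _ _ eq])
    show "set ?cs \<subseteq> commutators F" using cs F.inv_commutators by auto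
    show "conj_to_factor I G d \<and> d \<noteq> \<one>\<^bsub>F\<^esub>" if "d \<in> set ?ds'" for d
      using that ds conj_to_factor_inv by auto
    show "g \<in> carrier F \<and> n > 0" if "(g, n) \<in> set ?hs" for g n
      using that gf pos by auto
  qed (use ps in simp_all)
  moreover have "length ?ds' \<le> length ds"
    using length_filter_le[of _ ?ds] by simp
  \<comment> \<open>Positive exponents make the truncated subtraction \<open>n - 1\<close> exact, so
    the number of powers cancels from both sides of the bound.\<close>
  moreover have "sum_list (map snd ps) = (\<Sum>(h, n)\<leftarrow>ps. n - 1) + length ps"
    using pos
  proof (induction ps)
    case (Cons p ps)
    then have "sum_list (map snd ps) = (\<Sum>(h, n)\<leftarrow>ps. n - 1) + length ps" "snd p > 0" by simp_all
    then show ?case by (cases p) simp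
  qed simp
  ultimately show ?thesis by (simp add: comp_def)
qed

text \<open>Each letter of \<open>w\<close> is a factor element, so no commutators are used and the
  mixed genus is at most \<open>length w\<close>.\<close>

lemma ex_mixed_factorization:
  assumes "w \<in> carrier F"
  shows "mixed_factorization I G w [] (map (\<lambda>x. [x]) w)"
proof -
  have "list_product F (map (\<lambda>x. [x]) w) = foldr (lmult G) w []"
    by (induction w) (simp_all add: one_F mult_F)
  also have "\<dots> = w"
    using foldr_lmult_Nil[of I G w, OF groups] assms by (simp add: carrier_F)
  finally have "w = list_product F (map (\<lambda>x. [x]) w)" by simp
  moreover have "conj_to_factor I G [x]" if "x \<in> set w" for x
  proof -
    obtain i a where x: "x = (i, a)" by force
    then have ia: "i \<in> I" "a \<in> carrier (G i)" "a \<noteq> \<one>\<^bsub>G i\<^esub>"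
      using that assms by (auto simp: carrier_F reduced_words_def letters_def)
    then have "[x] = factor_emb G i a" using x by (simp add: factor_emb_def)
    then have "[x] \<in> factor_elems I G" using ia unfolding factor_elems_iff by blast
    then show ?thesis by (rule factor_elems_conj_to_factor)
  qed
  ultimately show ?thesis by (simp add: mixed_factorization_def)
qed

text \<open>An element conjugate into a factor has a mixed factorization of weight one, and
  \<open>r + 2 \<le> 1\<close> holds for no value \<open>r\<close>. Any other \<open>w\<close> is
  its own quasiperiodic factorization, with exponent one.\<close>

lemma quasiperiodicity_values_empty_iff:
  assumes I: "I \<noteq> {}" and tf: "\<And>i. i \<in> I \<Longrightarrow> torsion_free (G i)" and w: "w \<in> carrier F"
  shows "quasiperiodicity_values I G w = {} \<longleftrightarrow> conj_to_factor I G w"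
proof
  assume "conj_to_factor I G w"
  then have "mixed_factorization I G w [] [w]"
    using w by (simp add: mixed_factorization_def)
  then show "quasiperiodicity_values I G w = {}"
    using quasiperiodic_factorization_bound[OF I tf, of w "[]" "[w]"]
    unfolding quasiperiodicity_values_def by fastforce
next
  assume empty: "quasiperiodicity_values I G w = {}"
  show "conj_to_factor I G w"
  proof (rule ccontr)
    assume "\<not> conj_to_factor I G w"
    then have "quasiperiodic_factorization I G w [(w, 1)]"
      using w unfolding quasiperiodic_factorization_def conjugate_def
      by (auto intro: bexI[of _ "\<one>\<^bsub>F\<^esub>"])
    then show False using empty unfolding quasiperiodicity_values_def by blast
  qed
qed

end

theorem corollary5:
  fixes I :: "'i set" and G :: "'i \<Rightarrow> ('a, 'b) monoid_scheme" and w :: "('i \<times> 'a) list"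
  assumes "I \<noteq> {}"
    and "\<And>i. i \<in> I \<Longrightarrow> group (G i)"
    and "\<And>i. i \<in> I \<Longrightarrow> torsion_free (G i)"
    and "w \<in> carrier (free_product I G)"
  shows "quasiperiodicity I G w \<le> mixed_genus I G w - 2 \<and> mixed_genus I G w - 2 < \<infinity> \<and>
    (quasiperiodicity I G w = - \<infinity> \<longleftrightarrow> conj_to_factor I G w) \<and>
    (\<not> conj_to_factor I G w \<longrightarrow> 0 \<le> quasiperiodicity I G w \<and> quasiperiodicity I G w < \<infinity>)"
proof -
  let ?R = "quasiperiodicity_values I G w"
  let ?M = "{ereal (real (2 * length cs + length ds)) | cs ds. mixed_factorization I G w cs ds}"
  note mf = ex_mixed_factorization[of I G w, OF assms(2,4)]
  have bound: "r + 2 \<le> 2 * length cs + length ds"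
    if "r \<in> ?R" "mixed_factorization I G w cs ds" for r cs ds
    using quasiperiodic_factorization_bound[of I G w cs ds, OF assms(2,1,3) that(2)] that(1)
    unfolding quasiperiodicity_values_def by blast
  have iff: "?R = {} \<longleftrightarrow> conj_to_factor I G w"
    using quasiperiodicity_values_empty_iff[of I G w, OF assms(2,1,3,4)] .
  \<comment> \<open>One mixed factorization is enough: the one into letters gives
    \<open>r + 2 \<le> length w\<close> for every value \<open>r\<close>.\<close>
  have bdd: "bdd_above ?R"
    using bound[OF _ mf] by (intro bdd_aboveI[of _ "length w"]) fastforce
  have "mixed_genus I G w \<le> ereal (real (length w))"
    unfolding mixed_genus_def using mf by (intro Inf_lower) force
  then have mg: "mixed_genus I G w - 2 < \<infinity>"
    by (cases "mixed_genus I G w") auto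
  \<comment> \<open>The maximum is attained by some quasiperiodic factorization, which is then
    compared with each mixed factorization under the infimum.\<close>
  have Max: "ereal (real (Max ?R)) \<le> mixed_genus I G w - 2" if "?R \<noteq> {}"
  proof -
    have "finite ?R" using bdd by (simp add: bdd_above_nat)
    then have "Max ?R \<in> ?R" using that by (rule Max_in)
    have "ereal (real (Max ?R + 2)) \<le> mixed_genus I G w"
      unfolding mixed_genus_def
    proof (rule Inf_greatest)
      fix x assume "x \<in> ?M"
      then obtain cs ds where x: "x = ereal (real (2 * length cs + length ds))"
        "mixed_factorization I G w cs ds" by blast
      show "ereal (real (Max ?R + 2)) \<le> x"
        unfolding x(1) ereal_less_eq of_nat_le_iff using bound[OF \<open>Max ?R \<in> ?R\<close> x(2)] .
    qed
    then show ?thesis by (cases "mixed_genus I G w") auto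
  qed
  show ?thesis
    using iff bdd mg Max unfolding quasiperiodicity_def Let_def by auto
qed

end
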